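(* Let $\Gamma$ be a finitely generated and recursively presented group. Then every $\Gamma$-subshift which is effectively closed by patterns is effective. Consequently, for a subshift $X\subset A^\Gamma$ (with $A$ a finite alphabet) the following three notions are equivalent: $X$ is an EDS; $X$ is effective; $X$ is effectively closed by patterns.
   Context: r.e. means recursively enumerable. For a finite symmetric generating set $S$ of $\Gamma$ and $w\in S^*$, $\underline w\in\Gamma$ is the element represented by $w$. A finitely generated group is recursively presented if for some (equivalently, any) such $S$ the set $\{w\in S^*:\underline w=1_\Gamma\}$ is r.e. Subshifts. $\Gamma$ acts on $A^\Gamma$ (prodiscrete topology) by $(gx)(h)=x(g^{-1}h)$; a $\Gamma$-subshift is a closed $\Gamma$-invariant subset. Effectively closed by patterns (ECP). Let $S$ be a finite generating set of $\Gamma$. A pattern coding is a partial function $c\colon S^*\to A$ with finite domain $\operatorname{supp}(c)$; its cylinder is $[c]=\{x\in A^\Gamma:x(\underline w)=c(w)\text{ for every }w\in\operatorname{supp}(c)\}$. For a set $\mathcal C$ of pattern codings, $X_{\mathcal C}=A^\Gamma\setminus\bigcup_{g\in\Gamma,c\in\mathcal C}g[c]$. A subshift $X\subset A^\Gamma$ is ECP if $X=X_{\mathcal C}$ for some r.e. set $\mathcal C$ of pattern codings. Effective subshift. Let $F(S)$ be the free group on $S$ and $\phi\colon F(S)\to\Gamma$ the canonical epimorphism. The pullback of $X\subset A^\Gamma$ is $\widehat X=\{x\circ\phi:x\in X\}\subset A^{F(S)}$. $X$ is effective if for some (equivalently any) finite generating set $S$ the set $\widehat X$ is effectively closed in $A^{F(S)}$,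 i.e. the set of patterns $p\colon W\to A$, $W\subset F(S)$ finite, such that no $y\in\widehat X$ satisfies $y|_W=p$ is r.e. EDS. A computable metric space is $(X,d,\mathcal{S})$ where $(X,d)$ is a separable metric space, $\mathcal{S}=\{s_i: i\ge 0\}$ is dense, and there is an algorithm which on input $(i,j,n)$ outputs $r\in\mathbb{Q}$ with $|d(s_i,s_j)-r|\le 2^{-n}$. Basic balls are open balls centered at points of $\mathcal{S}$ with positive rational radius; fix a computable enumeration $(B_n)_{n\in\mathbb{N}}$ of them and put $U_I=\bigcup_{n\in I}B_n$. A compact set $K\subset X$ is recursively compact if there is an algorithm which, given a finite $I\subset\mathbb{N}$, halts iff $K\subset U_I$. A map $f\colon Y\subset X\to X'$ between computable metric spaces is computable if there is an algorithm which, given $m$, enumerates $I_m$ with $f^{-1}(B'_m)=U_{I_m}\cap Y$, where $(B'_m)_m$ enumerates the basic balls of $X'$. An action of a finitely generated group by homeomorphisms on a recursively compact subset of a computable metric space is computable if for some (equivalently any) finite generating set each generator acts by a computable map. An action of a finitely generated group on a compact metrizable space is an effective dynamical system (EDS) if it is topologically conjugate (equivariantly homeomorphic) to a computable action on some recursively compact subset of a computable metric space. *)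

theory Defs
  imports
    "HOL-Analysis.Analysis"
    "HOL-Library.Nat_Bijection"
    "HOL-Library.Countable_Set"
    "HOL-Algebra.Generated_Groups"
    "HOL-Algebra.Group_Action"
begin

section \<open>Computability\<close>

text \<open>Kleene's partial recursive functions on tuples of natural numbers.  The relation
  \<open>rec_eval f xs y\<close> says that the algorithm \<open>f\<close> halts on input \<open>xs\<close> with output \<open>y\<close>.\<close>

datatype recf =
    Zero
  | Succ
  | Proj nat
  | Comp recf "recf list"
  | PrimRec recf recf
  | Mu recf

inductive rec_eval :: "recf \<Rightarrow> nat list \<Rightarrow> nat \<Rightarrow> bool" where
  Zero: "rec_eval Zero xs 0"
| Succ: "rec_eval Succ [x] (Suc x)"
| Proj: "i < length xs \<Longrightarrow> rec_eval (Proj i) xs (xs ! i)"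
| Comp: "\<lbrakk>list_all2 (\<lambda>g y. rec_eval g xs y) gs ys; rec_eval f ys z\<rbrakk>
           \<Longrightarrow> rec_eval (Comp f gs) xs z"
| PrimRec_0: "rec_eval f xs y \<Longrightarrow> rec_eval (PrimRec f g) (0 # xs) y"
| PrimRec_Suc: "\<lbrakk>rec_eval (PrimRec f g) (n # xs) y; rec_eval g (n # y # xs) z\<rbrakk>
           \<Longrightarrow> rec_eval (PrimRec f g) (Suc n # xs) z"
| Mu: "\<lbrakk>rec_eval f (n # xs) 0; \<And>m. m < n \<Longrightarrow> \<exists>y>0. rec_eval f (m # xs) y\<rbrakk>
           \<Longrightarrow> rec_eval (Mu f) xs n"

lemma rec_eval_deterministic:
  "rec_eval f xs y \<Longrightarrow> rec_eval f xs z \<Longrightarrow> z = y"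
proof (induction arbitrary: z rule: rec_eval.induct)
  case (Comp xs gs ys f z z')
  from Comp.prems obtain zs
    where zs: "list_all2 (\<lambda>g y. rec_eval g xs y) gs zs" "rec_eval f zs z'"
    by cases auto
  have "zs = ys"
    using Comp.IH(1) zs(1) by (auto simp: list_all2_conv_all_nth intro!: nth_equalityI)
  with Comp.IH(2) zs(2) show ?case by blast
next
  case (PrimRec_0 f xs y g)
  from PrimRec_0.prems show ?case by cases (auto intro: PrimRec_0.IH)
next
  case (PrimRec_Suc f g n xs y z)
  from PrimRec_Suc.prems show ?case
    by cases (use PrimRec_Suc.IH in blast)
next
  case (Mu f n xs)
  from Mu.prems obtain "rec_eval f (z # xs) 0"
    and less: "\<And>m. m < z \<Longrightarrow> \<exists>y>0. rec_eval f (m # xs) y"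
    by cases auto
  have "\<not> n < z" using less Mu.IH(1) by blast
  moreover have "\<not> z < n"
    using Mu.IH(2) \<open>rec_eval f (z # xs) 0\<close> by blast
  ultimately show ?case by simp
qed (auto elim: rec_eval.cases)

definition re_set :: "nat set \<Rightarrow> bool" where
  "re_set N \<longleftrightarrow> (\<exists>f. \<forall>n. n \<in> N \<longleftrightarrow> (\<exists>y. rec_eval f [n] y))"

text \<open>Words over a finite alphabet \<open>T\<close>, and finite partial functions from words to a finite
  set \<open>A\<close>, are represented by natural numbers.  The numbering \<open>to_nat_on T\<close> of a finite alphabet
  is an arbitrary bijection onto an initial segment of the natural numbers; any two such
  numberings differ by a finite permutation, so that the choice does not affect which sets are
  recursively enumerable.\<close>

definition word_code :: "'t set \<Rightarrow> 't list \<Rightarrow> nat" where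
  "word_code T w = list_encode (map (to_nat_on T) w)"

definition pattern_code :: "'t set \<Rightarrow> 'a set \<Rightarrow> ('t list \<rightharpoonup> 'a) \<Rightarrow> nat" where
  "pattern_code T A p =
     set_encode ((\<lambda>(w, a). prod_encode (word_code T w, to_nat_on A a)) ` Map.graph p)"

definition re_words :: "'t set \<Rightarrow> 't list set \<Rightarrow> bool" where
  "re_words T L \<longleftrightarrow> re_set (word_code T ` L)"

definition re_patterns :: "'t set \<Rightarrow> 'a set \<Rightarrow> ('t list \<rightharpoonup> 'a) set \<Rightarrow> bool" where
  "re_patterns T A P \<longleftrightarrow> re_set (pattern_code T A ` P)"


section \<open>Finitely generated groups\<close>

definition fin_gen_set :: "('g, 'b) monoid_scheme \<Rightarrow> 'g set \<Rightarrow> bool" where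
  "fin_gen_set G S \<longleftrightarrow> finite S \<and> S \<subseteq> carrier G \<and> generate G S = carrier G"

definition fin_sym_gen_set :: "('g, 'b) monoid_scheme \<Rightarrow> 'g set \<Rightarrow> bool" where
  "fin_sym_gen_set G S \<longleftrightarrow> fin_gen_set G S \<and> (\<forall>s\<in>S. inv\<^bsub>G\<^esub> s \<in> S)"

definition finitely_generated :: "('g, 'b) monoid_scheme \<Rightarrow> bool" where
  "finitely_generated G \<longleftrightarrow> (\<exists>S. fin_gen_set G S)"

definition word_val :: "('g, 'b) monoid_scheme \<Rightarrow> 'g list \<Rightarrow> 'g" where
  "word_val G w = foldr (\<lambda>s x. s \<otimes>\<^bsub>G\<^esub> x) w \<one>\<^bsub>G\<^esub>"

definition recursively_presented :: "('g, 'b) monoid_scheme \<Rightarrow> bool" where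
  "recursively_presented G \<longleftrightarrow>
     (\<exists>S. fin_sym_gen_set G S \<and> re_words S {w \<in> lists S. word_val G w = \<one>\<^bsub>G\<^esub>})"


section \<open>Free groups\<close>

text \<open>The free group on \<open>S\<close> consists of the reduced words in the letters \<open>(s, True)\<close>, standing
  for \<open>s\<close>, and \<open>(s, False)\<close>, standing for the formal inverse of \<open>s\<close>.\<close>

definition flip :: "'s \<times> bool \<Rightarrow> 's \<times> bool" where
  "flip x = (fst x, \<not> snd x)"

fun reduced :: "('s \<times> bool) list \<Rightarrow> bool" where
  "reduced (x # y # w) \<longleftrightarrow> y \<noteq> flip x \<and> reduced (y # w)"
| "reduced w \<longleftrightarrow> True"

fun push :: "'s \<times> bool \<Rightarrow> ('s \<times> bool) list \<Rightarrow> ('s \<times> bool) list" where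
  "push x [] = [x]"
| "push x (y # w) = (if y = flip x then w else x # y # w)"

definition free_group :: "'s set \<Rightarrow> ('s \<times> bool) list monoid" where
  "free_group S =
     \<lparr>carrier = {w \<in> lists (S \<times> UNIV). reduced w}, monoid.mult = foldr push, one = []\<rparr>"

text \<open>The canonical homomorphism from the free group on a subset of \<open>G\<close> to \<open>G\<close>.\<close>

definition free_eval :: "('g, 'b) monoid_scheme \<Rightarrow> ('g \<times> bool) list \<Rightarrow> 'g" where
  "free_eval G w = word_val G (map (\<lambda>(s, b). if b then s else inv\<^bsub>G\<^esub> s) w)"

lemma flip_flip [simp]: "flip (flip x) = x"
  by (simp add: flip_def)

lemma flip_neq [simp]: "flip x \<noteq> x" "x \<noteq> flip x"
  by (auto simp: flip_def prod_eq_iff)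

lemma reduced_ConsD: "reduced (x # w) \<Longrightarrow> reduced w"
  by (cases w) auto

lemma reduced_push: "reduced w \<Longrightarrow> reduced (push x w)"
  by (cases w) (auto dest: reduced_ConsD)

lemma push_push_flip: "reduced w \<Longrightarrow> push x (push (flip x) w) = w"
  by (cases w; cases "tl w") auto

lemma push_reduced: "reduced (x # w) \<Longrightarrow> push x w = x # w"
  by (cases w) auto

lemma reduced_foldr_push: "reduced w \<Longrightarrow> reduced (foldr push v w)"
  by (induction v) (auto intro: reduced_push)

lemma foldr_push_push:
  assumes "reduced w"
  shows "foldr push (push x v) w = push x (foldr push v w)"
proof (cases v)
  case (Cons y u)
  show ?thesis
    using push_push_flip[OF reduced_foldr_push[OF assms], of x u] Cons by auto
qed simp

lemma foldr_push_foldr: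
  "reduced w \<Longrightarrow> foldr push (foldr push u v) w = foldr push u (foldr push v w)"
  by (induction u) (auto simp: foldr_push_push)

lemma push_in_lists:
  "x \<in> S \<times> UNIV \<Longrightarrow> w \<in> lists (S \<times> UNIV) \<Longrightarrow> push x w \<in> lists (S \<times> UNIV)"
  by (cases w) auto

lemma foldr_push_in_lists:
  "u \<in> lists (S \<times> UNIV) \<Longrightarrow> w \<in> lists (S \<times> UNIV) \<Longrightarrow> foldr push u w \<in> lists (S \<times> UNIV)"
proof (induction u)
  case (Cons x u)
  then show ?case using push_in_lists[of x S "foldr push u w"] by (simp del: in_lists_conv_set)
qed simp

lemma foldr_push_Nil: "reduced w \<Longrightarrow> foldr push w [] = w"
proof (induction w)
  case (Cons x w)
  then show ?case using push_reduced[OF Cons.prems] reduced_ConsD[OF Cons.prems] by simp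
qed simp

lemma foldr_push_inverse: "foldr push (rev (map flip w)) w = []" if "reduced w" for w
proof -
  have "foldr push (rev (map flip w)) (foldr push w v) = v" if "reduced v" for v
    using that
  proof (induction w arbitrary: v)
    case (Cons x w)
    have "push (flip x) (push x (foldr push w v)) = foldr push w v"
      using push_push_flip[of "foldr push w v" "flip x"] reduced_foldr_push[OF Cons.prems]
      by simp
    then show ?case using Cons by simp
  qed simp
  from this[of "[]"] show ?thesis using foldr_push_Nil[OF that] by simp
qed

lemma group_free_group: "group (free_group S)"
proof (rule groupI)
  fix x assume "x \<in> carrier (free_group S)"
  then have x: "x \<in> lists (S \<times> UNIV)" "reduced x"
    by (simp_all add: free_group_def)
  define y where "y = foldr push (rev (map flip x)) []"
  have "rev (map flip x) \<in> lists (S \<times> UNIV)"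
    using x(1) by (induction x) (auto simp: flip_def)
  then have "y \<in> carrier (free_group S)"
    unfolding y_def free_group_def
    using foldr_push_in_lists[of _ S "[]"] reduced_foldr_push[of "[]"] by simp
  moreover have "foldr push y x = []"
    unfolding y_def using foldr_push_foldr[OF x(2)] foldr_push_inverse[OF x(2)] by simp
  ultimately show "\<exists>y\<in>carrier (free_group S). y \<otimes>\<^bsub>free_group S\<^esub> x = \<one>\<^bsub>free_group S\<^esub>"
    by (auto simp: free_group_def)
next
  fix x y assume "x \<in> carrier (free_group S)" "y \<in> carrier (free_group S)"
  then show "x \<otimes>\<^bsub>free_group S\<^esub> y \<in> carrier (free_group S)"
    using foldr_push_in_lists[of x S y] reduced_foldr_push[of y x]
    by (simp add: free_group_def del: in_lists_conv_set)
next
  fix x y z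
  assume "x \<in> carrier (free_group S)" "y \<in> carrier (free_group S)" "z \<in> carrier (free_group S)"
  then show "x \<otimes>\<^bsub>free_group S\<^esub> y \<otimes>\<^bsub>free_group S\<^esub> z =
      x \<otimes>\<^bsub>free_group S\<^esub> (y \<otimes>\<^bsub>free_group S\<^esub> z)"
    using foldr_push_foldr[of z x y] by (simp add: free_group_def)
qed (simp_all add: free_group_def)

lemma free_eval_hom:
  fixes G (structure)
  assumes "group G" "S \<subseteq> carrier G"
  shows "free_eval G \<in> hom (free_group S) G"
proof -
  interpret group G by fact
  let ?v = "\<lambda>(s, b). if b then s else inv s"
  have v: "?v x \<in> carrier G" if "x \<in> S \<times> UNIV" for x
    using that assms(2) by auto
  have Nil: "free_eval G [] = \<one>"
    by (simp add: free_eval_def word_val_def)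
  have Cons: "free_eval G (x # w) = ?v x \<otimes> free_eval G w" for x w
    by (simp add: free_eval_def word_val_def)
  have closed: "free_eval G w \<in> carrier G" if "w \<in> lists (S \<times> UNIV)" for w
    using that by (induction w) (use Nil Cons v in auto)
  have push: "free_eval G (push x w) = ?v x \<otimes> free_eval G w"
    if x: "x \<in> S \<times> UNIV" and w: "w \<in> lists (S \<times> UNIV)" for x w
  proof (cases "\<exists>u. w = flip x # u")
    case True
    then obtain u where u: "w = flip x # u" by blast
    have c: "free_eval G u \<in> carrier G" using w u closed by auto
    have "?v x \<otimes> (?v (flip x) \<otimes> free_eval G u) = free_eval G u"
      using x c assms(2) by (auto simp: flip_def m_assoc[symmetric])
    then show ?thesis using u Cons by simp
  next
    case False
    then show ?thesis using Cons by (cases w) auto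
  qed
  have "free_eval G (foldr push u w) = free_eval G u \<otimes> free_eval G w"
    if "u \<in> lists (S \<times> UNIV)" "w \<in> lists (S \<times> UNIV)" for u w
    using that(1)
  proof (induction u)
    case Nil
    then show ?case using closed[OF that(2)] \<open>free_eval G [] = \<one>\<close> by simp
  next
    case (Cons x u)
    then show ?case
      using push[OF _ foldr_push_in_lists[OF _ that(2)], of x u] v[of x] closed[of u]
        closed[OF that(2)] \<open>\<And>x w. free_eval G (x # w) = ?v x \<otimes> free_eval G w\<close>
      by (simp add: m_assoc del: in_lists_conv_set)
  qed
  then show ?thesis
    unfolding hom_def free_group_def using closed by auto
qed


section \<open>Subshifts\<close>

definition full_shift :: "('g, 'b) monoid_scheme \<Rightarrow> 'a set \<Rightarrow> ('g \<Rightarrow> 'a) topology" where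
  "full_shift G A = product_topology (\<lambda>_. discrete_topology A) (carrier G)"

definition shift :: "('g, 'b) monoid_scheme \<Rightarrow> 'g \<Rightarrow> ('g \<Rightarrow> 'a) \<Rightarrow> ('g \<Rightarrow> 'a)" where
  "shift G g x = (\<lambda>h\<in>carrier G. x (inv\<^bsub>G\<^esub> g \<otimes>\<^bsub>G\<^esub> h))"

definition subshift :: "('g, 'b) monoid_scheme \<Rightarrow> 'a set \<Rightarrow> ('g \<Rightarrow> 'a) set \<Rightarrow> bool" where
  "subshift G A X \<longleftrightarrow>
     closedin (full_shift G A) X \<and> (\<forall>g\<in>carrier G. \<forall>x\<in>X. shift G g x \<in> X)"

definition finite_patterns :: "'w set \<Rightarrow> 'a set \<Rightarrow> ('w \<rightharpoonup> 'a) set" where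
  "finite_patterns W A = {p. finite (dom p) \<and> dom p \<subseteq> W \<and> ran p \<subseteq> A}"

definition cylinder ::
    "('g, 'b) monoid_scheme \<Rightarrow> 'a set \<Rightarrow> ('g list \<rightharpoonup> 'a) \<Rightarrow> ('g \<Rightarrow> 'a) set" where
  "cylinder G A c =
     {x \<in> carrier G \<rightarrow>\<^sub>E A. \<forall>w\<in>dom c. c w = Some (x (word_val G w))}"

definition avoiding ::
    "('g, 'b) monoid_scheme \<Rightarrow> 'a set \<Rightarrow> ('g list \<rightharpoonup> 'a) set \<Rightarrow> ('g \<Rightarrow> 'a) set" where
  "avoiding G A C =
     (carrier G \<rightarrow>\<^sub>E A) - (\<Union>g\<in>carrier G. \<Union>c\<in>C. shift G g ` cylinder G A c)"

text \<open>Words use the generators only, not formal inverses, so that the generating set has to be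
  symmetric for every element of the group to be the value of a word.\<close>

definition ecp :: "('g, 'b) monoid_scheme \<Rightarrow> 'a set \<Rightarrow> ('g \<Rightarrow> 'a) set \<Rightarrow> bool" where
  "ecp G A X \<longleftrightarrow>
     (\<exists>S C. fin_sym_gen_set G S \<and> C \<subseteq> finite_patterns (lists S) A \<and>
        re_patterns S A C \<and> X = avoiding G A C)"

definition pullback ::
    "('g, 'b) monoid_scheme \<Rightarrow> 'g set \<Rightarrow> ('g \<Rightarrow> 'a) set \<Rightarrow> (('g \<times> bool) list \<Rightarrow> 'a) set" where
  "pullback G S X = (\<lambda>x. \<lambda>w\<in>carrier (free_group S). x (free_eval G w)) ` X"

definition effective :: "('g, 'b) monoid_scheme \<Rightarrow> 'a set \<Rightarrow> ('g \<Rightarrow> 'a) set \<Rightarrow> bool" where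
  "effective G A X \<longleftrightarrow>
     (\<exists>S. fin_gen_set G S \<and>
        re_patterns (S \<times> UNIV) A
          {p \<in> finite_patterns (carrier (free_group S)) A.
             \<not> (\<exists>y\<in>pullback G S X. \<forall>w\<in>dom p. p w = Some (y w))})"


section \<open>Effective dynamical systems\<close>

locale computable_metric_space = Metric_space M d
  for M :: "'m set" and d :: "'m \<Rightarrow> 'm \<Rightarrow> real" +
  fixes s :: "nat \<Rightarrow> 'm"
  assumes s_in: "range s \<subseteq> M"
    and s_dense: "Abstract_Topology.closure_of mtopology (range s) = M"
    and computable_dist:
      "\<exists>f. \<forall>i j n. \<exists>r. rec_eval f [i, j, n] r \<and>
         \<bar>d (s i) (s j) - of_rat (nat_to_rat_surj r)\<bar> \<le> 1 / 2 ^ n"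

text \<open>The computable enumeration of the basic balls: \<open>n\<close> encodes a pair of a centre \<open>s i\<close>
  and of a radius \<open>(a + 1) / (b + 1)\<close>.\<close>

definition basic_ball ::
    "'m set \<Rightarrow> ('m \<Rightarrow> 'm \<Rightarrow> real) \<Rightarrow> (nat \<Rightarrow> 'm) \<Rightarrow> nat \<Rightarrow> 'm set" where
  "basic_ball M d s n =
     (let (i, k) = prod_decode n; (a, b) = prod_decode k
      in Metric_space.mball M d (s i) (real (Suc a) / real (Suc b)))"

definition basic_union ::
    "'m set \<Rightarrow> ('m \<Rightarrow> 'm \<Rightarrow> real) \<Rightarrow> (nat \<Rightarrow> 'm) \<Rightarrow> nat set \<Rightarrow> 'm set" where
  "basic_union M d s I = (\<Union>n\<in>I. basic_ball M d s n)"

definition recursively_compact ::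
    "'m set \<Rightarrow> ('m \<Rightarrow> 'm \<Rightarrow> real) \<Rightarrow> (nat \<Rightarrow> 'm) \<Rightarrow> 'm set \<Rightarrow> bool" where
  "recursively_compact M d s K \<longleftrightarrow>
     compactin (Metric_space.mtopology M d) K \<and>
     re_set (set_encode ` {I. finite I \<and> K \<subseteq> basic_union M d s I})"

text \<open>An algorithm enumerating \<open>I\<^sub>m\<close> on input \<open>m\<close> amounts to a recursively enumerable set \<open>R\<close>
  of pairs \<open>(m, n)\<close>, with \<open>I\<^sub>m\<close> the section of \<open>R\<close> at \<open>m\<close>.\<close>

definition computable_map ::
    "'m set \<Rightarrow> ('m \<Rightarrow> 'm \<Rightarrow> real) \<Rightarrow> (nat \<Rightarrow> 'm) \<Rightarrow> 'm set \<Rightarrow>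
     'k set \<Rightarrow> ('k \<Rightarrow> 'k \<Rightarrow> real) \<Rightarrow> (nat \<Rightarrow> 'k) \<Rightarrow> ('m \<Rightarrow> 'k) \<Rightarrow> bool" where
  "computable_map M d s Y M' d' s' f \<longleftrightarrow>
     f \<in> Y \<rightarrow> M' \<and>
     (\<exists>R. re_set (prod_encode ` R) \<and>
        (\<forall>m. {y \<in> Y. f y \<in> basic_ball M' d' s' m} =
              basic_union M d s {n. (m, n) \<in> R} \<inter> Y))"

definition computable_action ::
    "('g, 'b) monoid_scheme \<Rightarrow> 'm set \<Rightarrow> ('m \<Rightarrow> 'm \<Rightarrow> real) \<Rightarrow> (nat \<Rightarrow> 'm) \<Rightarrow> 'm set \<Rightarrow>
     ('g \<Rightarrow> 'm \<Rightarrow> 'm) \<Rightarrow> bool" where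
  "computable_action G M d s K \<alpha> \<longleftrightarrow>
     group_action G K \<alpha> \<and>
     (\<forall>g\<in>carrier G. homeomorphic_map (subtopology (Metric_space.mtopology M d) K)
                      (subtopology (Metric_space.mtopology M d) K) (\<alpha> g)) \<and>
     (\<exists>S. fin_gen_set G S \<and> (\<forall>g\<in>S. computable_map M d s K M d s (\<alpha> g)))"

definition eds_on ::
    "'m itself \<Rightarrow> ('g, 'b) monoid_scheme \<Rightarrow> 'x topology \<Rightarrow> ('g \<Rightarrow> 'x \<Rightarrow> 'x) \<Rightarrow> bool" where
  "eds_on (T :: 'm itself) G X act \<longleftrightarrow>
     (\<exists>(M :: 'm set) d s K \<alpha> \<phi>.
        computable_metric_space M d s \<and> recursively_compact M d s K \<and>
        computable_action G M d s K \<alpha> \<and>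
        homeomorphic_map X (subtopology (Metric_space.mtopology M d) K) \<phi> \<and>
        (\<forall>g\<in>carrier G. \<forall>x\<in>topspace X. act g x \<in> topspace X \<and> \<phi> (act g x) = \<alpha> g (\<phi> x)))"

text \<open>A separable metric space has at most the cardinality of the continuum, hence is isometric
  to one whose points are of type \<^typ>\<open>nat \<Rightarrow> nat\<close> (with an arbitrary metric on an arbitrary
  subset of that type).  The choice of this type is therefore no restriction, as is
  shown by \<open>eds_if_eds_on\<close> below.\<close>

definition eds ::
    "('g, 'b) monoid_scheme \<Rightarrow> 'x topology \<Rightarrow> ('g \<Rightarrow> 'x \<Rightarrow> 'x) \<Rightarrow> bool" where
  "eds G X act \<longleftrightarrow> eds_on TYPE(nat \<Rightarrow> nat) G X act"

lemma group_action_transport: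
  assumes act: "group_action G K \<alpha>" and j: "bij_betw j K K'"
  shows "group_action G K' (\<lambda>g. \<lambda>y\<in>K'. j (\<alpha> g (inv_into K j y)))"
proof -
  interpret group_action G K \<alpha> by fact
  interpret hom: group_hom G "BijGroup K" \<alpha> by (rule group_hom)
  let ?i = "inv_into K j"
  let ?\<alpha> = "\<lambda>g. \<lambda>y\<in>K'. j (\<alpha> g (?i y))"
  have i: "bij_betw ?i K' K" using j by (rule bij_betw_inv_into)
  have ij: "?i (j x) = x" if "x \<in> K" for x using j that by (rule bij_betw_inv_into_left)
  have iK: "?i y \<in> K" if "y \<in> K'" for y using i that by (rule bij_betw_apply)
  have jK: "j x \<in> K'" if "x \<in> K" for x using j that by (rule bij_betw_apply)
  have bij: "?\<alpha> g \<in> Bij K'" if g: "g \<in> carrier G" for g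
  proof -
    have "bij_betw (\<alpha> g) K K" using bij_prop0[OF g] by (simp add: Bij_def)
    from bij_betw_trans[OF bij_betw_trans[OF i this] j]
    have "bij_betw (?\<alpha> g) K' K'"
      by (simp add: comp_def)
    then show ?thesis by (simp add: Bij_def)
  qed
  have "?\<alpha> (g \<otimes>\<^bsub>G\<^esub> h) = compose K' (?\<alpha> g) (?\<alpha> h)"
    if g: "g \<in> carrier G" and h: "h \<in> carrier G" for g h
  proof
    fix y
    show "?\<alpha> (g \<otimes>\<^bsub>G\<^esub> h) y = compose K' (?\<alpha> g) (?\<alpha> h) y"
    proof (cases "y \<in> K'")
      case True
      note y = iK[OF True]
      note hy = element_image[OF h y refl]
      show ?thesis
        by (simp add: compose_def True jK[OF hy] ij[OF hy] composition_rule[OF y g h])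
    qed (simp add: compose_def)
  qed
  then have "group_hom G (BijGroup K') ?\<alpha>"
    using bij by (intro group_hom.intro hom.G.is_group group_BijGroup group_hom_axioms.intro)
      (auto simp: hom_def BijGroup_def)
  then show ?thesis by (rule group_action.intro)
qed

lemma eds_if_eds_on:
  assumes "eds_on TYPE('m) G X act"
  shows "eds G X act"
proof -
  from assms obtain M :: "'m set" and d s K \<alpha> \<phi> where
    cms: "computable_metric_space M d s" and rc: "recursively_compact M d s K" and
    ca: "computable_action G M d s K \<alpha>" and
    hom: "homeomorphic_map X (subtopology (Metric_space.mtopology M d) K) \<phi>" and
    equi: "\<forall>g\<in>carrier G. \<forall>x\<in>topspace X. act g x \<in> topspace X \<and> \<phi> (act g x) = \<alpha> g (\<phi> x)"
    unfolding eds_on_def by blast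
  interpret computable_metric_space M d s by fact
  have K: "K \<subseteq> M"
    using rc compactin_subset_topspace unfolding recursively_compact_def by fastforce
  have near: "\<exists>k. d x (s k) < 1 / real (Suc n)" if "x \<in> M" for x n
  proof -
    have "x \<in> Abstract_Topology.closure_of mtopology (range s)" using that s_dense by simp
    then have "\<forall>r>0. \<exists>y\<in>range s. y \<in> mball x r" unfolding metric_closure_of by blast
    moreover have "0 < 1 / real (Suc n)" by simp
    ultimately obtain y where "y \<in> range s" "y \<in> mball x (1 / real (Suc n))" by blast
    then show ?thesis by auto
  qed
  define j :: "'m \<Rightarrow> nat \<Rightarrow> nat" where "j x n = (LEAST k. d x (s k) < 1 / real (Suc n))" for x n
  have j_near: "d x (s (j x n)) < 1 / real (Suc n)" if "x \<in> M" for x n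
    unfolding j_def using near[OF that] by (rule LeastI_ex)
  have inj: "inj_on j M"
  proof (rule inj_onI, rule ccontr)
    fix x y assume xy: "x \<in> M" "y \<in> M" "j x = j y" "x \<noteq> y"
    then have "0 < d x y / 2" by simp
    then obtain n where n: "inverse (real (Suc n)) < d x y / 2" using reals_Archimedean by blast
    have "s (j x n) \<in> M" using s_in by auto
    then have "d x y \<le> d x (s (j x n)) + d y (s (j y n))"
      using triangle[of x "s (j x n)" y] xy commute[of y] by simp
    also have "\<dots> < 2 * inverse (real (Suc n))"
      using j_near[OF xy(1), of n] j_near[OF xy(2), of n] by (simp add: inverse_eq_divide)
    finally show False using n by simp
  qed
  define M' where "M' = j ` M"
  define i where "i = inv_into M j"
  define d' where "d' a b = d (i a) (i b)" for a b
  define s' where "s' = j \<circ> s"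
  define K' where "K' = j ` K"
  define \<alpha>' where "\<alpha>' = (\<lambda>g. \<lambda>y\<in>K'. j (\<alpha> g (inv_into K j y)))"
  have ij: "i (j x) = x" if "x \<in> M" for x using that inj by (simp add: i_def)
  have ji: "j (i y) = y" "i y \<in> M" if "y \<in> M'" for y
    using that by (auto simp: M'_def ij)
  have sM: "s n \<in> M" for n using s_in by auto
  have iso: "d' (j x) (j y) = d x y" if "x \<in> M" "y \<in> M" for x y
    using that by (simp add: d'_def ij)
  interpret M': Metric_space M' d'
  proof
    fix x y assume "x \<in> M'" "y \<in> M'"
    then show "d' x y = 0 \<longleftrightarrow> x = y" using ji by (metis d'_def zero)
  next
    fix x y z assume "x \<in> M'" "y \<in> M'" "z \<in> M'"
    then show "d' x z \<le> d' x y + d' y z" using ji by (simp add: d'_def triangle)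
  qed (simp_all add: d'_def commute)
  interpret MM': Metric_space12 M d M' d' ..
  have homj: "homeomorphic_map mtopology M'.mtopology j"
    by (rule MM'.isometry_imp_homeomorphic_map) (auto simp: M'_def iso)
  have mball: "M'.mball (j x) r = j ` mball x r" if "x \<in> M" for x r
    using that unfolding set_eq_iff image_iff M'.in_mball in_mball
    by (auto simp: M'_def iso)
  have ball: "basic_ball M' d' s' n = j ` basic_ball M d s n" for n
    by (simp add: basic_ball_def s'_def mball sM split: prod.split)
  have union: "basic_union M' d' s' I = j ` basic_union M d s I" for I
    by (auto simp: basic_union_def ball)
  have ball_M: "basic_ball M d s n \<subseteq> M" for n
    by (auto simp: basic_ball_def split: prod.split)
  then have union_M: "basic_union M d s I \<subseteq> M" for I
    by (auto simp: basic_union_def)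
  have homK: "homeomorphic_map (subtopology mtopology K) (subtopology M'.mtopology K') j"
  proof (rule homeomorphic_map_subtopologies[OF homj])
    show "j ` (topspace mtopology \<inter> K) = topspace M'.mtopology \<inter> K'"
      using K unfolding K'_def M'.topspace_mtopology topspace_mtopology by (auto simp: M'_def)
  qed

  have "computable_metric_space M' d' s'"
  proof
    show "range s' \<subseteq> M'" using s_in by (auto simp: s'_def M'_def)
    have "Abstract_Topology.closure_of M'.mtopology (j ` range s) = j ` Abstract_Topology.closure_of mtopology (range s)"
      using homeomorphic_map_closure_of[OF homj] s_in by simp
    then show "Abstract_Topology.closure_of M'.mtopology (range s') = M'"
      by (simp add: s'_def M'_def s_dense image_comp)
    show "\<exists>f. \<forall>i j n. \<exists>r. rec_eval f [i, j, n] r \<and>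
         \<bar>d' (s' i) (s' j) - of_rat (nat_to_rat_surj r)\<bar> \<le> 1 / 2 ^ n"
      using computable_dist by (simp add: s'_def iso sM)
  qed
  moreover have "recursively_compact M' d' s' K'"
  proof -
    have "compactin M'.mtopology K'"
      using rc K homeomorphic_map_compactness[OF homj, of K]
      by (simp add: recursively_compact_def K'_def)
    moreover have "K' \<subseteq> basic_union M' d' s' I \<longleftrightarrow> K \<subseteq> basic_union M d s I" for I
      unfolding K'_def union using inj_on_image_subset_iff[OF inj K union_M] .
    ultimately show ?thesis using rc by (simp add: recursively_compact_def)
  qed
  moreover have "computable_action G M' d' s' K' \<alpha>'"
  proof -
    have ga: "group_action G K \<alpha>"
      and homeo: "\<And>g. g \<in> carrier G \<Longrightarrow>
        homeomorphic_map (subtopology mtopology K) (subtopology mtopology K) (\<alpha> g)"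
      using ca by (auto simp: computable_action_def)
    have injK: "inj_on j K" using inj K by (rule inj_on_subset)
    then have bij: "bij_betw j K K'" by (simp add: bij_betw_def K'_def)
    have kj: "inv_into K j (j x) = x" if "x \<in> K" for x using injK that by simp
    have \<alpha>K: "\<alpha> g x \<in> K" if "g \<in> carrier G" "x \<in> K" for g x
      using group_action.element_image[OF ga that refl] .
    have \<alpha>'j: "\<alpha>' g (j x) = j (\<alpha> g x)" if "x \<in> K" for g x
      using that kj by (simp add: \<alpha>'_def K'_def)
    have "group_action G K' \<alpha>'"
      unfolding \<alpha>'_def using group_action_transport[OF ga bij] .
    moreover have "homeomorphic_map (subtopology M'.mtopology K') (subtopology M'.mtopology K') (\<alpha>' g)"
      if g: "g \<in> carrier G" for g
    proof -
      obtain k where k: "homeomorphic_maps (subtopology mtopology K) (subtopology M'.mtopology K') j k"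
        using homK homeomorphic_map_maps by blast
      then have hk: "homeomorphic_map (subtopology M'.mtopology K') (subtopology mtopology K) k"
        using homeomorphic_maps_sym homeomorphic_maps_imp_map by blast
      have "homeomorphic_map (subtopology M'.mtopology K') (subtopology M'.mtopology K') (j \<circ> (\<alpha> g \<circ> k))"
        by (intro homeomorphic_map_compose[OF homeomorphic_map_compose[OF hk homeo[OF g]] homK])
      moreover have "(j \<circ> (\<alpha> g \<circ> k)) y = \<alpha>' g y"
        if "y \<in> topspace (subtopology M'.mtopology K')" for y
      proof -
        from that obtain x where x: "x \<in> K" "y = j x" by (auto simp: K'_def)
        then have "k y = x" using k K unfolding homeomorphic_maps_def by auto
        then show ?thesis using x \<alpha>'j by simp
      qed
      ultimately show ?thesis by (rule homeomorphic_map_eq)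
    qed
    moreover obtain S where S: "fin_gen_set G S" "\<forall>g\<in>S. computable_map M d s K M d s (\<alpha> g)"
      using ca by (auto simp: computable_action_def)
    moreover have "computable_map M' d' s' K' M' d' s' (\<alpha>' g)" if g: "g \<in> S" for g
    proof -
      have gG: "g \<in> carrier G" using S(1) g by (auto simp: fin_gen_set_def)
      obtain R where R: "re_set (prod_encode ` R)"
        "\<And>m. {y \<in> K. \<alpha> g y \<in> basic_ball M d s m} = basic_union M d s {n. (m, n) \<in> R} \<inter> K"
        using S(2) g by (auto simp: computable_map_def)
      have "{y \<in> K'. \<alpha>' g y \<in> basic_ball M' d' s' m} =
          basic_union M' d' s' {n. (m, n) \<in> R} \<inter> K'" for m
      proof -
        have "{y \<in> K'. \<alpha>' g y \<in> basic_ball M' d' s' m} =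
            j ` {y \<in> K. \<alpha> g y \<in> basic_ball M d s m}"
        proof -
          have "\<alpha>' g (j x) \<in> basic_ball M' d' s' m \<longleftrightarrow> \<alpha> g x \<in> basic_ball M d s m"
            if "x \<in> K" for x
            unfolding \<alpha>'j[OF that] ball
            using inj_on_image_mem_iff[OF inj _ ball_M] \<alpha>K[OF gG that] K by blast
          then show ?thesis unfolding K'_def by auto
        qed
        also have "\<dots> = basic_union M' d' s' {n. (m, n) \<in> R} \<inter> K'"
          unfolding R(2) union K'_def by (rule inj_on_image_Int[OF inj union_M K])
        finally show ?thesis .
      qed
      moreover have "\<alpha>' g \<in> K' \<rightarrow> M'"
        using \<alpha>K[OF gG] K unfolding K'_def M'_def by (fastforce simp: \<alpha>'j[unfolded K'_def])
      ultimately show ?thesis using R(1) by (auto simp: computable_map_def)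
    qed
    ultimately show ?thesis unfolding computable_action_def by blast
  qed
  moreover have "homeomorphic_map X (subtopology M'.mtopology K') (j \<circ> \<phi>)"
    using homeomorphic_map_compose[OF hom homK] .
  moreover have "(j \<circ> \<phi>) (act g x) = \<alpha>' g ((j \<circ> \<phi>) x)"
    if "g \<in> carrier G" "x \<in> topspace X" for g x
  proof -
    have "\<phi> x \<in> K"
      using homeomorphic_imp_surjective_map[OF hom] that(2) by auto
    then show ?thesis
      using equi that inj_on_subset[OF inj K] by (simp add: \<alpha>'_def K'_def)
  qed
  ultimately show ?thesis
    using equi unfolding eds_def eds_on_def by blast
qed

end

theory Submission
  imports Defs
begin

text \<open>Fix letters whose values generate the group, and number them. All three notions are
  compared with one condition: the finite patterns on words which no configuration of \<open>X\<close>
  realises form a semidecidable set. This condition does not depend on the letters, and by free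
  reduction it amounts to effectiveness when the letters are generators and their formal inverses.

  If \<open>X\<close> is effectively closed by patterns, then the functions on words induced by \<open>X\<close> are cut out
  by a semidecidable family of cylinders: those of the translated patterns, and those assigning
  different values to two words that represent the same element, which is where the recursive
  presentation enters. By compactness the condition follows.

  If the condition holds, then these functions form a recursively compact subset of Baire space,
  on which the generators act by a computable renaming of the coordinates.

  Finally, in an effective dynamical system conjugate to \<open>X\<close>, the points whose symbol at the
  identity differs from a given one form a finite union of basic balls. Preimages of balls under
  the generators and their inverses are computable, so a pattern is forbidden iff a semidecidable
  family of balls covers the system, which recursive compactness allows to recognise.\<close>

section \<open>Computable functions on coded types\<close>

text \<open>Equality in the group is not assumed decidable, so nothing is computed with group
  elements: a configuration is replaced by the function it induces on words, and words are lists of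
  numbers with repeated spellings left in place. Each of the three notions brings its own generating
  set, and the one attached to a dynamical system need not be closed under inverses, whereas reading
  the symbol at \<open>g\<close> means acting by the inverse of \<open>g\<close>; hence the argument
  on inverses of computable homeomorphisms. The conjugacy to a dynamical system carries no
  computability. It enters only through one finite union of balls for each symbol, and a finite
  table is computable whichever way its entries were chosen. The same principle allows spellings of
  generators to be chosen without any algorithm. Enumerability is treated through a calculus of
  semidecidable predicates, so that explicit Kleene terms occur only for basic arithmetic, pairing,
  recursion and minimisation. The equivalences come from a cycle: patterns, effective, dynamical
  system, patterns.\<close>

lemma rec_eval_Comp1:
  "rec_eval g xs y \<Longrightarrow> rec_eval f [y] z \<Longrightarrow> rec_eval (Comp f [g]) xs z"
  by (rule rec_eval.Comp) auto

lemma rec_eval_Comp2: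
  "rec_eval g xs y \<Longrightarrow> rec_eval h xs y' \<Longrightarrow> rec_eval f [y, y'] z \<Longrightarrow>
    rec_eval (Comp f [g, h]) xs z"
  by (rule rec_eval.Comp) auto

lemma rec_eval_Proj: "i < length xs \<Longrightarrow> y = xs ! i \<Longrightarrow> rec_eval (Proj i) xs y"
  using rec_eval.Proj by simp

lemma rec_eval_PrimRec:
  assumes "rec_eval f xs (h 0)" and "\<And>n. rec_eval g (n # h n # xs) (h (Suc n))"
  shows "rec_eval (PrimRec f g) (n # xs) (h n)"
  by (induction n) (use assms in \<open>auto intro: rec_eval.intros\<close>)

lemma rec_eval_Mu_iff:
  "rec_eval (Mu f) xs n \<longleftrightarrow>
    rec_eval f (n # xs) 0 \<and> (\<forall>m<n. \<exists>y. 0 < y \<and> rec_eval f (m # xs) y)"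
  by (rule iffI, erule rec_eval.cases) (auto intro: rec_eval.Mu)

section \<open>Arithmetic and pairing in Kleene's schemes\<close>

lemma recf_const: "\<exists>r. \<forall>xs. rec_eval r xs c"
proof (induction c)
  case 0
  then show ?case using rec_eval.Zero by blast
next
  case (Suc c)
  then show ?case using rec_eval_Comp1 rec_eval.Succ by meson
qed

lemma recf_pred: "\<exists>r. \<forall>n. rec_eval r [n] (n - 1)"
proof (intro exI allI)
  show "rec_eval (PrimRec Zero (Proj 0)) [n] (n - 1)" for n
    by (rule rec_eval_PrimRec) (auto intro!: rec_eval.Zero rec_eval_Proj)
qed

lemma recf_add: "\<exists>r. \<forall>m n. rec_eval r [m, n] (m + n)"
proof (intro exI allI)
  show "rec_eval (PrimRec (Proj 0) (Comp Succ [Proj 1])) [m, n] (m + n)" for m n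
    by (rule rec_eval_PrimRec) (auto intro!: rec_eval_Proj rec_eval_Comp1 rec_eval.Succ)
qed

lemma recf_diff: "\<exists>r. \<forall>m n. rec_eval r [m, n] (m - n)"
proof -
  obtain p where p: "rec_eval p [n] (n - 1)" for n using recf_pred by blast
  have "rec_eval (PrimRec (Proj 0) (Comp p [Proj 1])) (n # [m]) (m - n)" for m n
  proof (rule rec_eval_PrimRec)
    show "rec_eval (Comp p [Proj 1]) [n, m - n, m] (m - Suc n)" for n
      using p[of "m - n"] by (auto intro!: rec_eval_Comp1 rec_eval_Proj)
  qed (auto intro!: rec_eval_Proj)
  then have "rec_eval (Comp (PrimRec (Proj 0) (Comp p [Proj 1])) [Proj 1, Proj 0]) [m, n] (m - n)"
    for m n
    by (intro rec_eval_Comp2[of _ _ n _ m]) (auto intro!: rec_eval_Proj)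
  then show ?thesis by blast
qed

lemma recf_triangle: "\<exists>r. \<forall>n. rec_eval r [n] (triangle n)"
proof -
  obtain a where a: "rec_eval a [m, n] (m + n)" for m n using recf_add by blast
  have "rec_eval (PrimRec Zero (Comp a [Proj 1, Comp Succ [Proj 0]])) (n # []) (triangle n)" for n
  proof (rule rec_eval_PrimRec)
    show "rec_eval (Comp a [Proj 1, Comp Succ [Proj 0]]) [n, triangle n] (triangle (Suc n))" for n
      using a[of "triangle n" "Suc n"]
      by (auto intro!: rec_eval_Comp2 rec_eval_Comp1 rec_eval_Proj rec_eval.Succ)
  qed (auto intro: rec_eval.Zero)
  then show ?thesis by blast
qed

lemma recf_prod_encode: "\<exists>r. \<forall>m n. rec_eval r [m, n] (prod_encode (m, n))"
proof -
  obtain a where a: "rec_eval a [m, n] (m + n)" for m n using recf_add by blast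
  obtain t where t: "rec_eval t [n] (triangle n)" for n using recf_triangle by blast
  have "rec_eval (Comp a [Comp t [a], Proj 0]) [m, n] (prod_encode (m, n))" for m n
    unfolding prod_encode_def split
    using a t by (auto intro!: rec_eval_Comp2 rec_eval_Comp1 rec_eval_Proj)
  then show ?thesis by blast
qed

lemma recf_fst: "\<exists>r. \<forall>n. rec_eval r [n] (fst (prod_decode n))"
  and recf_snd: "\<exists>r. \<forall>n. rec_eval r [n] (snd (prod_decode n))"
proof -
  obtain d where d: "rec_eval d [m, n] (m - n)" for m n using recf_diff by blast
  obtain t where t: "rec_eval t [n] (triangle n)" for n using recf_triangle by blast
  \<comment> \<open>The value of \<open>h\<close> at \<open>[s, n]\<close> is 0 iff
    \<open>n < triangle (Suc s)\<close>, so the least zero is the diagonal \<open>a + b\<close> on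
    which the pair coded by \<open>n\<close> lies.\<close>
  define h where "h = Comp d [Comp Succ [Proj 1], Comp t [Comp Succ [Proj 0]]]"
  have h: "rec_eval h [s, n] (Suc n - triangle (Suc s))" for s n
    unfolding h_def
    by (rule rec_eval_Comp2 rec_eval_Comp1 rec_eval_Proj rec_eval.Succ d t | simp)+
  have mono: "triangle a \<le> triangle b" if "a \<le> b" for a b
    using that by (induction rule: dec_induct) auto
  have mu: "rec_eval (Mu h) [prod_encode (a, b)] (a + b)" for a b
  proof (rule rec_eval.Mu)
    show "rec_eval h [a + b, prod_encode (a, b)] 0"
      using h[of "a + b" "prod_encode (a, b)"] by (simp add: prod_encode_def)
    fix m assume "m < a + b"
    then have "triangle (Suc m) \<le> triangle (a + b)" by (intro mono) simp
    then have "Suc (prod_encode (a, b)) - triangle (Suc m) > 0"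
      by (simp add: prod_encode_def)
    with h show "\<exists>y>0. rec_eval h [m, prod_encode (a, b)] y" by blast
  qed
  define f where "f = Comp d [Proj 0, Comp t [Mu h]]"
  have f: "rec_eval f [prod_encode (a, b)] a" for a b
  proof -
    have "rec_eval f [prod_encode (a, b)] (prod_encode (a, b) - triangle (a + b))"
      unfolding f_def by (rule rec_eval_Comp2 rec_eval_Comp1 rec_eval_Proj d t mu | simp)+
    then show ?thesis by (simp add: prod_encode_def)
  qed
  have "rec_eval (Comp d [Mu h, f]) [prod_encode (a, b)] (a + b - a)" for a b
    by (rule rec_eval_Comp2 rec_eval_Comp1 rec_eval_Proj d mu f | simp)+
  then have s: "rec_eval (Comp d [Mu h, f]) [prod_encode (a, b)] b" for a b
    by simp
  have "rec_eval f [n] (fst (prod_decode n))"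
    "rec_eval (Comp d [Mu h, f]) [n] (snd (prod_decode n))" for n
    using f[of "fst (prod_decode n)" "snd (prod_decode n)"]
      s[of "fst (prod_decode n)" "snd (prod_decode n)"] by simp_all
  then show "\<exists>r. \<forall>n. rec_eval r [n] (fst (prod_decode n))"
    "\<exists>r. \<forall>n. rec_eval r [n] (snd (prod_decode n))" by blast+
qed

text \<open>Bijectivity makes \<open>decode\<close> a total two-sided inverse: no number is an
  invalid code, and a search over the numbers is a search over the type.\<close>

class coded =
  fixes code :: "'a \<Rightarrow> nat"
  assumes bij_code: "bij code"

definition decode :: "nat \<Rightarrow> 'a::coded" where
  "decode = inv_into UNIV code"

lemma decode_code [simp]: "decode (code x) = x"
  unfolding decode_def by (rule inv_into_f_f[OF bij_is_inj[OF bij_code]]) simp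

lemma code_decode [simp]: "code (decode n) = n"
  unfolding decode_def by (rule surj_f_inv_f[OF bij_is_surj[OF bij_code]])

lemma code_eq_iff [simp]: "code x = code y \<longleftrightarrow> x = y"
  using bij_code by (metis bij_is_inj injD)

instantiation nat :: coded
begin

definition code_nat :: "nat \<Rightarrow> nat" where
  "code_nat n = n"

instance
  by standard (simp add: code_nat_def[abs_def] id_def[symmetric])

end

instantiation prod :: (coded, coded) coded
begin

definition code_prod :: "'a \<times> 'b \<Rightarrow> nat" where
  "code_prod p = prod_encode (code (fst p), code (snd p))"

instance
proof
  have "bij (map_prod code code :: 'a \<times> 'b \<Rightarrow> nat \<times> nat)"
    by (rule bijI[OF prod.inj_map map_prod_surj]; rule bij_is_inj[OF bij_code] bij_is_surj[OF bij_code])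
  then have "bij (prod_encode \<circ> (map_prod code code :: 'a \<times> 'b \<Rightarrow> nat \<times> nat))"
    using bij_prod_encode by (rule bij_comp)
  then show "bij (code :: 'a \<times> 'b \<Rightarrow> nat)"
    by (simp add: code_prod_def[abs_def] comp_def map_prod_def case_prod_beta)
qed

end

instantiation list :: (coded) coded
begin

definition code_list :: "'a list \<Rightarrow> nat" where
  "code_list xs = list_encode (map code xs)"

instance
proof
  have "map code (map decode l :: 'a list) = l" for l
    by (simp add: comp_def)
  then have "surj (map code :: 'a list \<Rightarrow> nat list)" by (rule surjI)
  moreover have "inj (map code :: 'a list \<Rightarrow> nat list)"
    by (rule list.inj_map[OF bij_is_inj[OF bij_code]])
  ultimately have "bij (map code :: 'a list \<Rightarrow> nat list)" by (intro bijI)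
  from bij_comp[OF this bij_list_encode]
  show "bij (code :: 'a list \<Rightarrow> nat)"
    by (simp add: code_list_def[abs_def] comp_def)
qed

end

lemma code_Nil [simp]: "code [] = 0"
  and code_Cons: "code (x # xs) = Suc (prod_encode (code x, code xs))"
  by (simp_all add: code_list_def)

text \<open>Functions of several arguments take a tuple, which is again of a coded type, so the
  unary notion is enough.\<close>

definition computable :: "('a::coded \<Rightarrow> 'b::coded) \<Rightarrow> bool" where
  "computable f \<longleftrightarrow> (\<exists>r. \<forall>x. rec_eval r [code x] (code (f x)))"

section \<open>Closure properties of computable functions\<close>

named_theorems computable_intros

lemma computable_id [computable_intros]: "computable (\<lambda>x. x)"
  unfolding computable_def by (auto intro!: exI[of _ "Proj 0"] rec_eval_Proj)

lemma computable_const [computable_intros]: "computable (\<lambda>x. c)"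
  unfolding computable_def using recf_const by metis

lemma computable_compose: "computable f \<Longrightarrow> computable g \<Longrightarrow> computable (\<lambda>x. f (g x))"
  unfolding computable_def using rec_eval_Comp1 by metis

lemma computable_Pair [computable_intros]:
  "computable f \<Longrightarrow> computable g \<Longrightarrow> computable (\<lambda>x. (f x, g x))"
proof -
  obtain p where p: "rec_eval p [m, n] (prod_encode (m, n))" for m n
    using recf_prod_encode by blast
  assume "computable f" "computable g"
  then obtain r s where "\<And>x. rec_eval r [code x] (code (f x))" "\<And>x. rec_eval s [code x] (code (g x))"
    unfolding computable_def by blast
  then have "rec_eval (Comp p [r, s]) [code x] (code (f x, g x))" for x
    using p rec_eval_Comp2 unfolding code_prod_def by fastforce
  then show ?thesis unfolding computable_def by blast
qed

lemma computable_compose2: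
  "computable (\<lambda>p. h (fst p) (snd p)) \<Longrightarrow> computable f \<Longrightarrow> computable g \<Longrightarrow>
    computable (\<lambda>x. h (f x) (g x))"
  using computable_compose[OF _ computable_Pair, of "\<lambda>p. h (fst p) (snd p)" f g] by simp

lemma computable_fst [computable_intros]:
  fixes f :: "'a::coded \<Rightarrow> 'b::coded \<times> 'c::coded"
  assumes "computable f" shows "computable (\<lambda>x. fst (f x))"
proof (rule computable_compose[OF _ assms])
  obtain r where r: "rec_eval r [n] (fst (prod_decode n))" for n using recf_fst by blast
  have "rec_eval r [code p] (code (fst p))" for p :: "'b \<times> 'c"
    using r[of "code p"] by (simp add: code_prod_def)
  then show "computable (fst :: 'b \<times> 'c \<Rightarrow> _)" unfolding computable_def by blast
qed

lemma computable_snd [computable_intros]: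
  fixes f :: "'a::coded \<Rightarrow> 'b::coded \<times> 'c::coded"
  assumes "computable f" shows "computable (\<lambda>x. snd (f x))"
proof (rule computable_compose[OF _ assms])
  obtain r where r: "rec_eval r [n] (snd (prod_decode n))" for n using recf_snd by blast
  have "rec_eval r [code p] (code (snd p))" for p :: "'b \<times> 'c"
    using r[of "code p"] by (simp add: code_prod_def)
  then show "computable (snd :: 'b \<times> 'c \<Rightarrow> _)" unfolding computable_def by blast
qed

lemma computable_Suc [computable_intros]: "computable f \<Longrightarrow> computable (\<lambda>x. Suc (f x))"
  by (rule computable_compose[where f = Suc]) (auto simp: computable_def code_nat_def intro: rec_eval.Succ)

text \<open>Numbers are their own codes, so at the level of codes both \<open>code\<close> and
  \<open>decode\<close> are the identity.\<close>

lemma computable_code [computable_intros]: "computable f \<Longrightarrow> computable (\<lambda>x. code (f x))"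
  unfolding computable_def code_nat_def .

lemma computable_decode [computable_intros]: "computable f \<Longrightarrow> computable (\<lambda>x. decode (f x))"
  unfolding computable_def by (simp add: code_nat_def)

text \<open>Primitive recursion with a parameter \<open>x\<close> and a state of any coded type. The
  arithmetic and list functions below are reduced to it.\<close>

lemma computable_rec_nat [computable_intros]:
  fixes f :: "'a::coded \<Rightarrow> nat \<Rightarrow> 'b::coded \<Rightarrow> 'b"
  assumes "computable a" "computable (\<lambda>p. f (fst p) (fst (snd p)) (snd (snd p)))" "computable n"
  shows "computable (\<lambda>x. rec_nat (a x) (f x) (n x))"
proof -
  obtain p where p: "rec_eval p [m, n] (prod_encode (m, n))" for m n
    using recf_prod_encode by blast
  from assms obtain ra rf rn where
    ra: "\<And>x. rec_eval ra [code x] (code (a x))" and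
    rf: "\<And>x i s. rec_eval rf [code (x, i, s)] (code (f x i s))" and
    rn: "\<And>x. rec_eval rn [code x] (n x)"
    unfolding computable_def by (auto simp: code_nat_def)
  \<comment> \<open>\<open>PrimRec\<close> supplies counter, state and parameter in this order,
    whereas \<open>rf\<close> expects the code of parameter, counter and state.\<close>
  define g where "g = Comp rf [Comp p [Proj 2, Comp p [Proj 0, Proj 1]]]"
  have "rec_eval (PrimRec ra g) (k # [code x]) (code (rec_nat (a x) (f x) k))" for k x
  proof (rule rec_eval_PrimRec)
    fix i
    let ?s = "rec_nat (a x) (f x) i"
    have "rec_eval (Comp p [Proj 2, Comp p [Proj 0, Proj 1]]) [i, code ?s, code x] (code (x, i, ?s))"
      unfolding code_prod_def fst_conv snd_conv code_nat_def
      by (rule rec_eval_Comp2 rec_eval_Proj p | simp)+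
    then show "rec_eval g [i, code ?s, code x] (code (rec_nat (a x) (f x) (Suc i)))"
      unfolding g_def using rf by (auto intro: rec_eval_Comp1)
  qed (simp add: ra)
  then have "rec_eval (Comp (PrimRec ra g) [rn, Proj 0]) [code x] (code (rec_nat (a x) (f x) (n x)))" for x
    using rn by (auto intro!: rec_eval_Comp2 rec_eval_Proj)
  then show ?thesis unfolding computable_def by blast
qed

lemma computable_pred [computable_intros]:
  assumes "computable f" shows "computable (\<lambda>x. f x - Suc 0)"
proof -
  have "computable (\<lambda>x. rec_nat 0 (\<lambda>n _. n) (f x))"
    by (intro computable_intros assms)
  moreover have "rec_nat 0 (\<lambda>n _. n) m = m - Suc 0" for m by (cases m) auto
  ultimately show ?thesis by simp
qed

lemma computable_add [computable_intros]:
  assumes "computable f" "computable g" shows "computable (\<lambda>x. f x + g x :: nat)"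
proof -
  have "computable (\<lambda>x. rec_nat (f x) (\<lambda>_ s. Suc s) (g x))"
    by (intro computable_intros assms)
  moreover have "rec_nat m (\<lambda>_ s. Suc s) n = m + n" for m n by (induction n) auto
  ultimately show ?thesis by simp
qed

lemma computable_diff [computable_intros]:
  assumes "computable f" "computable g" shows "computable (\<lambda>x. f x - g x :: nat)"
proof -
  have "computable (\<lambda>x. rec_nat (f x) (\<lambda>_ s. s - Suc 0) (g x))"
    by (intro computable_intros assms)
  moreover have "rec_nat m (\<lambda>_ s. s - Suc 0) n = m - n" for m n by (induction n) auto
  ultimately show ?thesis by simp
qed

lemma computable_mult [computable_intros]:
  assumes "computable f" "computable g" shows "computable (\<lambda>x. f x * g x :: nat)"
proof -
  have "computable (\<lambda>x. rec_nat 0 (\<lambda>_ s. f x + s) (g x))"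
    by (intro computable_intros assms computable_compose[OF assms(1)])
  moreover have "rec_nat 0 (\<lambda>_ s. m + s) n = m * n" for m n by (induction n) auto
  ultimately show ?thesis by simp
qed

lemma computable_power [computable_intros]:
  assumes "computable f" "computable g" shows "computable (\<lambda>x. f x ^ g x :: nat)"
proof -
  have "computable (\<lambda>x. rec_nat (Suc 0) (\<lambda>_ s. f x * s) (g x))"
    by (intro computable_intros assms computable_compose[OF assms(1)])
  moreover have "rec_nat (Suc 0) (\<lambda>_ s. m * s) n = m ^ n" for m n by (induction n) auto
  ultimately show ?thesis by simp
qed


section \<open>Decidable predicates\<close>

definition decidable :: "('a::coded \<Rightarrow> bool) \<Rightarrow> bool" where
  "decidable P \<longleftrightarrow> computable (\<lambda>x. of_bool (P x) :: nat)"

lemma decidable_compose: "decidable P \<Longrightarrow> computable f \<Longrightarrow> decidable (\<lambda>x. P (f x))"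
  unfolding decidable_def by (rule computable_compose)

lemma computable_of_bool [computable_intros]:
  "decidable P \<Longrightarrow> computable (\<lambda>x. of_bool (P x) :: nat)"
  by (simp add: decidable_def)

lemma decidable_const [computable_intros]: "decidable (\<lambda>x. c)"
  unfolding decidable_def by (rule computable_const)

lemma decidable_not [computable_intros]: "decidable P \<Longrightarrow> decidable (\<lambda>x. \<not> P x)"
proof -
  assume "decidable P"
  then have "computable (\<lambda>x. 1 - of_bool (P x) :: nat)" by (intro computable_intros)
  moreover have "1 - of_bool b = (of_bool (\<not> b) :: nat)" for b by simp
  ultimately show ?thesis unfolding decidable_def by simp
qed

lemma decidable_conj [computable_intros]:
  "decidable P \<Longrightarrow> decidable Q \<Longrightarrow> decidable (\<lambda>x. P x \<and> Q x)"
proof -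
  assume "decidable P" "decidable Q"
  then have "computable (\<lambda>x. of_bool (P x) * of_bool (Q x) :: nat)" by (intro computable_intros)
  then show ?thesis unfolding decidable_def by (simp add: of_bool_conj)
qed

lemma decidable_disj [computable_intros]:
  "decidable P \<Longrightarrow> decidable Q \<Longrightarrow> decidable (\<lambda>x. P x \<or> Q x)"
  using decidable_not[OF decidable_conj[OF decidable_not decidable_not]] by auto

lemma decidable_imp [computable_intros]:
  "decidable P \<Longrightarrow> decidable Q \<Longrightarrow> decidable (\<lambda>x. P x \<longrightarrow> Q x)"
  unfolding imp_conv_disj by (intro decidable_disj decidable_not)

lemma decidable_le [computable_intros]:
  assumes "computable f" "computable g" shows "decidable (\<lambda>x. f x \<le> (g x :: nat))"
proof -
  have "computable (\<lambda>x. rec_nat (Suc 0) (\<lambda>_ _. 0) (f x - g x) :: nat)"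
    by (intro computable_intros assms)
  moreover have "rec_nat (Suc 0) (\<lambda>_ _. 0) n = (of_bool (n = 0) :: nat)" for n by (cases n) auto
  ultimately show ?thesis unfolding decidable_def by simp
qed

lemma decidable_less [computable_intros]:
  assumes "computable f" "computable g" shows "decidable (\<lambda>x. f x < (g x :: nat))"
  using decidable_le[OF computable_Suc[OF assms(1)] assms(2)] by (simp add: Suc_le_eq)

lemma decidable_eq [computable_intros]:
  assumes "computable f" "computable g" shows "decidable (\<lambda>x. f x = g x)"
proof -
  have "decidable (\<lambda>x. code (f x) \<le> code (g x) \<and> code (g x) \<le> code (f x))"
    by (intro computable_intros assms)
  moreover have "code a \<le> code b \<and> code b \<le> code a \<longleftrightarrow> a = b" for a b :: 'b
    using code_eq_iff[of a b] by linarith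
  ultimately show ?thesis by simp
qed

lemma decidable_all_less [computable_intros]:
  fixes P :: "'a::coded \<Rightarrow> nat \<Rightarrow> bool"
  assumes P: "decidable (\<lambda>p. P (fst p) (snd p))" and n: "computable n"
  shows "decidable (\<lambda>x. \<forall>i<n x. P x i)"
proof -
  have "computable (\<lambda>x. rec_nat (Suc 0) (\<lambda>i s. of_bool (P x i) * s) (n x) :: nat)"
    by (intro computable_intros decidable_compose[OF P, of "\<lambda>p. (fst p, fst (snd p))", simplified] n)
  moreover have "rec_nat (Suc 0) (\<lambda>i s. of_bool (Q i) * s) k = (of_bool (\<forall>i<k. Q i) :: nat)" for Q k
    by (induction k) (auto simp: less_Suc_eq)
  ultimately show ?thesis unfolding decidable_def by simp
qed

lemma decidable_ex_less [computable_intros]: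
  fixes P :: "'a::coded \<Rightarrow> nat \<Rightarrow> bool"
  assumes "decidable (\<lambda>p. P (fst p) (snd p))" "computable n"
  shows "decidable (\<lambda>x. \<exists>i<n x. P x i)"
  using decidable_not[OF decidable_all_less[OF decidable_not]] assms by auto

lemma computable_if [computable_intros]:
  assumes "decidable P" "computable f" "computable g"
  shows "computable (\<lambda>x. if P x then f x else g x)"
proof -
  have "computable (\<lambda>x. rec_nat (g x) (\<lambda>_ _. f x) (of_bool (P x)))"
    by (intro computable_intros assms computable_compose[OF assms(2)])
  moreover have "rec_nat b (\<lambda>_ _. a) (of_bool c) = (if c then a else b)" for a b :: 'b and c by simp
  ultimately show ?thesis by simp
qed

text \<open>Stated as an equivalence about \<open>rec_eval\<close>, since the search diverges when
  there is no witness. Its domain of halting is what later yields an enumerable set.\<close>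

lemma recf_Mu:
  fixes P :: "'a::coded \<Rightarrow> nat \<Rightarrow> bool"
  assumes P: "decidable (\<lambda>p. P (fst p) (snd p))"
  obtains r where "\<And>x n. rec_eval r [code x] n \<longleftrightarrow> P x n \<and> (\<forall>m<n. \<not> P x m)"
proof -
  obtain d where d: "rec_eval d [m, n] (prod_encode (m, n))" for m n using recf_prod_encode by blast
  have "computable (\<lambda>p. of_bool (\<not> P (fst p) (snd p)) :: nat)" by (intro computable_intros P)
  then obtain r where r: "rec_eval r [code (x, n)] (of_bool (\<not> P x n))" for x n
    by (auto simp: computable_def code_nat_def)
  define h where "h = Comp r [Comp d [Proj 1, Proj 0]]"
  have "rec_eval h [n, code x] (of_bool (\<not> P x n))" for x n
    using r[of x n] unfolding h_def code_prod_def fst_conv snd_conv code_nat_def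
    by (auto intro!: rec_eval_Comp1 rec_eval_Comp2 rec_eval_Proj intro: d)
  then have h: "rec_eval h [n, code x] y \<longleftrightarrow> y = of_bool (\<not> P x n)" for x n y
    using rec_eval_deterministic by blast
  show thesis by (rule that[of "Mu h"]) (auto simp: rec_eval_Mu_iff h)
qed

lemma computable_Least [computable_intros]:
  assumes P: "decidable (\<lambda>p. P (fst p) (snd p))" and ex: "\<And>x. \<exists>n. P x n"
  shows "computable (\<lambda>x. LEAST n::nat. P x n)"
proof -
  obtain r where r: "\<And>x n. rec_eval r [code x] n \<longleftrightarrow> P x n \<and> (\<forall>m<n. \<not> P x m)"
    using recf_Mu[OF P] by blast
  have "rec_eval r [code x] (LEAST n. P x n)" for x
    unfolding r using LeastI_ex[OF ex] not_less_Least by blast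
  then show ?thesis by (auto simp: computable_def code_nat_def)
qed

lemma computable_div [computable_intros]:
  assumes [computable_intros]: "computable f" "computable g"
  shows "computable (\<lambda>x. f x div g x :: nat)"
proof -
  \<comment> \<open>The disjunct \<open>g x = 0\<close> ends the search at 0, which is also the
    value of division by zero.\<close>
  have "computable (\<lambda>x. LEAST q. g x = 0 \<or> f x < g x * Suc q)"
  proof (rule computable_Least)
    show "decidable (\<lambda>p. g (fst p) = 0 \<or> f (fst p) < g (fst p) * Suc (snd p))"
      by (intro computable_intros computable_compose[OF assms(1)] computable_compose[OF assms(2)])
    show "\<exists>n. g x = 0 \<or> f x < g x * Suc n" for x
      by (intro exI[of _ "f x"]) (cases "g x", auto)
  qed
  moreover have "(LEAST q. n = 0 \<or> m < n * Suc q) = m div n" for m n :: nat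
  proof (rule Least_equality)
    show "n = 0 \<or> m < n * Suc (m div n)"
      by (metis bot_nat_0.not_eq_extremum dividend_less_times_div mult_Suc_right add.commute)
    show "m div n \<le> q" if "n = 0 \<or> m < n * Suc q" for q
      using that by (auto simp: less_mult_imp_div_less mult.commute simp flip: less_Suc_eq_le)
  qed
  ultimately show ?thesis by simp
qed

lemma decidable_even [computable_intros]:
  assumes "computable f" shows "decidable (\<lambda>x. even (f x :: nat))"
proof -
  have "decidable (\<lambda>x. 2 * (f x div 2) = f x)" by (intro computable_intros assms)
  moreover have "2 * (m div 2) = m \<longleftrightarrow> even m" for m :: nat by presburger
  ultimately show ?thesis by simp
qed

lemma decidable_set_decode [computable_intros]:
  "computable f \<Longrightarrow> computable g \<Longrightarrow> decidable (\<lambda>x. f x \<in> set_decode (g x))"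
  unfolding set_decode_def mem_Collect_eq by (intro computable_intros)


section \<open>Computable functions on lists\<close>

lemma computable_Cons [computable_intros]:
  assumes "computable f" "computable g" shows "computable (\<lambda>x. f x # g x)"
  using computable_Suc[OF computable_code[OF computable_Pair[OF assms]]]
  by (simp add: computable_def code_Cons code_prod_def code_nat_def)

lemma computable_tl [computable_intros]:
  assumes "computable f" shows "computable (\<lambda>x. tl (f x))"
proof -
  \<comment> \<open>The code of a nonempty list is the successor of a pair. For the empty list,
    truncated subtraction leaves 0, the code of \<open>(0, 0)\<close>, whose second component is
    again the code of the empty list.\<close>
  have "computable (\<lambda>x. snd (decode (code (f x) - Suc 0) :: nat \<times> nat))"
    by (intro computable_intros assms)
  moreover have "snd (decode (code l - Suc 0) :: nat \<times> nat) = code (tl l)" for l :: "'b list"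
  proof (cases l)
    case Nil
    have "snd (decode (code ((0::nat), (0::nat))) :: nat \<times> nat) = 0"
      by (subst decode_code) simp
    then show ?thesis using Nil by (simp add: code_prod_def code_nat_def prod_encode_def)
  next
    case (Cons a l')
    have "snd (decode (code (code a, code l')) :: nat \<times> nat) = code l'"
      by (subst decode_code) simp
    then show ?thesis using Cons by (simp add: code_prod_def code_nat_def code_Cons)
  qed
  ultimately show ?thesis by (simp add: computable_def code_nat_def)
qed

text \<open>A total version of \<^const>\<open>hd\<close> whose value on the empty list can be computed.\<close>

definition head :: "'a::coded list \<Rightarrow> 'a" where
  "head l = decode (fst (decode (code l - Suc 0) :: nat \<times> nat))"

lemma head_Cons [simp]: "head (x # l) = x"
proof -
  have "fst (decode (code (code x, code l)) :: nat \<times> nat) = code x"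
    by (subst decode_code) simp
  then show ?thesis by (simp add: head_def code_prod_def code_nat_def code_Cons)
qed

lemma computable_head [computable_intros]: "computable f \<Longrightarrow> computable (\<lambda>x. head (f x))"
  unfolding head_def by (intro computable_intros)

lemma length_le_code: "length l \<le> code l"
proof (induction l)
  case (Cons a l)
  then show ?case using le_prod_encode_2[of "code l" "code a"] by (simp add: code_Cons)
qed simp

lemma computable_foldl [computable_intros]:
  fixes f :: "'a::coded \<Rightarrow> 'b::coded \<Rightarrow> 'c::coded \<Rightarrow> 'b"
  assumes f: "computable (\<lambda>p. f (fst p) (fst (snd p)) (snd (snd p)))"
    and a: "computable a" and l: "computable l"
  shows "computable (\<lambda>x. foldl (f x) (a x) (l x))"
proof -
  define step where "step x = (\<lambda>_::nat. \<lambda>s. if fst s = [] then s else (tl (fst s), f x (snd s) (head (fst s))))" for x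
  have "rec_nat (l, a) (step x) n = (drop n l, foldl (f x) a (take n l))" for l a x n
  proof (induction n)
    case (Suc n)
    show ?case
    proof (cases "n < length l")
      case True
      then show ?thesis using Suc Cons_nth_drop_Suc[OF True, symmetric]
        by (simp add: step_def take_Suc_conv_app_nth)
    next
      case False
      then show ?thesis using Suc by (simp add: step_def)
    qed
  qed simp
  then have "foldl (f x) (a x) (l x) = snd (rec_nat (l x, a x) (step x) (code (l x)))" for x
    by (simp add: length_le_code)
  moreover have "computable (\<lambda>x. snd (rec_nat (l x, a x) (step x) (code (l x))))"
    unfolding step_def
    by (intro computable_intros l a
        computable_compose[OF f, of "\<lambda>p. (fst p, snd (snd (snd p)), head (fst (snd (snd p))))", simplified])
  ultimately show ?thesis by simp
qed

lemma computable_rev [computable_intros]: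
  assumes "computable l" shows "computable (\<lambda>x. rev (l x))"
proof -
  have "computable (\<lambda>x. foldl (\<lambda>s a. a # s) [] (l x))" by (intro computable_intros assms)
  moreover have "foldl (\<lambda>s a. a # s) ys xs = rev xs @ ys" for xs ys :: "'b list"
    by (induction xs arbitrary: ys) auto
  ultimately show ?thesis by simp
qed

lemma computable_foldr [computable_intros]:
  fixes f :: "'a::coded \<Rightarrow> 'c::coded \<Rightarrow> 'b::coded \<Rightarrow> 'b"
  assumes f: "computable (\<lambda>p. f (fst p) (fst (snd p)) (snd (snd p)))"
    and a: "computable a" and l: "computable l"
  shows "computable (\<lambda>x. foldr (f x) (l x) (a x))"
  unfolding foldr_conv_foldl
  by (intro computable_intros a l
      computable_compose[OF f, of "\<lambda>p. (fst p, snd (snd p), fst (snd p))", simplified])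

lemma computable_append [computable_intros]:
  assumes "computable f" "computable g" shows "computable (\<lambda>x. f x @ g x)"
proof -
  have "computable (\<lambda>x. foldr (\<lambda>a s. a # s) (f x) (g x))" by (intro computable_intros assms)
  moreover have "foldr (\<lambda>a s. a # s) xs ys = xs @ ys" for xs ys :: "'b list"
    by (induction xs) auto
  ultimately show ?thesis by simp
qed

lemma computable_map [computable_intros]:
  fixes f :: "'a::coded \<Rightarrow> 'b::coded \<Rightarrow> 'c::coded"
  assumes f: "computable (\<lambda>p. f (fst p) (snd p))" and l: "computable l"
  shows "computable (\<lambda>x. map (f x) (l x))"
proof -
  have "computable (\<lambda>x. foldr (\<lambda>a s. f x a # s) (l x) [])"
    by (intro computable_intros l computable_compose[OF f, of "\<lambda>p. (fst p, fst (snd p))", simplified])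
  moreover have "foldr (\<lambda>a s. h a # s) xs [] = map h xs" for xs and h :: "'b \<Rightarrow> 'c"
    by (induction xs) auto
  ultimately show ?thesis by simp
qed

lemma computable_concat [computable_intros]:
  assumes "computable l" shows "computable (\<lambda>x. concat (l x))"
proof -
  have "computable (\<lambda>x. foldr (\<lambda>a s. a @ s) (l x) [])" by (intro computable_intros assms)
  then show ?thesis by (simp add: concat_conv_foldr)
qed

lemma computable_filter [computable_intros]:
  assumes P: "decidable (\<lambda>p. P (fst p) (snd p))" and l: "computable l"
  shows "computable (\<lambda>x. filter (P x) (l x))"
proof -
  have "computable (\<lambda>x. foldr (\<lambda>a s. if P x a then a # s else s) (l x) [])"
    by (intro computable_intros l decidable_compose[OF P, of "\<lambda>p. (fst p, fst (snd p))", simplified])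
  moreover have "foldr (\<lambda>a s. if Q a then a # s else s) xs [] = filter Q xs" for Q and xs :: "'b list"
    by (induction xs) auto
  ultimately show ?thesis by simp
qed

lemma computable_length [computable_intros]:
  assumes "computable l" shows "computable (\<lambda>x. length (l x))"
proof -
  have "computable (\<lambda>x. foldl (\<lambda>s _. Suc s) 0 (l x))" by (intro computable_intros assms)
  moreover have "foldl (\<lambda>s _. Suc s) n xs = n + length xs" for n and xs :: "'b list"
    by (induction xs arbitrary: n) auto
  ultimately show ?thesis by simp
qed

lemma computable_upt [computable_intros]:
  assumes "computable n" shows "computable (\<lambda>x. [0..<n x])"
proof -
  have "computable (\<lambda>x. rec_nat [] (\<lambda>i s. s @ [i]) (n x))" by (intro computable_intros assms)
  moreover have "rec_nat [] (\<lambda>i s. s @ [i]) k = [0..<k]" for k by (induction k) auto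
  ultimately show ?thesis by simp
qed

definition item :: "'a::coded list \<Rightarrow> nat \<Rightarrow> 'a" where
  "item l i = head (drop i l)"

lemma item_nth [simp]: "i < length l \<Longrightarrow> item l i = l ! i"
  by (simp add: item_def flip: Cons_nth_drop_Suc)

lemma computable_item [computable_intros]:
  assumes "computable l" "computable i" shows "computable (\<lambda>x. item (l x) (i x))"
proof -
  have "computable (\<lambda>x. head (rec_nat (l x) (\<lambda>_ s. tl s) (i x)))" by (intro computable_intros assms)
  moreover have "rec_nat l (\<lambda>_ s. tl s) i = drop i l" for l :: "'b list" and i
    by (induction i) (auto simp: drop_Suc tl_drop)
  ultimately show ?thesis by (simp add: item_def)
qed

lemma ball_set_conv_item: "(\<forall>a\<in>set l. P a) \<longleftrightarrow> (\<forall>i<length l. P (item l i))"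
  by (auto simp: all_set_conv_all_nth)

lemma bex_set_conv_item: "(\<exists>a\<in>set l. P a) \<longleftrightarrow> (\<exists>i<length l. P (item l i))"
  using ball_set_conv_item[of l "\<lambda>a. \<not> P a"] by blast

lemma decidable_ball [computable_intros]:
  assumes P: "decidable (\<lambda>p. P (fst p) (snd p))" and l: "computable l"
  shows "decidable (\<lambda>x. \<forall>a\<in>set (l x). P x a)"
  unfolding ball_set_conv_item
  by (intro computable_intros l computable_compose[OF l]
      decidable_compose[OF P, of "\<lambda>p. (fst p, item (l (fst p)) (snd p))", simplified])

lemma decidable_bex [computable_intros]:
  assumes "decidable (\<lambda>p. P (fst p) (snd p))" "computable l"
  shows "decidable (\<lambda>x. \<exists>a\<in>set (l x). P x a)"
  using decidable_not[OF decidable_ball[OF decidable_not]] assms by auto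

lemma computable_n_lists [computable_intros]:
  fixes l :: "'a::coded \<Rightarrow> 'b::coded list"
  assumes "computable n" and l: "computable l"
  shows "computable (\<lambda>x. List.n_lists (n x) (l x))"
proof -
  have "computable (\<lambda>x. rec_nat [[]] (\<lambda>_ s. concat (map (\<lambda>ys. map (\<lambda>y. y # ys) (l x)) s)) (n x))"
    by (intro computable_intros assms computable_compose[OF l])
  moreover have "rec_nat [[]] (\<lambda>_ s. concat (map (\<lambda>ys. map (\<lambda>y. y # ys) k) s)) m = List.n_lists m k"
    for k :: "'b list" and m
    by (induction m) auto
  ultimately show ?thesis by simp
qed

text \<open>A finite table is computable even if its entries were picked by a choice operator. All
  choices made for finitely many generators or symbols become algorithms through this lemma.\<close>

lemma computable_finite_support:
  fixes f :: "nat \<Rightarrow> 'a::coded"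
  assumes "\<And>i. k \<le> i \<Longrightarrow> f i = c"
  shows "computable f"
proof -
  have "computable (\<lambda>i. if i < k then item (map f [0..<k]) i else c)"
    by (intro computable_intros)
  moreover have "(\<lambda>i. if i < k then item (map f [0..<k]) i else c) = f"
    using assms by (auto simp: fun_eq_iff)
  ultimately show ?thesis by simp
qed

section \<open>Finite sets of numbers as numbers\<close>

definition set_code :: "nat list \<Rightarrow> nat" where
  "set_code l = foldr (\<lambda>a n. if a \<in> set_decode n then n else 2 ^ a + n) l 0"

lemma set_code_eq: "set_code l = set_encode (set l)"
proof (induction l)
  case (Cons a l)
  then show ?case by (auto simp: set_code_def insert_absorb)
qed (simp add: set_code_def)

lemma computable_set_code [computable_intros]: "computable f \<Longrightarrow> computable (\<lambda>x. set_code (f x))"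
  unfolding set_code_def by (intro computable_intros)

definition elements :: "nat \<Rightarrow> nat list" where
  "elements n = filter (\<lambda>i. i \<in> set_decode n) [0..<n]"

lemma less_of_mem_set_decode: "i \<in> set_decode n \<Longrightarrow> i < n"
proof (rule ccontr)
  assume "i \<in> set_decode n" "\<not> i < n"
  then have "n < 2 ^ i" by (meson less_exp linorder_not_less order_le_less_trans)
  with \<open>i \<in> set_decode n\<close> show False by (simp add: set_decode_def)
qed

lemma set_elements [simp]: "set (elements n) = set_decode n"
  by (auto simp: elements_def less_of_mem_set_decode)

lemma computable_elements [computable_intros]: "computable f \<Longrightarrow> computable (\<lambda>x. elements (f x))"
  unfolding elements_def by (intro computable_intros computable_compose[where g = fst])


section \<open>Semidecidable predicates\<close>

text \<open>Projections of decidable relations: unbounded search is built in, and closure under the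
  logical connectives needs no simulation of machines running in parallel.\<close>

definition semidec :: "('a::coded \<Rightarrow> bool) \<Rightarrow> bool" where
  "semidec P \<longleftrightarrow> (\<exists>Q. decidable Q \<and> (\<forall>x. P x \<longleftrightarrow> (\<exists>n::nat. Q (x, n))))"

lemma semidecE:
  assumes "semidec P"
  obtains Q where "decidable (\<lambda>p. Q (fst p) (snd p))" "\<And>x. P x \<longleftrightarrow> (\<exists>n::nat. Q x n)"
proof -
  from assms obtain Q where "decidable Q" "\<And>x. P x \<longleftrightarrow> (\<exists>n::nat. Q (x, n))"
    unfolding semidec_def by blast
  then show thesis by (intro that[of "\<lambda>x n. Q (x, n)"]) auto
qed

lemma semidecI:
  "decidable (\<lambda>p. Q (fst p) (snd p)) \<Longrightarrow> (\<And>x. P x \<longleftrightarrow> (\<exists>n::nat. Q x n)) \<Longrightarrow> semidec P"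
  unfolding semidec_def by (intro exI[of _ "\<lambda>p. Q (fst p) (snd p)"]) simp

lemma semidec_compose:
  assumes "semidec P" "computable f" shows "semidec (\<lambda>x. P (f x))"
proof -
  from assms(1) obtain Q where Q: "decidable (\<lambda>p. Q (fst p) (snd p))" "\<And>x. P x \<longleftrightarrow> (\<exists>n::nat. Q x n)"
    by (rule semidecE) blast
  have "decidable (\<lambda>p. Q (f (fst p)) (snd p))"
    by (rule decidable_compose[OF Q(1), of "\<lambda>p. (f (fst p), snd p)", simplified])
      (intro computable_intros computable_compose[OF assms(2)])
  then show ?thesis by (rule semidecI) (simp add: Q(2))
qed

lemma semidec_compose2:
  "semidec (\<lambda>p. P (fst p) (snd p)) \<Longrightarrow> computable f \<Longrightarrow> computable g \<Longrightarrow> semidec (\<lambda>x. P (f x) (g x))"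
  using semidec_compose[OF _ computable_Pair, of "\<lambda>p. P (fst p) (snd p)" f g] by simp

named_theorems semidec_intros

lemma semidec_decidable: "decidable P \<Longrightarrow> semidec P"
proof (rule semidecI[of "\<lambda>x _. P x"])
  assume "decidable P"
  then show "decidable (\<lambda>p. P (fst p))" by (rule decidable_compose) (intro computable_intros)
qed simp

text \<open>The witness \<open>y\<close> and the number certifying it are packed into a single
  number.\<close>

lemma semidec_ex [semidec_intros]:
  fixes P :: "'a::coded \<Rightarrow> 'b::coded \<Rightarrow> bool"
  assumes "semidec (\<lambda>p. P (fst p) (snd p))"
  shows "semidec (\<lambda>x. \<exists>y. P x y)"
proof -
  from assms obtain Q where Q: "decidable (\<lambda>p. Q (fst p) (snd p))"
    "\<And>p. P (fst p) (snd p) \<longleftrightarrow> (\<exists>n::nat. Q p n)"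
    by (rule semidecE) blast
  have "(\<exists>y. P x y) \<longleftrightarrow> (\<exists>m. Q (x, fst (decode m :: 'b \<times> nat)) (snd (decode m :: 'b \<times> nat)))" for x
  proof -
    have "(\<exists>y. P x y) \<longleftrightarrow> (\<exists>q :: 'b \<times> nat. Q (x, fst q) (snd q))"
      using Q(2)[of "(x, _)"] by auto
    then show ?thesis by (metis decode_code)
  qed
  then show ?thesis
    by (intro semidecI[of "\<lambda>x m. Q (x, fst (decode m :: 'b \<times> nat)) (snd (decode m :: 'b \<times> nat))"]
        decidable_compose[OF Q(1), of "\<lambda>p. ((fst p, fst (decode (snd p) :: 'b \<times> nat)), snd (decode (snd p) :: 'b \<times> nat))", simplified]
        computable_intros)
qed

lemma semidec_conj [semidec_intros]:
  assumes "semidec P" "semidec Q" shows "semidec (\<lambda>x. P x \<and> Q x)"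
proof -
  from assms(1) obtain P' where P: "decidable (\<lambda>p. P' (fst p) (snd p))" "\<And>x. P x \<longleftrightarrow> (\<exists>n::nat. P' x n)"
    by (rule semidecE) blast
  from assms(2) obtain Q' where Q: "decidable (\<lambda>p. Q' (fst p) (snd p))" "\<And>x. Q x \<longleftrightarrow> (\<exists>n::nat. Q' x n)"
    by (rule semidecE) blast
  have "semidec (\<lambda>x. \<exists>q :: nat \<times> nat. P' x (fst q) \<and> Q' x (snd q))"
    by (intro semidec_intros semidec_decidable computable_intros
        decidable_compose[OF P(1), of "\<lambda>p. (fst p, fst (snd p))", simplified]
        decidable_compose[OF Q(1), of "\<lambda>p. (fst p, snd (snd p))", simplified])
  then show ?thesis by (simp add: P(2) Q(2))
qed

lemma semidec_disj [semidec_intros]: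
  assumes "semidec P" "semidec Q" shows "semidec (\<lambda>x. P x \<or> Q x)"
proof -
  from assms(1) obtain P' where P: "decidable (\<lambda>p. P' (fst p) (snd p))" "\<And>x. P x \<longleftrightarrow> (\<exists>n::nat. P' x n)"
    by (rule semidecE) blast
  from assms(2) obtain Q' where Q: "decidable (\<lambda>p. Q' (fst p) (snd p))" "\<And>x. Q x \<longleftrightarrow> (\<exists>n::nat. Q' x n)"
    by (rule semidecE) blast
  show ?thesis
    by (rule semidecI[of "\<lambda>x n. P' x n \<or> Q' x n"]) (use P Q in \<open>auto intro: decidable_disj\<close>)
qed

text \<open>Finitely many certificates have a common bound, so one unbounded existential quantifier
  over the bound suffices, with bounded quantifiers behind it.\<close>

lemma semidec_all_less [semidec_intros]:
  fixes P :: "'a::coded \<Rightarrow> nat \<Rightarrow> bool"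
  assumes "semidec (\<lambda>p. P (fst p) (snd p))" and n: "computable n"
  shows "semidec (\<lambda>x. \<forall>i<n x. P x i)"
proof -
  from assms(1) obtain Q where Q: "decidable (\<lambda>p. Q (fst p) (snd p))"
    "\<And>p. P (fst p) (snd p) \<longleftrightarrow> (\<exists>n::nat. Q p n)"
    by (rule semidecE) blast
  have P: "P x i \<longleftrightarrow> (\<exists>n. Q (x, i) n)" for x i using Q(2)[of "(x, i)"] by simp
  show ?thesis
  proof (rule semidecI)
    show "decidable (\<lambda>p. \<forall>i<n (fst p). \<exists>k<snd p. Q (fst p, i) k)"
      by (intro computable_intros computable_compose[OF n]
          decidable_compose[OF Q(1), of "\<lambda>p. ((fst (fst (fst p)), snd (fst p)), snd p)", simplified])
    show "(\<forall>i<n x. P x i) \<longleftrightarrow> (\<exists>K. \<forall>i<n x. \<exists>k<K. Q (x, i) k)" for x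
    proof
      assume "\<forall>i<n x. P x i"
      then obtain k where k: "Q (x, i) (k i)" if "i < n x" for i using P by metis
      have "\<exists>j<Suc (Max (k ` {..<n x})). Q (x, i) j" if "i < n x" for i
        using k[OF that] Max_ge[of "k ` {..<n x}" "k i"] that
        by (intro exI[of _ "k i"]) (auto simp: less_Suc_eq_le)
      then show "\<exists>K. \<forall>i<n x. \<exists>k<K. Q (x, i) k" by blast
    qed (use P in blast)
  qed
qed

lemma semidec_ball [semidec_intros]:
  assumes P: "semidec (\<lambda>p. P (fst p) (snd p))" and l: "computable l"
  shows "semidec (\<lambda>x. \<forall>a\<in>set (l x). P x a)"
  unfolding ball_set_conv_item
  by (intro semidec_intros computable_intros l computable_compose[OF l]
      semidec_compose[OF P, of "\<lambda>p. (fst p, item (l (fst p)) (snd p))", simplified])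

lemma semidec_bex [semidec_intros]:
  assumes P: "semidec (\<lambda>p. P (fst p) (snd p))" and l: "computable l"
  shows "semidec (\<lambda>x. \<exists>a\<in>set (l x). P x a)"
  unfolding bex_set_conv_item
  by (intro semidec_intros computable_intros l computable_compose[OF l] semidec_decidable
      semidec_compose[OF P, of "\<lambda>p. (fst p, item (l (fst p)) (snd p))", simplified])

section \<open>Kleene's normal form\<close>

lemma rec_eval_Zero_iff: "rec_eval Zero xs y \<longleftrightarrow> y = 0"
  and rec_eval_Succ_iff: "rec_eval Succ xs y \<longleftrightarrow> xs \<noteq> [] \<and> tl xs = [] \<and> y = Suc (head xs)"
  and rec_eval_Proj_iff: "rec_eval (Proj i) xs y \<longleftrightarrow> i < length xs \<and> y = item xs i"
  and rec_eval_Comp_iff: "rec_eval (Comp f gs) xs z \<longleftrightarrow>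
    (\<exists>ys. list_all2 (\<lambda>g y. rec_eval g xs y) gs ys \<and> rec_eval f ys z)"
proof -
  show "rec_eval Zero xs y \<longleftrightarrow> y = 0"
    by (auto elim: rec_eval.cases intro: rec_eval.intros)
  show "rec_eval Succ xs y \<longleftrightarrow> xs \<noteq> [] \<and> tl xs = [] \<and> y = Suc (head xs)"
    by (cases xs) (auto elim: rec_eval.cases intro: rec_eval.intros)
  show "rec_eval (Proj i) xs y \<longleftrightarrow> i < length xs \<and> y = item xs i"
    by (auto elim: rec_eval.cases intro: rec_eval.intros)
  show "rec_eval (Comp f gs) xs z \<longleftrightarrow>
    (\<exists>ys. list_all2 (\<lambda>g y. rec_eval g xs y) gs ys \<and> rec_eval f ys z)"
    by (rule iffI, erule rec_eval.cases) (auto intro: rec_eval.Comp)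
qed

text \<open>The list of intermediate values is a finite certificate of the recursion; it replaces
  the inductive definition by an existential quantifier over a bounded universal one.\<close>

lemma rec_eval_PrimRec_iff:
  "rec_eval (PrimRec f g) xs z \<longleftrightarrow>
    (\<exists>l. xs \<noteq> [] \<and> length l = Suc (head xs) \<and> rec_eval f (tl xs) (item l 0) \<and>
      (\<forall>i<head xs. rec_eval g (i # item l i # tl xs) (item l (Suc i))) \<and> z = item l (head xs))"
  (is "_ \<longleftrightarrow> (\<exists>l. ?R xs z l)")
proof
  have "\<exists>l. ?R (n # ys) z l" if "rec_eval (PrimRec f g) (n # ys) z" for n ys z
    using that
  proof (induction n arbitrary: z)
    case 0
    then have "rec_eval f ys z" by (auto elim: rec_eval.cases)
    then show ?case by (intro exI[of _ "[z]"]) simp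
  next
    case (Suc n)
    from Suc.prems obtain y where y: "rec_eval (PrimRec f g) (n # ys) y" "rec_eval g (n # y # ys) z"
      by (cases rule: rec_eval.cases) auto
    from Suc.IH[OF y(1)] obtain l where l: "?R (n # ys) y l" by blast
    have it: "item (l @ [z]) i = item l i" if "i \<le> n" for i
      using that l by (simp add: nth_append)
    have last: "item (l @ [z]) (Suc n) = z" using l by (simp add: nth_append)
    have "rec_eval g (i # item (l @ [z]) i # ys) (item (l @ [z]) (Suc i))" if "i < Suc n" for i
    proof (cases "i < n")
      case True
      then show ?thesis using l it[of i] it[of "Suc i"] by (simp del: item_nth)
    next
      case False
      then have "i = n" using that by simp
      then show ?thesis using l y(2) it[of i] last by (simp del: item_nth)
    qed
    then show ?case using l it[of 0] last by (intro exI[of _ "l @ [z]"]) (simp del: item_nth)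
  qed
  moreover have "xs \<noteq> []" if "rec_eval (PrimRec f g) xs z"
    using that by (cases rule: rec_eval.cases) auto
  ultimately show "\<exists>l. ?R xs z l" if "rec_eval (PrimRec f g) xs z"
    using that by (cases xs) auto
next
  assume "\<exists>l. ?R xs z l"
  then obtain l n ys where l: "?R (n # ys) z l" and xs: "xs = n # ys" by (cases xs) auto
  have "rec_eval (PrimRec f g) (i # ys) (item l i)" if "i \<le> n" for i
    using that
  proof (induction i)
    case 0
    then show ?case using l by (auto intro: rec_eval.PrimRec_0)
  next
    case (Suc i)
    then show ?case using l by (auto intro!: rec_eval.PrimRec_Suc)
  qed
  then show "rec_eval (PrimRec f g) xs z" using l xs by simp
qed

text \<open>The algorithm \<open>f\<close> is fixed, so induction on its structure takes the place
  of a coding of programs and of a universal function.\<close>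

theorem semidec_rec_eval: "semidec (\<lambda>p. rec_eval f (fst p) (snd p))"
proof (induction f)
  case Zero
  show ?case unfolding rec_eval_Zero_iff by (intro semidec_decidable computable_intros)
next
  case Succ
  show ?case unfolding rec_eval_Succ_iff by (intro semidec_decidable computable_intros)
next
  case (Proj i)
  show ?case unfolding rec_eval_Proj_iff by (intro semidec_decidable computable_intros)
next
  case (Comp f gs)
  have "semidec (\<lambda>p. list_all2 (\<lambda>g y. rec_eval g (fst p) y) gs (snd p))"
    using Comp.IH(2)
  proof (induction gs)
    case Nil
    show ?case unfolding list_all2_Nil by (intro semidec_decidable computable_intros)
  next
    case (Cons g gs)
    have gs: "semidec (\<lambda>p. list_all2 (\<lambda>g y. rec_eval g (fst p) y) gs (snd p))"
      using Cons by simp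
    have g: "semidec (\<lambda>p. rec_eval g (fst p) (snd p))"
      using Cons by simp
    have "semidec (\<lambda>p. snd p \<noteq> [] \<and> rec_eval g (fst p) (head (snd p)) \<and>
        list_all2 (\<lambda>g y. rec_eval g (fst p) y) gs (tl (snd p)))"
      by (intro semidec_intros semidec_decidable[OF decidable_not] computable_intros
          semidec_compose2[OF g] semidec_compose2[OF gs])
    moreover have "list_all2 (\<lambda>g y. rec_eval g xs y) (g # gs) ys \<longleftrightarrow>
        ys \<noteq> [] \<and> rec_eval g xs (head ys) \<and> list_all2 (\<lambda>g y. rec_eval g xs y) gs (tl ys)" for xs ys
      by (cases ys) auto
    ultimately show ?case by presburger
  qed
  note compose = semidec_compose2[OF this]
  show ?case unfolding rec_eval_Comp_iff
    by (intro semidec_intros compose semidec_compose2[OF Comp.IH(1)] computable_intros)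
next
  case (PrimRec f g)
  show ?case unfolding rec_eval_PrimRec_iff
    by (intro semidec_intros semidec_compose2[OF PrimRec.IH(1)] semidec_compose2[OF PrimRec.IH(2)]
        computable_intros semidec_decidable[OF decidable_not] semidec_decidable[OF decidable_eq])
next
  case (Mu f)
  show ?case unfolding rec_eval_Mu_iff
    by (intro semidec_intros semidec_compose2[OF Mu.IH]
        computable_intros semidec_decidable[OF decidable_less])
qed

lemma semidec_halts: "semidec (\<lambda>xs. \<exists>y. rec_eval f xs y)"
  by (intro semidec_intros semidec_rec_eval)

text \<open>For the converse, a semidecidable set is the domain of the search for a least
  certificate.\<close>

theorem re_set_iff_semidec: "re_set N \<longleftrightarrow> semidec (\<lambda>n. n \<in> N)"
proof
  assume "re_set N"
  then obtain f where f: "\<And>n. n \<in> N \<longleftrightarrow> (\<exists>y. rec_eval f [n] y)"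
    unfolding re_set_def by blast
  show "semidec (\<lambda>n. n \<in> N)"
    unfolding f by (rule semidec_compose[OF semidec_halts]) (intro computable_intros)
next
  assume "semidec (\<lambda>n. n \<in> N)"
  then obtain Q where Q: "decidable (\<lambda>p. Q (fst p) (snd p))" "\<And>n. n \<in> N \<longleftrightarrow> (\<exists>k::nat. Q n k)"
    by (rule semidecE) blast
  obtain r where "\<And>n k. rec_eval r [code n] k \<longleftrightarrow> Q n k \<and> (\<forall>m<k. \<not> Q n m)"
    using recf_Mu[OF Q(1)] by blast
  then have "n \<in> N \<longleftrightarrow> (\<exists>k. rec_eval r [n] k)" for n
    unfolding Q(2) using exists_least_iff[of "Q n"] by (simp add: code_nat_def)
  then show "re_set N" unfolding re_set_def by blast
qed

section \<open>Forbidden patterns\<close>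

lemma code_nat_list: "code (w :: nat list) = list_encode w"
  by (simp add: code_list_def code_nat_def map_idI)

lemma code_word_nat: "code (w :: nat list, a :: nat) = prod_encode (list_encode w, a)"
  by (simp add: code_prod_def code_nat_list code_nat_def)

text \<open>The inverse of the coding of patterns, made total: every number yields a list of
  constraints, whether or not these form a function on admissible words.\<close>

definition entries :: "nat \<Rightarrow> (nat list \<times> nat) list" where
  "entries n = map decode (elements n)"

lemma computable_entries [computable_intros]: "computable f \<Longrightarrow> computable (\<lambda>x. entries (f x))"
  unfolding entries_def by (intro computable_intros)

lemma set_entries_set_encode: "finite E \<Longrightarrow> set (entries (set_encode (code ` E))) = E"
  by (simp add: entries_def image_image)

lemma set_encode_set_entries: "set_encode (code ` set (entries n)) = n"
  by (simp add: entries_def image_image)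

text \<open>Constraints form an arbitrary list on numbered words, with \<open>V\<close> giving the
  group element named by a word. Inconsistent lists are simply forbidden, as are lists with a number
  that codes no symbol when the configurations take values in a finite \<open>A\<close>. Hence words
  may be substituted freely without checking that a partial function results.\<close>

definition forbids :: "('g \<Rightarrow> 'a) set \<Rightarrow> 'a set \<Rightarrow> (nat list \<Rightarrow> 'g) \<Rightarrow> (nat list \<times> nat) list \<Rightarrow> bool" where
  "forbids X A V l \<longleftrightarrow> \<not> (\<exists>x\<in>X. \<forall>(w, a)\<in>set l. to_nat_on A (x (V w)) = a)"

lemma semidec_forbids_transfer:
  assumes "semidec (forbids X A V)" "computable \<tau>" "\<And>w. V (\<tau> w) = V' w"
  shows "semidec (forbids X A V')"
proof -
  have "semidec (\<lambda>l. forbids X A V (map (\<lambda>p. (\<tau> (fst p), snd p)) l))"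
    by (intro semidec_compose[OF assms(1)] computable_intros computable_compose[OF assms(2)])
  moreover have "forbids X A V (map (\<lambda>p. (\<tau> (fst p), snd p)) l) = forbids X A V' l" for l
    using assms(3) by (simp add: forbids_def case_prod_beta)
  ultimately show ?thesis by simp
qed

definition letters_of :: "'t set \<Rightarrow> 't list \<Rightarrow> nat list" where
  "letters_of T w = map (to_nat_on T) w"

text \<open>Here \<open>k\<close> is the number of letters, \<open>m\<close> the number of symbols
  and \<open>R\<close> the test for words allowed as positions, such as reducedness; the last clause
  makes the list the graph of a function.\<close>

definition valid_entries :: "nat \<Rightarrow> nat \<Rightarrow> (nat list \<Rightarrow> bool) \<Rightarrow> (nat list \<times> nat) list \<Rightarrow> bool" where
  "valid_entries k m R l \<longleftrightarrow>
    (\<forall>p\<in>set l. snd p < m \<and> (\<forall>i\<in>set (fst p). i < k) \<and> R (fst p)) \<and>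
    (\<forall>p\<in>set l. \<forall>q\<in>set l. fst p = fst q \<longrightarrow> snd p = snd q)"

lemma decidable_valid_entries:
  assumes "decidable R" shows "decidable (valid_entries k m R)"
  unfolding valid_entries_def
  by (intro computable_intros decidable_compose[OF assms])

lemma inj_on_to_nat_on_finite: "finite T \<Longrightarrow> inj_on (to_nat_on T) T"
  by (rule inj_on_to_nat_on[OF countable_finite])

lemma to_nat_on_less: "finite T \<Longrightarrow> t \<in> T \<Longrightarrow> to_nat_on T t < card T"
  using to_nat_on_finite[of T] by (auto simp: bij_betw_def)

lemma from_nat_into_less:
  assumes "finite T" "i < card T"
  shows "from_nat_into T i \<in> T" "to_nat_on T (from_nat_into T i) = i"
proof -
  have "T \<noteq> {}" using assms(2) by auto
  then show "from_nat_into T i \<in> T" by (rule from_nat_into)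
  show "to_nat_on T (from_nat_into T i) = i"
    using assms to_nat_on_finite[of T] by (intro to_nat_on_from_nat_into) (auto simp: bij_betw_def)
qed

lemma pattern_code_eq:
  "pattern_code T A p = set_encode (code ` (\<lambda>(w, a). (letters_of T w, to_nat_on A a)) ` Map.graph p)"
  unfolding pattern_code_def word_code_def letters_of_def image_image
  by (auto simp: code_word_nat case_prod_beta intro!: arg_cong[of _ _ set_encode] image_cong)

lemma finite_graph_finite_patterns: "p \<in> finite_patterns W A \<Longrightarrow> finite (Map.graph p)"
  by (simp add: finite_patterns_def)

lemma set_entries_pattern_code:
  assumes "p \<in> finite_patterns W A"
  shows "set (entries (pattern_code T A p)) =
    (\<lambda>(w, a). (letters_of T w, to_nat_on A a)) ` Map.graph p"
  unfolding pattern_code_eq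
  using finite_graph_finite_patterns[OF assms] by (intro set_entries_set_encode) simp

lemma graph_finite_patterns:
  assumes "p \<in> finite_patterns W A" "(w, a) \<in> Map.graph p"
  shows "w \<in> W" "a \<in> A" "p w = Some a"
  using assms by (auto simp: finite_patterns_def in_graphD dest!: in_graphD intro: ranI)

lemma letters_of_eq_iff:
  assumes "finite T" "w \<in> lists T" "w' \<in> lists T"
  shows "letters_of T w = letters_of T w' \<longleftrightarrow> w = w'"
proof -
  have "inj_on (map (to_nat_on T)) (lists T)"
    by (rule inj_on_map_lists[OF inj_on_to_nat_on_finite[OF assms(1)]])
  then show ?thesis using assms(2,3) by (simp add: letters_of_def inj_on_eq_iff)
qed

text \<open>An enumerable set of patterns speaks only about codes of genuine patterns, while
  \<open>entries\<close> accepts every number; for decidable \<open>R\<close> this criterion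
  separates the two by an algorithm.\<close>

lemma pattern_code_image_iff:
  assumes T: "finite T" and A: "finite A" and W: "W \<subseteq> lists T"
    and R: "\<And>w. w \<in> lists T \<Longrightarrow> R (letters_of T w) \<longleftrightarrow> w \<in> W"
  shows "n \<in> pattern_code T A ` finite_patterns W A \<longleftrightarrow> valid_entries (card T) (card A) R (entries n)"
proof
  assume "n \<in> pattern_code T A ` finite_patterns W A"
  then obtain p where p: "p \<in> finite_patterns W A" "n = pattern_code T A p" by blast
  note gr = graph_finite_patterns[OF p(1)]
  have "snd e < card A \<and> (\<forall>i\<in>set (fst e). i < card T) \<and> R (fst e)"
    if e: "e \<in> set (entries n)" for e
  proof -
    from e obtain w a where wa: "(w, a) \<in> Map.graph p" "e = (letters_of T w, to_nat_on A a)"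
      using set_entries_pattern_code[OF p(1)] p(2) by auto
    then have "w \<in> W" "a \<in> A" "w \<in> lists T" using gr W by blast+
    then show ?thesis using wa(2) R T A by (auto simp: letters_of_def to_nat_on_less)
  qed
  moreover have "snd e = snd e'"
    if e: "e \<in> set (entries n)" "e' \<in> set (entries n)" "fst e = fst e'" for e e'
  proof -
    from e obtain w a w' a' where wa: "(w, a) \<in> Map.graph p" "e = (letters_of T w, to_nat_on A a)"
      "(w', a') \<in> Map.graph p" "e' = (letters_of T w', to_nat_on A a')"
      using set_entries_pattern_code[OF p(1)] p(2) by fastforce
    then have "w = w'" using e(3) letters_of_eq_iff[OF T] gr W by (metis fst_conv subsetD)
    moreover from this have "a = a'" using wa(1,3) gr(3) by (metis option.inject)
    ultimately show ?thesis using wa by simp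
  qed
  ultimately show "valid_entries (card T) (card A) R (entries n)"
    unfolding valid_entries_def by blast
next
  assume v: "valid_entries (card T) (card A) R (entries n)"
  define E where "E = set (entries n)"
  \<comment> \<open>The graph rebuilt in the original letters and symbols. It is functional because
    \<open>letters_of\<close> recovers the numbered word.\<close>
  define F where "F = (\<lambda>(w, a). (map (from_nat_into T) w, from_nat_into A a)) ` E"
  have E: "letters_of T (map (from_nat_into T) w) = w" "map (from_nat_into T) w \<in> W"
    "to_nat_on A (from_nat_into A a) = a" "from_nat_into A a \<in> A" if "(w, a) \<in> E" for w a
  proof -
    have wa: "a < card A" "\<forall>i\<in>set w. i < card T" "R w"
      using v that unfolding valid_entries_def E_def by (metis fst_conv snd_conv)+
    show "letters_of T (map (from_nat_into T) w) = w"
      unfolding letters_of_def map_map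
      by (rule map_idI) (use wa(2) from_nat_into_less(2)[OF T] in simp)
    moreover have "map (from_nat_into T) w \<in> lists T" using wa(2) from_nat_into_less(1)[OF T] by auto
    ultimately show "map (from_nat_into T) w \<in> W" using R wa(3) by metis
    show "to_nat_on A (from_nat_into A a) = a" "from_nat_into A a \<in> A"
      using from_nat_into_less[OF A wa(1)] by auto
  qed
  define p where "p w = (if \<exists>a. (w, a) \<in> F then Some (SOME a. (w, a) \<in> F) else None)" for w
  have fun_F: "a = a'" if "(w, a) \<in> F" "(w, a') \<in> F" for w a a'
  proof -
    from that obtain u b u' b' where u: "(u, b) \<in> E" "w = map (from_nat_into T) u" "a = from_nat_into A b"
      "(u', b') \<in> E" "w = map (from_nat_into T) u'" "a' = from_nat_into A b'"
      unfolding F_def by auto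
    then have "u = u'" using E(1) by metis
    then have "b = b'" using v u unfolding valid_entries_def E_def by fastforce
    then show ?thesis using u by simp
  qed
  have p: "p w = Some a \<longleftrightarrow> (w, a) \<in> F" for w a
    unfolding p_def using fun_F someI_ex[of "\<lambda>a. (w, a) \<in> F"] by auto
  then have graph: "Map.graph p = F" by (auto simp: Map.graph_def)
  have "finite F" unfolding F_def E_def by simp
  moreover have "dom p = fst ` F" using p by (force simp: dom_def)
  ultimately have "p \<in> finite_patterns W A"
    using p E(2,4) unfolding finite_patterns_def F_def by (auto simp: ran_def)
  moreover have "pattern_code T A p = n"
  proof -
    have "(\<lambda>(w, a). (letters_of T w, to_nat_on A a)) ` F = E"
      unfolding F_def image_image using E by (force simp: case_prod_beta)
    then show ?thesis unfolding pattern_code_eq graph E_def using set_encode_set_entries by simp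
  qed
  ultimately show "n \<in> pattern_code T A ` finite_patterns W A" by blast
qed

lemma forbids_pattern_code_iff:
  assumes A: "finite A" and p: "p \<in> finite_patterns W A"
    and V: "\<And>w. w \<in> W \<Longrightarrow> V (letters_of T w) = val w"
    and X: "\<And>x w. x \<in> X \<Longrightarrow> w \<in> W \<Longrightarrow> x (val w) \<in> A"
  shows "forbids X A V (entries (pattern_code T A p)) \<longleftrightarrow>
    \<not> (\<exists>x\<in>X. \<forall>w\<in>dom p. p w = Some (x (val w)))"
proof -
  have "(\<forall>(w, a)\<in>set (entries (pattern_code T A p)). to_nat_on A (x (V w)) = a) \<longleftrightarrow>
      (\<forall>w\<in>dom p. p w = Some (x (val w)))" if x: "x \<in> X" for x
  proof -
    have "to_nat_on A (x (V (letters_of T w))) = to_nat_on A a \<longleftrightarrow> p w = Some (x (val w))"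
      if "(w, a) \<in> Map.graph p" for w a
    proof -
      note gr = graph_finite_patterns[OF p that]
      show ?thesis using V[OF gr(1)] X[OF x gr(1)] gr(2,3) A
        by (auto simp: countable_finite)
    qed
    then have "(\<forall>(w, a)\<in>set (entries (pattern_code T A p)). to_nat_on A (x (V w)) = a) \<longleftrightarrow>
        (\<forall>(w, a)\<in>Map.graph p. p w = Some (x (val w)))"
      unfolding set_entries_pattern_code[OF p] ball_simps(9) case_prod_beta fst_conv snd_conv
      by (metis prod.collapse)
    also have "\<dots> \<longleftrightarrow> (\<forall>w\<in>dom p. p w = Some (x (val w)))"
      by (auto simp: Map.graph_def dom_def)
    finally show ?thesis .
  qed
  then show ?thesis by (simp add: forbids_def)
qed

lemma re_patterns_of_semidec_forbids:
  assumes "finite T" and A: "finite A" and "W \<subseteq> lists T"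
    and "decidable R" and "\<And>w. w \<in> lists T \<Longrightarrow> R (letters_of T w) \<longleftrightarrow> w \<in> W"
    and V: "\<And>w. w \<in> W \<Longrightarrow> V (letters_of T w) = val w"
    and X: "\<And>x w. x \<in> X \<Longrightarrow> w \<in> W \<Longrightarrow> x (val w) \<in> A"
    and sd: "semidec (forbids X A V)"
  shows "re_patterns T A {p \<in> finite_patterns W A. \<not> (\<exists>x\<in>X. \<forall>w\<in>dom p. p w = Some (x (val w)))}"
proof -
  have forb: "forbids X A V (entries (pattern_code T A p)) \<longleftrightarrow>
      \<not> (\<exists>x\<in>X. \<forall>w\<in>dom p. p w = Some (x (val w)))" if "p \<in> finite_patterns W A" for p
    by (rule forbids_pattern_code_iff[OF A that]) (use V X in auto)
  have "n \<in> pattern_code T A ` {p \<in> finite_patterns W A. \<not> (\<exists>x\<in>X. \<forall>w\<in>dom p. p w = Some (x (val w)))} \<longleftrightarrow>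
      valid_entries (card T) (card A) R (entries n) \<and> forbids X A V (entries n)" for n
    using pattern_code_image_iff[OF assms(1-3,5), of n]
      forb by blast
  then show ?thesis
    unfolding re_patterns_def re_set_iff_semidec
    by (simp only:) (intro semidec_intros semidec_decidable
        decidable_compose[OF decidable_valid_entries[OF assms(4)]] semidec_compose[OF sd] computable_intros)
qed

text \<open>The enumerable set knows only patterns placed on words in \<open>W\<close>, so every
  word is first brought to a normal form by \<open>\<nu>\<close>, which does not change its value. A
  list that is then no longer a pattern has to be recognised separately.\<close>

lemma semidec_forbids_of_re_patterns:
  assumes T: "finite T" and A: "finite A" and W: "W \<subseteq> lists T"
    and R: "\<And>w. w \<in> lists T \<Longrightarrow> R (letters_of T w) \<longleftrightarrow> w \<in> W"
    and V: "\<And>w. w \<in> W \<Longrightarrow> V (letters_of T w) = val w"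
    and X: "\<And>x w. x \<in> X \<Longrightarrow> w \<in> W \<Longrightarrow> x (val w) \<in> A"
    and XV: "\<And>x w. x \<in> X \<Longrightarrow> x (V w) \<in> A"
    and \<nu>: "computable \<nu>" "\<And>w. R (\<nu> w)" "\<And>w i. i \<in> set (\<nu> w) \<Longrightarrow> i < card T" "\<And>w. V (\<nu> w) = V w"
    and re: "re_patterns T A {p \<in> finite_patterns W A. \<not> (\<exists>x\<in>X. \<forall>w\<in>dom p. p w = Some (x (val w)))}"
  shows "semidec (forbids X A V)"
proof -
  let ?P = "{p \<in> finite_patterns W A. \<not> (\<exists>x\<in>X. \<forall>w\<in>dom p. p w = Some (x (val w)))}"
  have forb: "forbids X A V (entries (pattern_code T A p)) \<longleftrightarrow>
      \<not> (\<exists>x\<in>X. \<forall>w\<in>dom p. p w = Some (x (val w)))" if "p \<in> finite_patterns W A" for p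
    by (rule forbids_pattern_code_iff[OF A that]) (use V X in auto)
  define N where "N = pattern_code T A ` ?P"
  have N: "n \<in> N \<longleftrightarrow> valid_entries (card T) (card A) R (entries n) \<and> forbids X A V (entries n)" for n
    unfolding N_def
    using pattern_code_image_iff[OF T A W R, of n]
      forb by blast
  have sN: "semidec (\<lambda>n. n \<in> N)" using re unfolding re_patterns_def re_set_iff_semidec N_def .
  define g where "g l = set_code (map (\<lambda>p. code (\<nu> (fst p), snd p)) l)" for l :: "(nat list \<times> nat) list"
  have set_g: "set (entries (g l)) = (\<lambda>p. (\<nu> (fst p), snd p)) ` set l"
    for l :: "(nat list \<times> nat) list"
  proof -
    have "g l = set_encode (code ` (\<lambda>p. (\<nu> (fst p), snd p)) ` set l)"
      by (simp add: g_def set_code_eq image_image)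
    then show ?thesis by (simp add: set_entries_set_encode)
  qed
  \<comment> \<open>The two ways in which the normalised list fails to be a pattern: a number that
    codes no symbol, or two symbols at words with the same normal form. No configuration in
    \<open>X\<close> satisfies such a list.\<close>
  define bad where "bad l \<longleftrightarrow> (\<exists>p\<in>set l. card A \<le> snd p) \<or>
      (\<exists>p\<in>set l. \<exists>q\<in>set l. \<nu> (fst p) = \<nu> (fst q) \<and> snd p \<noteq> snd q)" for l :: "(nat list \<times> nat) list"
  have "forbids X A V l \<longleftrightarrow> bad l \<or> g l \<in> N" for l
  proof -
    have bad: "forbids X A V l" if "bad l"
    proof -
      have False if x: "x \<in> X" and *: "\<And>p. p \<in> set l \<Longrightarrow> to_nat_on A (x (V (fst p))) = snd p" for x
        using \<open>bad l\<close> unfolding bad_def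
      proof (elim disjE bexE conjE)
        fix p assume "p \<in> set l" "card A \<le> snd p"
        then show False using *[of p] to_nat_on_less[OF A XV[OF x, of "fst p"]] by simp
      next
        fix p q assume "p \<in> set l" "q \<in> set l" "\<nu> (fst p) = \<nu> (fst q)" "snd p \<noteq> snd q"
        then show False using *[of p] *[of q] \<nu>(4)[of "fst p"] \<nu>(4)[of "fst q"] by simp
      qed
      then show ?thesis unfolding forbids_def case_prod_beta by blast
    qed
    have "forbids X A V (entries (g l)) \<longleftrightarrow> forbids X A V l"
      unfolding forbids_def set_g case_prod_beta using \<nu>(4) by auto
    moreover have "valid_entries (card T) (card A) R (entries (g l)) \<longleftrightarrow> \<not> bad l"
      unfolding valid_entries_def set_g bad_def using \<nu>(2,3) by (auto simp: not_le)
    ultimately show ?thesis using bad N by blast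
  qed
  moreover have "semidec (\<lambda>l. bad l \<or> g l \<in> N)"
    unfolding bad_def g_def
    by (intro semidec_intros(3) semidec_decidable computable_intros computable_compose[OF \<nu>(1)]
        decidable_not[OF decidable_eq] semidec_compose[OF sN])
  ultimately show ?thesis by presburger
qed


section \<open>Words over numbered generators\<close>

lemma letters_of_filter:
  assumes "finite T"
  obtains u where "u \<in> lists T" "letters_of T u = filter (\<lambda>i. i < card T) w"
proof
  let ?u = "map (from_nat_into T) (filter (\<lambda>i. i < card T) w)"
  show "?u \<in> lists T" using from_nat_into_less(1)[OF assms] by auto
  show "letters_of T ?u = filter (\<lambda>i. i < card T) w"
    unfolding letters_of_def map_map
    by (rule map_idI) (use from_nat_into_less(2)[OF assms] in simp)
qed

definition word_map :: "('g, 'b) monoid_scheme \<Rightarrow> (nat \<Rightarrow> 'g) \<Rightarrow> nat list \<Rightarrow> 'g" where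
  "word_map G e w = word_val G (map e w)"

text \<open>Numbers that code no letter stand for the identity. Every list of numbers is then a
  word, and such entries can be deleted without changing its value.\<close>

definition letter :: "('g, 'b) monoid_scheme \<Rightarrow> 't set \<Rightarrow> ('t \<Rightarrow> 'g) \<Rightarrow> nat \<Rightarrow> 'g" where
  "letter G T v i = (if i < card T then v (from_nat_into T i) else \<one>\<^bsub>G\<^esub>)"

lemma letter_to_nat_on: "finite T \<Longrightarrow> t \<in> T \<Longrightarrow> letter G T v (to_nat_on T t) = v t"
  by (simp add: letter_def to_nat_on_less countable_finite)

lemma word_map_letters_of:
  "finite T \<Longrightarrow> w \<in> lists T \<Longrightarrow> word_map G (letter G T v) (letters_of T w) = word_val G (map v w)"
  unfolding word_map_def letters_of_def
  by (auto simp: letter_to_nat_on intro!: arg_cong[of _ _ "word_val G"])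

lemma word_val_Nil [simp]: "word_val G [] = \<one>\<^bsub>G\<^esub>"
  and word_val_Cons [simp]: "word_val G (g # w) = g \<otimes>\<^bsub>G\<^esub> word_val G w"
  by (simp_all add: word_val_def)

lemma word_map_Nil [simp]: "word_map G e [] = \<one>\<^bsub>G\<^esub>"
  and word_map_Cons [simp]: "word_map G e (i # w) = e i \<otimes>\<^bsub>G\<^esub> word_map G e w"
  by (simp_all add: word_map_def)

abbreviation signed :: "'s set \<Rightarrow> ('s \<times> bool) set" where
  "signed S \<equiv> S \<times> UNIV"

context group
begin

lemma letter_closed: "finite T \<Longrightarrow> v ` T \<subseteq> carrier G \<Longrightarrow> letter G T v i \<in> carrier G"
  using from_nat_into_less[of T i] by (auto simp: letter_def)

lemma word_val_closed [simp]: "set w \<subseteq> carrier G \<Longrightarrow> word_val G w \<in> carrier G"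
  by (induction w) auto

lemma word_map_closed [simp]: "(\<And>i. e i \<in> carrier G) \<Longrightarrow> word_map G e w \<in> carrier G"
  by (induction w) auto

lemma word_map_append:
  "(\<And>i. e i \<in> carrier G) \<Longrightarrow> word_map G e (u @ w) = word_map G e u \<otimes> word_map G e w"
  by (induction u) (auto simp: m_assoc)

lemma word_map_letter_eq:
  assumes T: "finite T" and v: "v ` T \<subseteq> carrier G"
  obtains u where "u \<in> lists T" "letters_of T u = filter (\<lambda>i. i < card T) w"
    "word_map G (letter G T v) w = word_val G (map v u)"
proof -
  obtain u where u: "u \<in> lists T" "letters_of T u = filter (\<lambda>i. i < card T) w"
    using letters_of_filter[OF T] by blast
  have "word_map G (letter G T v) w = word_map G (letter G T v) (filter (\<lambda>i. i < card T) w)"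
  proof (induction w)
    case (Cons i w)
    have "word_map G (letter G T v) u \<in> carrier G" for u using letter_closed[OF T v] by simp
    moreover have "letter G T v i = \<one>" if "\<not> i < card T" using that by (simp add: letter_def)
    ultimately show ?case using Cons by simp
  qed simp
  then show thesis using that u word_map_letters_of[OF T u(1)] by metis
qed

lemma word_map_concat:
  assumes "\<And>i. e i \<in> carrier G" "\<And>i. word_map G e (t i) = e' i"
  shows "word_map G e (concat (map t w)) = word_map G e' w"
  by (induction w) (use assms in \<open>auto simp: word_map_append\<close>)

text \<open>Each letter of \<open>e'\<close> is spelled by a word in \<open>e\<close>, and words are
  translated letter by letter. Only finitely many letters are nontrivial, so the spelling is a
  finite table and may be chosen arbitrarily.\<close>

lemma semidec_forbids_change_letters:
  assumes e: "\<And>i. e i \<in> carrier G" and ran: "\<And>i. \<exists>w. word_map G e w = e' i"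
    and fin: "\<And>i. k \<le> i \<Longrightarrow> e' i = \<one>" and sd: "semidec (forbids X A (word_map G e))"
  shows "semidec (forbids X A (word_map G e'))"
proof -
  define t where "t i = (if k \<le> i then [] else SOME w. word_map G e w = e' i)" for i
  have t: "word_map G e (t i) = e' i" for i
    using someI_ex[OF ran[of i]] fin[of i] by (simp add: t_def)
  have ct: "computable t" by (rule computable_finite_support[of k _ "[]"]) (simp add: t_def)
  have "computable (\<lambda>w. concat (map t w))"
    by (intro computable_intros computable_compose[OF ct])
  with sd show ?thesis by (rule semidec_forbids_transfer) (rule word_map_concat[OF e t])
qed

lemma generate_word_map:
  assumes e: "\<And>i. e i \<in> carrier G" and S: "S \<subseteq> carrier G" "g \<in> generate G S"
    and gen: "\<And>s. s \<in> S \<Longrightarrow> s \<in> range e \<and> inv s \<in> range e"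
  shows "\<exists>w. word_map G e w = g"
  using S(2)
proof (induction rule: generate.induct)
  case one
  show ?case by (rule exI[of _ "[]"]) simp
next
  case (incl h)
  then obtain i where "e i = h" using gen by blast
  then show ?case using e[of i] by (intro exI[of _ "[i]"]) simp
next
  case (inv h)
  then obtain i where "e i = inv h" using gen by (metis imageE)
  then show ?case using e[of i] by (intro exI[of _ "[i]"]) simp
next
  case (eng h1 h2)
  then obtain u w where "word_map G e u = h1" "word_map G e w = h2" by blast
  then show ?case using e by (intro exI[of _ "u @ w"]) (simp add: word_map_append)
qed

definition free_letter :: "'a \<times> bool \<Rightarrow> 'a" where
  "free_letter p = (if snd p then fst p else inv (fst p))"

lemma free_eval_eq: "free_eval G w = word_val G (map free_letter w)"
  unfolding free_eval_def
  by (rule arg_cong[of _ _ "word_val G"], rule map_cong) (auto simp: free_letter_def)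

lemma free_letter_closed: "S \<subseteq> carrier G \<Longrightarrow> p \<in> S \<times> UNIV \<Longrightarrow> free_letter p \<in> carrier G"
  by (auto simp: free_letter_def)

lemma free_letter_flip: "S \<subseteq> carrier G \<Longrightarrow> p \<in> S \<times> UNIV \<Longrightarrow> free_letter (flip p) = inv (free_letter p)"
  by (auto simp: free_letter_def flip_def)

definition free_gens :: "'a set \<Rightarrow> nat \<Rightarrow> 'a" where
  "free_gens S = letter G (signed S) free_letter"

lemma free_gens_closed:
  assumes "finite S" "S \<subseteq> carrier G" shows "free_gens S i \<in> carrier G"
  unfolding free_gens_def using assms free_letter_closed[of S]
  by (intro letter_closed) auto

lemma free_gens_one: "card (signed S) \<le> i \<Longrightarrow> free_gens S i = \<one>"
  by (simp add: free_gens_def letter_def)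

lemma free_gens_range:
  assumes "finite S" "s \<in> S" shows "s \<in> range (free_gens S)" "inv s \<in> range (free_gens S)"
proof -
  have *: "finite (signed S)" using assms by simp
  have "free_gens S (to_nat_on (signed S) (s, True)) = s"
    "free_gens S (to_nat_on (signed S) (s, False)) = inv s"
    unfolding free_gens_def using letter_to_nat_on[OF *, of _ G free_letter] assms
    by (simp_all add: free_letter_def del: card_cartesian_product)
  then show "s \<in> range (free_gens S)" "inv s \<in> range (free_gens S)" by (metis rangeI)+
qed

end

section \<open>Free reduction on numbered letters\<close>

text \<open>Free cancellation on numbers. The default 0 is arbitrary: numbers that code no letter
  are filtered out or rejected by separate tests.\<close>

definition nflip :: "'s set \<Rightarrow> nat \<Rightarrow> nat" where
  "nflip S i = (if i < card (signed S)
     then to_nat_on (signed S) (flip (from_nat_into (signed S) i)) else 0)"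

definition npush :: "'s set \<Rightarrow> nat \<Rightarrow> nat list \<Rightarrow> nat list" where
  "npush S i w = (if w \<noteq> [] \<and> head w = nflip S i then tl w else i # w)"

lemma computable_nflip: "computable (nflip S)"
  by (rule computable_finite_support[of "card (signed S)" _ 0]) (simp add: nflip_def)

lemma computable_foldr_npush:
  "computable f \<Longrightarrow> computable g \<Longrightarrow> computable (\<lambda>x. foldr (npush S) (f x) (g x))"
  unfolding npush_def
  by (intro computable_intros computable_compose[OF computable_nflip])

lemma flip_in: "p \<in> S \<times> UNIV \<Longrightarrow> flip p \<in> S \<times> UNIV"
  by (auto simp: flip_def)

lemma nflip_to_nat_on:
  assumes "finite S" "p \<in> signed S"
  shows "nflip S (to_nat_on (signed S) p) = to_nat_on (signed S) (flip p)"
proof -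
  have T: "finite (signed S)" using assms(1) by simp
  show ?thesis
    using to_nat_on_less[OF T assms(2)] assms(2) countable_finite[OF T]
    by (simp add: nflip_def del: card_cartesian_product)
qed

lemma npush_letters_of:
  assumes S: "finite S" "p \<in> signed S" "w \<in> lists (signed S)"
  shows "npush S (to_nat_on (signed S) p) (letters_of (signed S) w) = letters_of (signed S) (push p w)"
proof (cases w)
  case Nil
  then show ?thesis by (simp add: npush_def letters_of_def)
next
  case (Cons q u)
  have "inj_on (to_nat_on (signed S)) (signed S)"
    using S(1) by (intro inj_on_to_nat_on_finite) simp
  moreover have "q \<in> S \<times> UNIV" using S(3) Cons by simp
  ultimately have "to_nat_on (signed S) q = to_nat_on (signed S) (flip p) \<longleftrightarrow> q = flip p"
    using flip_in[OF S(2)] by (simp add: inj_on_eq_iff)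
  then show ?thesis
    using Cons by (simp add: npush_def letters_of_def nflip_to_nat_on[OF S(1,2)])
qed

lemma foldr_npush_letters_of:
  assumes "finite S" "w \<in> lists (signed S)"
  shows "foldr (npush S) (letters_of (signed S) w) [] = letters_of (signed S) (foldr push w [])"
  using assms(2)
proof (induction w)
  case (Cons p w)
  have "letters_of (signed S) (p # w) = to_nat_on (signed S) p # letters_of (signed S) w"
    by (simp add: letters_of_def)
  then show ?case
    using Cons npush_letters_of[OF assms(1), of p "foldr push w []"] foldr_push_in_lists[of w S "[]"]
    by (simp del: in_lists_conv_set)
qed (simp add: letters_of_def)

definition nreduce :: "'s set \<Rightarrow> nat list \<Rightarrow> nat list" where
  "nreduce S w = foldr (npush S) (filter (\<lambda>i. i < card (signed S)) w) []"

text \<open>Being fixed by reduction is a decidable test for the elements of the free group among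
  all words.\<close>

lemma letters_of_reduced_iff:
  assumes "finite S" "w \<in> lists (signed S)"
  shows "foldr (npush S) (letters_of (signed S) w) [] = letters_of (signed S) w \<longleftrightarrow>
    w \<in> carrier (free_group S)"
proof -
  have "foldr push w [] = w \<longleftrightarrow> reduced w"
    using foldr_push_Nil[of w] reduced_foldr_push[of "[]" w] by auto
  then show ?thesis
    using assms foldr_push_in_lists[of w S "[]"] foldr_npush_letters_of[OF assms]
      letters_of_eq_iff[of "signed S" "foldr push w []" w]
    by (simp add: free_group_def del: in_lists_conv_set)
qed

lemma nreduce_letters:
  assumes "finite S"
  obtains u where "u \<in> carrier (free_group S)" "nreduce S w = letters_of (signed S) u"
proof -
  let ?T = "signed S"
  have T: "finite ?T" using assms by simp
  obtain v where v: "v \<in> lists ?T" "letters_of ?T v = filter (\<lambda>i. i < card ?T) w"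
    using letters_of_filter[OF T] by blast
  then have "nreduce S w = letters_of ?T (foldr push v [])"
    unfolding nreduce_def using foldr_npush_letters_of[OF assms v(1)] by simp
  moreover have "foldr push v [] \<in> carrier (free_group S)"
    using foldr_push_in_lists[OF v(1), of "[]"] reduced_foldr_push[of "[]" v]
    by (simp add: free_group_def del: in_lists_conv_set)
  ultimately show thesis using that by blast
qed

context group
begin

lemma word_map_npush:
  assumes S: "finite S" "S \<subseteq> carrier G" and i: "i < card (signed S)"
  shows "word_map G (free_gens S) (npush S i w) = free_gens S i \<otimes> word_map G (free_gens S) w"
proof (cases "w \<noteq> [] \<and> head w = nflip S i")
  case True
  then obtain u where u: "w = nflip S i # u" by (cases w) auto
  let ?T = "signed S"
  have T: "finite ?T" using S by simp
  define p where "p = from_nat_into ?T i"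
  have p: "p \<in> ?T" "to_nat_on ?T p = i" using from_nat_into_less[OF T i] by (simp_all add: p_def)
  have "free_gens S i = free_letter p" "free_gens S (nflip S i) = inv (free_letter p)"
    using letter_to_nat_on[OF T] p flip_in[OF p(1)] free_letter_flip[OF S(2) p(1)] nflip_to_nat_on[OF S(1) p(1)]
    unfolding free_gens_def by metis+
  moreover have "free_letter p \<in> carrier G" using free_letter_closed[OF S(2) p(1)] .
  moreover have "word_map G (free_gens S) u \<in> carrier G" using free_gens_closed[OF S] by simp
  ultimately show ?thesis
    using True u by (simp add: npush_def m_assoc[symmetric])
qed (auto simp: npush_def)

lemma word_map_nreduce:
  assumes S: "finite S" "S \<subseteq> carrier G"
  shows "word_map G (free_gens S) (nreduce S w) = word_map G (free_gens S) w"
proof (induction w)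
  case (Cons i w)
  have c: "word_map G (free_gens S) w \<in> carrier G" using free_gens_closed[OF S] by simp
  show ?case
  proof (cases "i < card (signed S)")
    case True
    have "nreduce S (i # w) = npush S i (nreduce S w)" using True by (simp add: nreduce_def)
    then show ?thesis using word_map_npush[OF S True] Cons by simp
  next
    case False
    have "nreduce S (i # w) = nreduce S w" using False by (simp add: nreduce_def)
    then show ?thesis using False Cons free_gens_one[of S i] c by simp
  qed
qed (simp add: nreduce_def)

lemma pullback_forbids:
  assumes "p \<in> finite_patterns (carrier (free_group S)) A"
  shows "(\<exists>y\<in>pullback G S X. \<forall>w\<in>dom p. p w = Some (y w)) \<longleftrightarrow>
    (\<exists>x\<in>X. \<forall>w\<in>dom p. p w = Some (x (free_eval G w)))"
proof -
  have "dom p \<subseteq> carrier (free_group S)" using assms by (simp add: finite_patterns_def)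
  then have "(\<forall>w\<in>dom p. p w = Some ((\<lambda>w\<in>carrier (free_group S). x (free_eval G w)) w)) \<longleftrightarrow>
      (\<forall>w\<in>dom p. p w = Some (x (free_eval G w)))" for x
    by (intro ball_cong) auto
  then show ?thesis unfolding pullback_def by (simp del: restrict_apply)
qed

text \<open>The positions of a pattern of the pullback are reduced words, so free reduction serves
  as the normal form; it preserves values because a letter cancels against its formal
  inverse.\<close>

lemma re_pullback_iff_semidec_forbids:
  assumes A: "finite A" and X: "X \<subseteq> carrier G \<rightarrow>\<^sub>E A" and S: "fin_gen_set G S"
  shows "re_patterns (signed S) A
      {p \<in> finite_patterns (carrier (free_group S)) A.
         \<not> (\<exists>y\<in>pullback G S X. \<forall>w\<in>dom p. p w = Some (y w))} \<longleftrightarrow>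
    semidec (forbids X A (word_map G (free_gens S)))"
proof -
  let ?T = "signed S" and ?W = "carrier (free_group S)"
  let ?R = "\<lambda>w. foldr (npush S) w [] = w"
  let ?V = "word_map G (free_gens S)"
  have fS: "finite S" "S \<subseteq> carrier G" using S by (auto simp: fin_gen_set_def)
  then have T: "finite ?T" by simp
  have W: "?W \<subseteq> lists ?T" by (auto simp: free_group_def)
  have V: "?V (letters_of ?T w) = free_eval G w" if "w \<in> ?W" for w
    using word_map_letters_of[OF T, of w G free_letter] that W
    by (auto simp: free_gens_def free_eval_eq)
  have R: "?R (letters_of ?T w) \<longleftrightarrow> w \<in> ?W" if "w \<in> lists ?T" for w
    using letters_of_reduced_iff[OF fS(1) that] .
  have Vc: "?V w \<in> carrier G" for w using free_gens_closed[OF fS] by simp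
  then have XV: "x (?V w) \<in> A" if "x \<in> X" for x w using that X by blast
  then have Xv: "x (free_eval G w) \<in> A" if "x \<in> X" "w \<in> ?W" for x w
    using that V[of w] by metis
  have eq: "{p \<in> finite_patterns ?W A. \<not> (\<exists>y\<in>pullback G S X. \<forall>w\<in>dom p. p w = Some (y w))} =
      {p \<in> finite_patterns ?W A. \<not> (\<exists>x\<in>X. \<forall>w\<in>dom p. p w = Some (x (free_eval G w)))}"
    using pullback_forbids by blast
  have dec: "decidable ?R"
    by (intro computable_intros computable_foldr_npush)
  have \<nu>: "computable (nreduce S)"
    unfolding nreduce_def[abs_def] by (intro computable_intros computable_foldr_npush)
  have \<nu>_red: "?R (nreduce S w)" and \<nu>_less: "\<And>i. i \<in> set (nreduce S w) \<Longrightarrow> i < card ?T" for w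
  proof -
    obtain u where u: "u \<in> ?W" "nreduce S w = letters_of ?T u"
      using nreduce_letters[OF fS(1)] by blast
    then have ul: "u \<in> lists ?T" using W by blast
    show "?R (nreduce S w)" unfolding u(2) using letters_of_reduced_iff[OF fS(1) ul] u(1) by blast
    show "i < card ?T" if "i \<in> set (nreduce S w)" for i
      using that to_nat_on_less[OF T] ul unfolding u(2) letters_of_def by auto
  qed
  note \<nu>_eval = word_map_nreduce[OF fS]
  show ?thesis
    unfolding eq
  proof
    show "semidec (forbids X A ?V)" if re: "re_patterns ?T A
        {p \<in> finite_patterns ?W A. \<not> (\<exists>x\<in>X. \<forall>w\<in>dom p. p w = Some (x (free_eval G w)))}"
      by (rule semidec_forbids_of_re_patterns[where R = ?R and V = ?V and val = "free_eval G"
            and \<nu> = "nreduce S", OF T A W _ _ _ _ \<nu> _ _ _ re];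
          (rule R V Xv XV \<nu>_red \<nu>_less \<nu>_eval; assumption?))
    show "re_patterns ?T A
        {p \<in> finite_patterns ?W A. \<not> (\<exists>x\<in>X. \<forall>w\<in>dom p. p w = Some (x (free_eval G w)))}"
      if sd: "semidec (forbids X A ?V)"
      by (rule re_patterns_of_semidec_forbids[where R = ?R and V = ?V and val = "free_eval G",
            OF T A W dec _ _ _ sd]; (rule R V Xv; assumption?))
  qed
qed

end

section \<open>Compactness\<close>

text \<open>The infinite path runs through nodes with extensions of every length: among the finitely
  many children of such a node, one has the same property.\<close>

lemma koenig:
  fixes B :: "nat list \<Rightarrow> bool"
  assumes prefix: "\<And>\<sigma> \<tau>. B (\<sigma> @ \<tau>) \<Longrightarrow> B \<sigma>"
    and long: "\<And>N. \<exists>\<sigma>. length \<sigma> = N \<and> set \<sigma> \<subseteq> {..<k} \<and> B \<sigma>"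
  obtains y where "\<And>i. y i < k" "\<And>N. B (map y [0..<N])"
proof -
  define ext where "ext \<sigma> \<longleftrightarrow> (\<forall>N. \<exists>\<tau>. length \<tau> = N \<and> set (\<sigma> @ \<tau>) \<subseteq> {..<k} \<and> B (\<sigma> @ \<tau>))" for \<sigma>
  have step: "\<exists>a<k. ext (\<sigma> @ [a])" if \<sigma>: "ext \<sigma>" for \<sigma>
  proof (rule ccontr)
    assume "\<not> (\<exists>a<k. ext (\<sigma> @ [a]))"
    then obtain N where N: "\<And>a \<tau>. a < k \<Longrightarrow> length \<tau> = N a \<Longrightarrow>
        \<not> (set ((\<sigma> @ [a]) @ \<tau>) \<subseteq> {..<k} \<and> B ((\<sigma> @ [a]) @ \<tau>))"
      unfolding ext_def by metis
    \<comment> \<open>If child \<open>a\<close> has no extension by \<open>N a\<close> letters, then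
      an extension of \<open>\<sigma>\<close> by more than all these lengths contradicts the failure
      of the child it passes through.\<close>
    define M where "M = Max (N ` {..<k})"
    obtain \<tau> where \<tau>: "length \<tau> = Suc M" "set (\<sigma> @ \<tau>) \<subseteq> {..<k}" "B (\<sigma> @ \<tau>)"
      using \<sigma> unfolding ext_def by blast
    then obtain a \<rho> where \<rho>: "\<tau> = a # \<rho>" "length \<rho> = M" by (cases \<tau>) auto
    then have a: "a < k" using \<tau>(2) by simp
    then have "N a \<le> M" unfolding M_def by (intro Max_ge) auto
    then have "length (take (N a) \<rho>) = N a" using \<rho>(2) by simp
    moreover have "B ((\<sigma> @ [a]) @ take (N a) \<rho>)"
      using \<tau>(3) \<rho>(1) prefix[of "(\<sigma> @ [a]) @ take (N a) \<rho>" "drop (N a) \<rho>"] by simp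
    moreover have "set ((\<sigma> @ [a]) @ take (N a) \<rho>) \<subseteq> {..<k}"
      using \<tau>(2) \<rho>(1) set_take_subset[of "N a" \<rho>] by auto
    ultimately show False using N[OF a] by blast
  qed
  define next_letter where "next_letter \<sigma> = (SOME a. a < k \<and> ext (\<sigma> @ [a]))" for \<sigma>
  have next_letter: "next_letter \<sigma> < k" "ext (\<sigma> @ [next_letter \<sigma>])" if "ext \<sigma>" for \<sigma>
    using someI_ex[OF step[OF that, unfolded Bex_def]] unfolding next_letter_def by auto
  define path where "path = rec_nat [] (\<lambda>_ \<sigma>. \<sigma> @ [next_letter \<sigma>])"
  have path_Suc: "path (Suc n) = path n @ [next_letter (path n)]" for n by (simp add: path_def)
  have "ext []" using long by (simp add: ext_def)
  then have ext: "ext (path n)" for n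
    by (induction n) (auto simp: path_Suc next_letter(2), simp add: path_def)
  define y where "y n = next_letter (path n)" for n
  have path: "path n = map y [0..<n]" for n
    by (induction n) (simp_all add: path_Suc y_def, simp add: path_def)
  show thesis
  proof
    show "y i < k" for i using next_letter(1)[OF ext] by (simp add: y_def)
    show "B (map y [0..<N])" for N
      using ext[of N] unfolding ext_def path by (metis append_Nil2 length_0_conv)
  qed
qed

text \<open>The list \<open>\<sigma>\<close> assigns values to the words with code below its length
  and leaves the others undetermined. Contradiction and containment both require determined words,
  and so persist when \<open>\<sigma>\<close> is prolonged.\<close>

definition contradicts :: "nat list \<Rightarrow> (nat list \<times> nat) list \<Rightarrow> bool" where
  "contradicts \<sigma> l \<longleftrightarrow> (\<exists>p\<in>set l. code (fst p) < length \<sigma> \<and> item \<sigma> (code (fst p)) \<noteq> snd p)"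

definition contains :: "nat list \<Rightarrow> (nat list \<times> nat) list \<Rightarrow> bool" where
  "contains \<sigma> l \<longleftrightarrow> (\<forall>p\<in>set l. code (fst p) < length \<sigma> \<and> item \<sigma> (code (fst p)) = snd p)"

lemma decidable_contradicts [computable_intros]:
  "computable f \<Longrightarrow> computable g \<Longrightarrow> decidable (\<lambda>x. contradicts (f x) (g x))"
  unfolding contradicts_def
  by (intro computable_intros decidable_not[OF decidable_eq] computable_compose[where g = fst])

lemma decidable_contains [computable_intros]:
  "computable f \<Longrightarrow> computable g \<Longrightarrow> decidable (\<lambda>x. contains (f x) (g x))"
  unfolding contains_def
  by (intro computable_intros computable_compose[where g = fst])

lemma item_append: "i < length \<sigma> \<Longrightarrow> item (\<sigma> @ \<tau>) i = item \<sigma> i"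
  by (simp add: nth_append)

lemma item_map_code: "code w < N \<Longrightarrow> item (map y [0..<N]) (code w) = y (code w)"
  by simp

text \<open>By compactness, a pattern is forbidden in the set of configurations avoiding the cylinders
  in \<open>Q\<close> iff for some \<open>N\<close> every assignment of values to the first \<open>N\<close> words either contradicts it
  or lies in one of these cylinders.\<close>

lemma semidec_forbids_of_cylinders:
  assumes Q: "semidec Q"
    and X: "\<And>z. (\<exists>x\<in>X. \<forall>w. z w = to_nat_on A (x (V w))) \<longleftrightarrow>
      (\<forall>w. z w < card A) \<and> (\<forall>l. Q l \<longrightarrow> (\<exists>p\<in>set l. z (fst p) \<noteq> snd p))"
  shows "semidec (forbids X A V)"
proof -
  have "forbids X A V l \<longleftrightarrow> (\<exists>N. \<forall>\<sigma>\<in>set (List.n_lists N [0..<card A]).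
      contradicts \<sigma> l \<or> (\<exists>m. Q m \<and> contains \<sigma> m))" for l
  proof
    assume *: "forbids X A V l"
    show "\<exists>N. \<forall>\<sigma>\<in>set (List.n_lists N [0..<card A]). contradicts \<sigma> l \<or> (\<exists>m. Q m \<and> contains \<sigma> m)"
    proof (rule ccontr)
      \<comment> \<open>If no \<open>N\<close> works, this prefix-closed tree has nodes at every
        level. An infinite path is a function on words that avoids all cylinders in
        \<open>Q\<close>, hence comes from a point of \<open>X\<close>, and it satisfies
        \<open>l\<close>.\<close>
      define B where "B \<sigma> \<longleftrightarrow> \<not> contradicts \<sigma> l \<and> \<not> (\<exists>m. Q m \<and> contains \<sigma> m)" for \<sigma>
      assume "\<not> ?thesis"
      then have "\<exists>\<sigma>. length \<sigma> = N \<and> set \<sigma> \<subseteq> {..<card A} \<and> B \<sigma>" for N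
        by (fastforce simp: B_def set_n_lists lessThan_atLeast0)
      moreover have "B \<sigma>" if "B (\<sigma> @ \<tau>)" for \<sigma> \<tau>
      proof -
        have "contradicts (\<sigma> @ \<tau>) m" if "contradicts \<sigma> m" for m
          using that unfolding contradicts_def by (metis item_append length_append trans_less_add1)
        moreover have "contains (\<sigma> @ \<tau>) m" if "contains \<sigma> m" for m
          using that unfolding contains_def by (metis item_append length_append trans_less_add1)
        ultimately show ?thesis using that unfolding B_def by blast
      qed
      ultimately obtain y where y: "\<And>i. y i < card A" "\<And>N. B (map y [0..<N])"
        using koenig[of B "card A"] by blast
      define z where "z w = y (code w)" for w :: "nat list"
      have "\<exists>p\<in>set m. z (fst p) \<noteq> snd p" if "Q m" for m
      proof (rule ccontr)
        assume eq: "\<not> ?thesis"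
        \<comment> \<open>Large enough for the prefix to determine all words of \<open>m\<close>, so
          that agreement of \<open>z\<close> with \<open>m\<close> becomes containment in its
          cylinder.\<close>
        define N where "N = Suc (Max ((code \<circ> fst) ` set m))"
        have "code (fst p) < N" if "p \<in> set m" for p
          using that Max_ge[of "(code \<circ> fst) ` set m" "code (fst p)"]
          unfolding N_def less_Suc_eq_le by force
        then have "contains (map y [0..<N]) m"
          using eq unfolding contains_def z_def by (simp add: item_map_code del: item_nth)
        with y(2)[of N] \<open>Q m\<close> show False unfolding B_def by blast
      qed
      then obtain x where x: "x \<in> X" "\<And>w. z w = to_nat_on A (x (V w))"
        using X[of z] y(1) unfolding z_def by blast
      then obtain p where p: "p \<in> set l" "z (fst p) \<noteq> snd p"
        using * unfolding forbids_def case_prod_beta by metis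
      then have "contradicts (map y [0..<Suc (code (fst p))]) l"
        unfolding contradicts_def z_def by (intro bexI[OF _ p(1)]) (simp add: item_map_code del: item_nth upt_Suc)
      with y(2) show False unfolding B_def by blast
    qed
  next
    assume "\<exists>N. \<forall>\<sigma>\<in>set (List.n_lists N [0..<card A]). contradicts \<sigma> l \<or> (\<exists>m. Q m \<and> contains \<sigma> m)"
    then obtain N where N: "\<And>\<sigma>. length \<sigma> = N \<Longrightarrow> set \<sigma> \<subseteq> {..<card A} \<Longrightarrow>
        contradicts \<sigma> l \<or> (\<exists>m. Q m \<and> contains \<sigma> m)"
      by (auto simp: set_n_lists lessThan_atLeast0)
    show "forbids X A V l"
      unfolding forbids_def
    proof
      assume "\<exists>x\<in>X. \<forall>(w, a)\<in>set l. to_nat_on A (x (V w)) = a"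
      then obtain x where x: "x \<in> X" "\<And>p. p \<in> set l \<Longrightarrow> to_nat_on A (x (V (fst p))) = snd p"
        by (auto simp: case_prod_beta)
      define z where "z w = to_nat_on A (x (V w))" for w
      have z: "\<And>w. z w < card A" "\<And>m. Q m \<Longrightarrow> \<exists>p\<in>set m. z (fst p) \<noteq> snd p"
        using X[of z] x(1) unfolding z_def by blast+
      define \<sigma> where "\<sigma> = map (\<lambda>i. z (decode i)) [0..<N]"
      have \<sigma>: "item \<sigma> (code w) = z w" if "code w < N" for w
        using that by (simp add: \<sigma>_def)
      have "length \<sigma> = N" "set \<sigma> \<subseteq> {..<card A}" using z(1) by (auto simp: \<sigma>_def)
      from N[OF this] show False
      proof
        assume "contradicts \<sigma> l"
        then show False using \<sigma> x(2) \<open>length \<sigma> = N\<close>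
          unfolding contradicts_def z_def by (metis (no_types, lifting))
      next
        assume "\<exists>m. Q m \<and> contains \<sigma> m"
        then show False using \<sigma> z(2) \<open>length \<sigma> = N\<close>
          unfolding contains_def by (metis (no_types, lifting))
      qed
    qed
  qed
  moreover have "semidec (\<lambda>l. \<exists>N. \<forall>\<sigma>\<in>set (List.n_lists N [0..<card A]).
      contradicts \<sigma> l \<or> (\<exists>m. Q m \<and> contains \<sigma> m))"
    by (intro semidec_intros semidec_compose[OF Q] semidec_decidable[OF decidable_contradicts]
        semidec_decidable[OF decidable_contains] computable_intros)
  ultimately show ?thesis by presburger
qed


section \<open>Subshifts defined by pattern codings\<close>

context group
begin

lemma word_map_surj:
  assumes S: "fin_sym_gen_set G S" and g: "g \<in> carrier G"
  shows "\<exists>w. word_map G (letter G S (\<lambda>s. s)) w = g"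
proof (rule generate_word_map)
  have fS: "finite S" "S \<subseteq> carrier G" "generate G S = carrier G" "\<And>s. s \<in> S \<Longrightarrow> inv s \<in> S"
    using S by (auto simp: fin_sym_gen_set_def fin_gen_set_def)
  show "letter G S (\<lambda>s. s) i \<in> carrier G" for i using fS by (intro letter_closed) auto
  show "S \<subseteq> carrier G" "g \<in> generate G S" using fS g by auto
  have "s \<in> range (letter G S (\<lambda>s. s))" if "s \<in> S" for s
    using letter_to_nat_on[OF fS(1) that, of G "\<lambda>s. s"] by (metis rangeI)
  then show "s \<in> range (letter G S (\<lambda>s. s)) \<and> inv s \<in> range (letter G S (\<lambda>s. s))" if "s \<in> S" for s
    using fS(4) that by blast
qed

text \<open>Two words agree iff the first followed by a formal inverse of the second is trivial.
  Symmetry of \<open>S\<close> lets the inverse be spelled letter by letter, by a finite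
  table.\<close>

lemma semidec_word_problem:
  assumes S: "fin_sym_gen_set G S" and re: "re_words S {w \<in> lists S. word_val G w = \<one>}"
  shows "semidec (\<lambda>p. word_map G (letter G S (\<lambda>s. s)) (fst p) = word_map G (letter G S (\<lambda>s. s)) (snd p))"
proof -
  let ?e = "letter G S (\<lambda>s. s)" and ?V = "word_map G (letter G S (\<lambda>s. s))"
  have fS: "finite S" "S \<subseteq> carrier G" "\<And>s. s \<in> S \<Longrightarrow> inv s \<in> S"
    using S by (auto simp: fin_sym_gen_set_def fin_gen_set_def)
  have e: "?e i \<in> carrier G" for i using fS by (intro letter_closed) auto
  define N where "N = word_code S ` {w \<in> lists S. word_val G w = \<one>}"
  have sN: "semidec (\<lambda>n. n \<in> N)" using re unfolding re_words_def re_set_iff_semidec N_def .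
  \<comment> \<open>Deleting the numbers that are no letters gives the code of a word over
    \<open>S\<close>, to which the recursive presentation applies.\<close>
  define f where "f w = filter (\<lambda>i. i < card S) w" for w :: "nat list"
  have "?V w = \<one> \<longleftrightarrow> code (f w) \<in> N" for w
  proof -
    have "(\<lambda>s. s) ` S \<subseteq> carrier G" using fS(2) by simp
    then obtain u where u: "u \<in> lists S" "letters_of S u = f w" "?V w = word_val G (map (\<lambda>s. s) u)"
      unfolding f_def using word_map_letter_eq[OF fS(1)] by blast
    then have fw: "f w = letters_of S u" and V: "?V w = word_val G u" by simp_all
    have "?V w = \<one> \<longleftrightarrow> word_val G u = \<one>" unfolding V ..
    also have "\<dots> \<longleftrightarrow> code (f w) \<in> N"
    proof
      assume "word_val G u = \<one>"
      then show "code (f w) \<in> N" using u(1) unfolding N_def fw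
        by (intro image_eqI[of _ _ u]) (auto simp: code_nat_list word_code_def letters_of_def)
    next
      assume "code (f w) \<in> N"
      then obtain v where v: "v \<in> lists S" "word_val G v = \<one>" "code (letters_of S u) = word_code S v"
        unfolding N_def fw by blast
      then have "letters_of S u = letters_of S v"
        by (simp add: code_nat_list word_code_def letters_of_def list_encode_eq)
      then show "word_val G u = \<one>" using letters_of_eq_iff[OF fS(1) u(1) v(1)] v(2) by simp
    qed
    finally show ?thesis .
  qed
  moreover have "semidec (\<lambda>w. code (f w) \<in> N)"
    unfolding f_def by (intro semidec_compose[OF sN] computable_intros)
  ultimately have V1: "semidec (\<lambda>w. ?V w = \<one>)" by presburger
  \<comment> \<open>The default \<open>card S\<close> is itself no letter, hence names the identity,
    which is its own inverse.\<close>
  define \<iota> where "\<iota> i = (if i < card S then to_nat_on S (inv (from_nat_into S i)) else card S)" for i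
  have c\<iota>: "computable \<iota>" by (rule computable_finite_support[of "card S" _ "card S"]) (simp add: \<iota>_def)
  have \<iota>: "?e (\<iota> i) = inv (?e i)" for i
  proof (cases "i < card S")
    case True
    then show ?thesis
      using letter_to_nat_on[OF fS(1), of "inv (from_nat_into S i)" G "\<lambda>s. s"] fS(3) from_nat_into_less(1)[OF fS(1) True]
      by (simp add: \<iota>_def letter_def)
  qed (simp add: \<iota>_def letter_def)
  have V_inv: "?V (rev (map \<iota> w)) = inv (?V w)" for w
  proof (induction w)
    case (Cons i w)
    have "?V w \<in> carrier G" using e by simp
    then show ?case using e Cons \<iota> by (simp add: word_map_append[OF e] inv_mult_group)
  qed simp
  have "?V u = ?V v \<longleftrightarrow> ?V (u @ rev (map \<iota> v)) = \<one>" for u v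
  proof -
    have c: "?V u \<in> carrier G" "?V v \<in> carrier G" using e by auto
    have "?V (u @ rev (map \<iota> v)) = ?V u \<otimes> inv ?V v"
      using e by (simp add: word_map_append V_inv)
    then show ?thesis by (simp only: inv_solve_right'[OF one_closed c] l_one[OF c(2)])
  qed
  moreover have "semidec (\<lambda>p. ?V (fst p @ rev (map \<iota> (snd p))) = \<one>)"
    by (intro semidec_compose[OF V1] computable_intros computable_compose[OF c\<iota>])
  ultimately show ?thesis by presburger
qed

lemma shift_mem_cylinder_iff:
  assumes x: "x \<in> carrier G \<rightarrow>\<^sub>E A" and h: "h \<in> carrier G"
    and c: "\<And>w. w \<in> dom c \<Longrightarrow> word_val G w \<in> carrier G"
  shows "x \<in> shift G h ` cylinder G A c \<longleftrightarrow> (\<forall>w\<in>dom c. c w = Some (x (h \<otimes> word_val G w)))"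
proof
  assume "x \<in> shift G h ` cylinder G A c"
  then obtain y where y: "y \<in> cylinder G A c" "x = shift G h y" by blast
  show "\<forall>w\<in>dom c. c w = Some (x (h \<otimes> word_val G w))"
    using y h c by (auto simp: cylinder_def shift_def m_assoc[symmetric])
next
  assume *: "\<forall>w\<in>dom c. c w = Some (x (h \<otimes> word_val G w))"
  define y where "y = (\<lambda>k\<in>carrier G. x (h \<otimes> k))"
  have "y \<in> cylinder G A c"
    using * x h c by (auto simp: cylinder_def y_def)
  moreover have "x = shift G h y"
    using x h by (auto simp: shift_def y_def m_assoc[symmetric] fun_eq_iff restrict_def PiE_def extensional_def)
  ultimately show "x \<in> shift G h ` cylinder G A c" by blast
qed

text \<open>The codings live on a generating set \<open>T\<close> of their own, whereas equality of
  words is semidecidable over \<open>S\<close>; words over \<open>T\<close> are therefore respelled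
  over \<open>S\<close> before the cylinders are formed.\<close>

lemma semidec_forbids_of_ecp:
  assumes A: "finite A" and ecp: "ecp G A X"
    and S: "fin_sym_gen_set G S" and re: "re_words S {w \<in> lists S. word_val G w = \<one>}"
  shows "semidec (forbids X A (word_map G (letter G S (\<lambda>s. s))))"
proof -
  let ?e = "letter G S (\<lambda>s. s)" and ?V = "word_map G (letter G S (\<lambda>s. s))"
  have fS: "finite S" "S \<subseteq> carrier G" "\<And>s. s \<in> S \<Longrightarrow> inv s \<in> S"
    using S by (auto simp: fin_sym_gen_set_def fin_gen_set_def)
  have e: "?e i \<in> carrier G" for i using fS by (intro letter_closed) auto
  then have V: "?V w \<in> carrier G" for w by simp
  from ecp obtain T C where T: "fin_sym_gen_set G T" and C: "C \<subseteq> finite_patterns (lists T) A"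
    and reC: "re_patterns T A C" and XC: "X = avoiding G A C"
    unfolding ecp_def by blast
  have fT: "finite T" "T \<subseteq> carrier G"
    using T by (auto simp: fin_sym_gen_set_def fin_gen_set_def)
  define N where "N = pattern_code T A ` C"
  have sN: "semidec (\<lambda>n. n \<in> N)" using reC unfolding re_patterns_def re_set_iff_semidec N_def .
  have eT: "letter G T (\<lambda>s. s) i \<in> carrier G" for i using fT by (intro letter_closed) auto
  define t where "t i = (if card T \<le> i then [] else SOME w. ?V w = letter G T (\<lambda>s. s) i)" for i
  have t: "?V (t i) = letter G T (\<lambda>s. s) i" for i
  proof (cases "card T \<le> i")
    case False
    then show ?thesis using someI_ex[OF word_map_surj[OF S eT[of i]]] by (simp add: t_def)
  qed (simp add: t_def letter_def)
  have ct: "computable t" by (rule computable_finite_support[of "card T" _ "[]"]) (simp add: t_def)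
  define \<tau> where "\<tau> w = concat (map t w)" for w
  have \<tau>: "?V (\<tau> (letters_of T w)) = word_val G w" if "w \<in> lists T" for w
    unfolding \<tau>_def word_map_concat[OF e t] word_map_letters_of[OF fT(1) that] by simp
  define tr where "tr g n = map (\<lambda>p. (g @ \<tau> (fst p), snd p)) (entries n)" for g n
  \<comment> \<open>Avoiding the first family makes a function on words depend only on the group
    element. In the second, prefixing the word \<open>g\<close> translates a pattern by its value;
    words reach every element, so all translates occur.\<close>
  define Q where "Q l \<longleftrightarrow> (\<exists>u v a b. l = [(u, a), (v, b)] \<and> a \<noteq> b \<and> ?V u = ?V v) \<or>
      (\<exists>g n. n \<in> N \<and> l = tr g n)" for l
  have tr_iff: "(\<forall>p\<in>set (tr g (pattern_code T A c)). to_nat_on A (x (?V (fst p))) = snd p) \<longleftrightarrow>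
      x \<in> shift G (?V g) ` cylinder G A c" if c: "c \<in> C" and x: "x \<in> carrier G \<rightarrow>\<^sub>E A" for g c x
  proof -
    have cf: "c \<in> finite_patterns (lists T) A" using c C by blast
    have dom: "w \<in> lists T" "word_val G w \<in> carrier G" if "w \<in> dom c" for w
    proof -
      show "w \<in> lists T" using cf that by (auto simp: finite_patterns_def)
      then show "word_val G w \<in> carrier G" using fT(2) by (intro word_val_closed) auto
    qed
    have "(\<forall>p\<in>set (tr g (pattern_code T A c)). to_nat_on A (x (?V (fst p))) = snd p) \<longleftrightarrow>
        (\<forall>(w, a)\<in>Map.graph c. to_nat_on A (x (?V (g @ \<tau> (letters_of T w)))) = to_nat_on A a)"
      unfolding tr_def set_map set_entries_pattern_code[OF cf] by (simp add: case_prod_beta)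
    also have "\<dots> \<longleftrightarrow> (\<forall>(w, a)\<in>Map.graph c. c w = Some (x (?V g \<otimes> word_val G w)))"
    proof (intro ball_cong refl, clarify)
      fix w a assume "(w, a) \<in> Map.graph c"
      then have w: "w \<in> dom c" "c w = Some a" "a \<in> A"
        using graph_finite_patterns[OF cf] by auto
      have "?V (g @ \<tau> (letters_of T w)) = ?V g \<otimes> word_val G w"
        using \<tau>[OF dom(1)[OF w(1)]] e by (simp add: word_map_append)
      moreover have "x (?V g \<otimes> word_val G w) \<in> A" using x V dom(2)[OF w(1)] by auto
      ultimately show "to_nat_on A (x (?V (g @ \<tau> (letters_of T w)))) = to_nat_on A a \<longleftrightarrow>
          c w = Some (x (?V g \<otimes> word_val G w))"
        using w(2,3) inj_on_to_nat_on_finite[OF A] by (auto simp: inj_on_eq_iff)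
    qed
    also have "\<dots> \<longleftrightarrow> (\<forall>w\<in>dom c. c w = Some (x (?V g \<otimes> word_val G w)))"
      by (auto simp: Map.graph_def dom_def)
    also have "\<dots> \<longleftrightarrow> x \<in> shift G (?V g) ` cylinder G A c"
      by (rule shift_mem_cylinder_iff[symmetric, OF x V dom(2)])
    finally show ?thesis .
  qed
  have X_iff: "x \<in> X \<longleftrightarrow> x \<in> carrier G \<rightarrow>\<^sub>E A \<and>
      (\<forall>g. \<forall>c\<in>C. \<not> (\<forall>p\<in>set (tr g (pattern_code T A c)). to_nat_on A (x (?V (fst p))) = snd p))" for x
  proof -
    have "x \<in> X \<longleftrightarrow> x \<in> carrier G \<rightarrow>\<^sub>E A \<and> (\<forall>h\<in>carrier G. \<forall>c\<in>C. x \<notin> shift G h ` cylinder G A c)"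
      unfolding XC avoiding_def by blast
    also have "\<dots> \<longleftrightarrow> x \<in> carrier G \<rightarrow>\<^sub>E A \<and> (\<forall>g. \<forall>c\<in>C. x \<notin> shift G (?V g) ` cylinder G A c)"
      using word_map_surj[OF S] V by metis
    finally show ?thesis using tr_iff by blast
  qed
  show ?thesis
  proof (rule semidec_forbids_of_cylinders)
    have "semidec (\<lambda>l. (\<exists>u v a b. l = [(u, a), (v, b)] \<and> a \<noteq> b \<and> ?V u = ?V v) \<or>
        (\<exists>g n. n \<in> N \<and> l = tr g n))"
      unfolding tr_def \<tau>_def
      by (intro semidec_intros semidec_compose2[OF semidec_word_problem[OF S re]]
          semidec_compose[OF sN] semidec_decidable[OF decidable_eq] semidec_decidable[OF decidable_not]
          computable_intros computable_compose[OF ct])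
    then show "semidec Q" unfolding Q_def[abs_def] .
    show "(\<exists>x\<in>X. \<forall>w. z w = to_nat_on A (x (?V w))) \<longleftrightarrow>
      (\<forall>w. z w < card A) \<and> (\<forall>l. Q l \<longrightarrow> (\<exists>p\<in>set l. z (fst p) \<noteq> snd p))" for z
    proof
      assume "\<exists>x\<in>X. \<forall>w. z w = to_nat_on A (x (?V w))"
      then obtain x where x: "x \<in> X" "\<And>w. z w = to_nat_on A (x (?V w))" by blast
      have xA: "x \<in> carrier G \<rightarrow>\<^sub>E A" using x(1) X_iff by blast
      have "z w < card A" for w
        unfolding x(2) using xA V by (intro to_nat_on_less[OF A]) auto
      moreover have "\<exists>p\<in>set l. z (fst p) \<noteq> snd p" if "Q l" for l
        using that unfolding Q_def
      proof (elim disjE exE conjE)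
        fix g n assume n: "n \<in> N" "l = tr g n"
        then obtain c where c: "c \<in> C" "n = pattern_code T A c" unfolding N_def by blast
        then show ?thesis using X_iff x n(2) by metis
      qed (auto simp: x(2))
      ultimately show "(\<forall>w. z w < card A) \<and> (\<forall>l. Q l \<longrightarrow> (\<exists>p\<in>set l. z (fst p) \<noteq> snd p))" by blast
    next
      assume z: "(\<forall>w. z w < card A) \<and> (\<forall>l. Q l \<longrightarrow> (\<exists>p\<in>set l. z (fst p) \<noteq> snd p))"
      have z_eq: "z u = z v" if "?V u = ?V v" for u v
      proof (rule ccontr)
        assume "z u \<noteq> z v"
        then have "Q [(u, z u), (v, z v)]" unfolding Q_def using that by blast
        with z show False by fastforce
      qed
      \<comment> \<open>Any spelling of \<open>g\<close> may be chosen: by \<open>z_eq\<close> the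
        function \<open>z\<close> is constant on the spellings of one element.\<close>
      define x where "x = (\<lambda>g\<in>carrier G. from_nat_into A (z (SOME w. ?V w = g)))"
      have "x (?V w) = from_nat_into A (z w)" for w
      proof -
        have "?V (SOME u. ?V u = ?V w) = ?V w" by (rule someI[of "\<lambda>u. ?V u = ?V w" w]) simp
        then have "z (SOME u. ?V u = ?V w) = z w" by (rule z_eq)
        then show ?thesis using V by (simp add: x_def)
      qed
      then have xz: "to_nat_on A (x (?V w)) = z w" for w
        using z from_nat_into_less(2)[OF A] by simp
      have "x \<in> carrier G \<rightarrow>\<^sub>E A"
        using z from_nat_into_less(1)[OF A] by (auto simp: x_def)
      moreover have "Q (tr g (pattern_code T A c))" if "c \<in> C" for g c
        using that unfolding Q_def N_def by blast
      ultimately have "x \<in> X" unfolding X_iff xz using z by blast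
      then show "\<exists>x\<in>X. \<forall>w. z w = to_nat_on A (x (?V w))" using xz by metis
    qed
  qed
qed

theorem ecp_imp_effective:
  assumes A: "finite A" and ecp: "ecp G A X" and rp: "recursively_presented G"
  shows "effective G A X"
proof -
  obtain S where S: "fin_sym_gen_set G S" "re_words S {w \<in> lists S. word_val G w = \<one>}"
    using rp unfolding recursively_presented_def by blast
  then have S': "fin_gen_set G S" by (simp add: fin_sym_gen_set_def)
  then have fS: "finite S" "S \<subseteq> carrier G" by (simp_all add: fin_gen_set_def)
  have "semidec (forbids X A (word_map G (free_gens S)))"
  proof (rule semidec_forbids_change_letters[OF _ _ _ semidec_forbids_of_ecp[OF A ecp S]])
    show "letter G S (\<lambda>s. s) i \<in> carrier G" for i using fS by (intro letter_closed) auto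
    show "\<exists>w. word_map G (letter G S (\<lambda>s. s)) w = free_gens S i" for i
      by (rule word_map_surj[OF S(1) free_gens_closed[OF fS]])
    show "free_gens S i = \<one>" if "card (signed S) \<le> i" for i
      using that by (rule free_gens_one)
  qed
  moreover have "X \<subseteq> carrier G \<rightarrow>\<^sub>E A" using ecp by (auto simp: ecp_def avoiding_def)
  ultimately show ?thesis
    unfolding effective_def using re_pullback_iff_semidec_forbids[OF A _ S'] S' by blast
qed

end

section \<open>The topology of the full shift\<close>

lemma topspace_full_shift [simp]: "topspace (full_shift G A) = carrier G \<rightarrow>\<^sub>E A"
  by (simp add: full_shift_def)

lemma compact_space_full_shift: "finite A \<Longrightarrow> compact_space (full_shift G A)"
  by (simp add: full_shift_def compact_space_product_topology compact_space_discrete_topology)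

lemma openin_full_shift_cylinder:
  assumes "finite F" "x \<in> carrier G \<rightarrow>\<^sub>E A"
  shows "openin (full_shift G A) {y \<in> carrier G \<rightarrow>\<^sub>E A. \<forall>g\<in>F \<inter> carrier G. y g = x g}"
proof -
  let ?U = "\<lambda>g. if g \<in> F then {x g} \<inter> A else A"
  have "openin (full_shift G A) (PiE (carrier G) ?U)"
    unfolding full_shift_def
  proof (rule product_topology_basis)
    show "finite {i. ?U i \<noteq> topspace (discrete_topology A)}"
      by (rule finite_subset[OF _ assms(1)]) auto
  qed auto
  moreover have "PiE (carrier G) ?U = {y \<in> carrier G \<rightarrow>\<^sub>E A. \<forall>g\<in>F \<inter> carrier G. y g = x g}"
    using assms(2) by (auto simp: PiE_iff extensional_def split: if_splits)
  ultimately show ?thesis by simp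
qed

lemma openin_full_shiftE:
  assumes "openin (full_shift G A) U" "x \<in> U"
  obtains F where "finite F" "F \<subseteq> carrier G"
    "\<And>y. y \<in> carrier G \<rightarrow>\<^sub>E A \<Longrightarrow> (\<And>g. g \<in> F \<Longrightarrow> y g = x g) \<Longrightarrow> y \<in> U"
proof -
  from assms obtain B where B: "finite {i \<in> carrier G. B i \<noteq> topspace (discrete_topology A)}"
    "\<forall>i\<in>carrier G. openin (discrete_topology A) (B i)" "x \<in> PiE (carrier G) B" "PiE (carrier G) B \<subseteq> U"
    unfolding full_shift_def openin_product_topology_alt by blast
  show thesis
  proof
    show "finite {i \<in> carrier G. B i \<noteq> A}" using B(1) by simp
    fix y assume y: "y \<in> carrier G \<rightarrow>\<^sub>E A" "\<And>g. g \<in> {i \<in> carrier G. B i \<noteq> A} \<Longrightarrow> y g = x g"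
    then have "y g \<in> B g" if "g \<in> carrier G" for g
      using that B(3) by (cases "B g = A") auto
    then have "y \<in> PiE (carrier G) B" using y(1) by (auto simp: PiE_iff)
    then show "y \<in> U" using B(4) by blast
  qed blast
qed

context group
begin

lemma shift_shift:
  assumes "g \<in> carrier G" "h \<in> carrier G"
  shows "shift G g (shift G h x) = shift G (g \<otimes> h) x"
  using assms by (auto simp: shift_def fun_eq_iff inv_mult_group m_assoc)

lemma shift_one: "x \<in> carrier G \<rightarrow>\<^sub>E A \<Longrightarrow> shift G \<one> x = x"
  by (auto simp: shift_def fun_eq_iff PiE_iff extensional_def)

lemma shift_at_one: "g \<in> carrier G \<Longrightarrow> shift G (inv g) x \<one> = x g"
  by (simp add: shift_def)

lemma subshift_subset: "subshift G A X \<Longrightarrow> X \<subseteq> carrier G \<rightarrow>\<^sub>E A"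
  unfolding subshift_def using closedin_subset by fastforce

lemma subshift_shift: "subshift G A X \<Longrightarrow> g \<in> carrier G \<Longrightarrow> x \<in> X \<Longrightarrow> shift G g x \<in> X"
  by (simp add: subshift_def)

lemma subshift_shift_inv:
  assumes "subshift G A X" "g \<in> carrier G" "x \<in> X"
  shows "shift G (inv g) (shift G g x) = x" "shift G g (shift G (inv g) x) = x"
  using assms subshift_subset[OF assms(1)] by (auto simp: shift_shift shift_one[of x A])

lemma continuous_map_shift:
  assumes "g \<in> carrier G"
  shows "continuous_map (full_shift G A) (full_shift G A) (shift G g)"
  unfolding full_shift_def continuous_map_componentwise
proof (intro conjI ballI)
  show "shift G g ` topspace (product_topology (\<lambda>_. discrete_topology A) (carrier G)) \<subseteq> extensional (carrier G)"
    by (auto simp: shift_def)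
  fix k assume "k \<in> carrier G"
  then have eq: "(\<lambda>x. shift G g x k) = (\<lambda>x. x (inv g \<otimes> k))" "inv g \<otimes> k \<in> carrier G"
    using assms by (auto simp: shift_def)
  show "continuous_map (product_topology (\<lambda>_. discrete_topology A) (carrier G)) (discrete_topology A)
      (\<lambda>x. shift G g x k)"
    unfolding eq(1) by (rule continuous_map_product_projection[OF eq(2)])
qed

lemma homeomorphic_map_shift:
  assumes X: "subshift G A X" and g: "g \<in> carrier G"
  shows "homeomorphic_map (subtopology (full_shift G A) X) (subtopology (full_shift G A) X) (shift G g)"
proof -
  have "homeomorphic_maps (subtopology (full_shift G A) X) (subtopology (full_shift G A) X)
      (shift G g) (shift G (inv g))"
    using subshift_shift[OF X] subshift_shift_inv[OF X] g
    by (auto simp: homeomorphic_maps_def continuous_map_in_subtopology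
        intro!: continuous_map_from_subtopology continuous_map_shift)
  then show ?thesis unfolding homeomorphic_map_maps by blast
qed

lemma group_action_shift:
  assumes X: "subshift G A X"
  shows "group_action G X (\<lambda>g. \<lambda>x\<in>X. shift G g x)"
proof -
  have bij: "(\<lambda>x\<in>X. shift G g x) \<in> Bij X" if g: "g \<in> carrier G" for g
  proof -
    have "bij_betw (shift G g) X X"
      by (rule bij_betw_byWitness[where f' = "shift G (inv g)"])
        (use subshift_shift[OF X] subshift_shift_inv[OF X g] g in auto)
    then show ?thesis by (simp add: Bij_def)
  qed
  have "(\<lambda>x\<in>X. shift G (g \<otimes> h) x) = compose X (\<lambda>x\<in>X. shift G g x) (\<lambda>x\<in>X. shift G h x)"
    if "g \<in> carrier G" "h \<in> carrier G" for g h
    using that subshift_shift[OF X] by (auto simp: compose_def shift_shift fun_eq_iff)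
  then have "group_hom G (BijGroup X) (\<lambda>g. \<lambda>x\<in>X. shift G g x)"
    using bij by (intro group_hom.intro is_group group_BijGroup group_hom_axioms.intro)
      (auto simp: hom_def BijGroup_def)
  then show ?thesis by (rule group_action.intro)
qed

end

section \<open>The Baire space as a computable metric space\<close>

definition baire_dist :: "(nat \<Rightarrow> nat) \<Rightarrow> (nat \<Rightarrow> nat) \<Rightarrow> real" where
  "baire_dist x y = (if x = y then 0 else (1 / 2) ^ (LEAST n. x n \<noteq> y n))"

text \<open>Quantifying over all positions, without naming the first difference, turns a ball into a
  conjunction of equations between coordinates.\<close>

lemma baire_dist_less_iff:
  assumes "0 < r"
  shows "baire_dist x y < r \<longleftrightarrow> (\<forall>n. r \<le> (1 / 2) ^ n \<longrightarrow> x n = y n)"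
proof (cases "x = y")
  case False
  define m where "m = (LEAST n. x n \<noteq> y n)"
  have m: "x m \<noteq> y m" "\<And>n. n < m \<Longrightarrow> x n = y n"
    using False LeastI_ex[of "\<lambda>n. x n \<noteq> y n"] not_less_Least unfolding m_def by blast+
  have "x n = y n" if "(1 / 2) ^ m < r" "r \<le> (1 / 2 :: real) ^ n" for n
  proof (rule m(2), rule ccontr)
    assume "\<not> n < m"
    then have "(1 / 2 :: real) ^ n \<le> (1 / 2) ^ m" by (intro power_decreasing) auto
    with that show False by simp
  qed
  then show ?thesis using False m(1) unfolding baire_dist_def m_def[symmetric] by (auto simp: not_less[symmetric])
qed (use assms in \<open>simp add: baire_dist_def\<close>)

lemma baire_dist_ge: "x n \<noteq> y n \<Longrightarrow> (1 / 2) ^ n \<le> baire_dist x y"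
  using baire_dist_less_iff[of "(1 / 2) ^ n" x y] by (force simp: not_less[symmetric])

interpretation baire: Metric_space UNIV baire_dist
proof
  show "0 \<le> baire_dist x y" for x y by (simp add: baire_dist_def)
  show "baire_dist x y = baire_dist y x" for x y by (simp add: baire_dist_def eq_commute)
  show "baire_dist x y = 0 \<longleftrightarrow> x = y" for x y by (simp add: baire_dist_def)
  show "baire_dist x z \<le> baire_dist x y + baire_dist y z" for x y z
  proof (cases "x = z")
    case False
    define m where "m = (LEAST n. x n \<noteq> z n)"
    have "x m \<noteq> z m"
      using False LeastI_ex[of "\<lambda>n. x n \<noteq> z n"] unfolding m_def by blast
    then have "x m \<noteq> y m \<or> y m \<noteq> z m" by auto
    then have "(1 / 2) ^ m \<le> baire_dist x y + baire_dist y z"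
      using baire_dist_ge[of x m y] baire_dist_ge[of y m z]
      by (elim disjE) (auto simp: baire_dist_def intro: add_increasing add_increasing2)
    then show ?thesis using False by (simp add: baire_dist_def m_def)
  qed (simp add: baire_dist_def)
qed

text \<open>The dense sequence: finite lists padded by zeros, numbered by their codes.\<close>

definition finite_seq :: "nat \<Rightarrow> nat \<Rightarrow> nat" where
  "finite_seq i n = (if n < length (decode i :: nat list) then item (decode i) n else 0)"

lemma computable_finite_seq [computable_intros]:
  "computable f \<Longrightarrow> computable g \<Longrightarrow> computable (\<lambda>x. finite_seq (f x) (g x))"
  unfolding finite_seq_def by (intro computable_intros)

lemma finite_seq_code: "n < N \<Longrightarrow> finite_seq (code (map x [0..<N])) n = x n"
  by (simp add: finite_seq_def)

lemma finite_seq_beyond: "i \<le> n \<Longrightarrow> finite_seq i n = 0"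
  using length_le_code[of "decode i :: nat list"] by (simp add: finite_seq_def)

abbreviation ball_data :: "nat \<Rightarrow> nat \<times> nat \<times> nat" where
  "ball_data \<equiv> decode"

text \<open>The condition that the radius is at most \<open>1 / 2 ^ m\<close>, cleared of
  denominators; these are the positions at which a point of the ball must agree with the
  centre.\<close>

definition in_window :: "nat \<Rightarrow> nat \<Rightarrow> bool" where
  "in_window n m \<longleftrightarrow> Suc (fst (snd (ball_data n))) * 2 ^ m
     \<le> Suc (snd (snd (ball_data n)))"

definition center :: "nat \<Rightarrow> nat \<Rightarrow> nat" where
  "center n m = finite_seq (fst (ball_data n)) m"

lemma decidable_in_window [computable_intros]:
  "computable f \<Longrightarrow> computable g \<Longrightarrow> decidable (\<lambda>x. in_window (f x) (g x))"
  unfolding in_window_def by (intro computable_intros)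

lemma computable_center [computable_intros]:
  "computable f \<Longrightarrow> computable g \<Longrightarrow> computable (\<lambda>x. center (f x) (g x))"
  unfolding center_def by (intro computable_intros)

text \<open>The index of a ball bounds the positions it constrains, because the denominator of its
  radius is part of the index. Quantifiers over these positions thereby become bounded.\<close>

lemma in_window_le: "in_window n m \<Longrightarrow> m \<le> n"
proof -
  define i a b where "i = fst (ball_data n)"
    and "a = fst (snd (ball_data n))" and "b = snd (snd (ball_data n))"
  have n: "n = prod_encode (i, prod_encode (a, b))"
    using code_decode[of n, where 'a = "nat \<times> nat \<times> nat"]
    by (simp add: i_def a_def b_def code_prod_def code_nat_def)
  assume "in_window n m"
  then have "Suc a * 2 ^ m \<le> Suc b" by (simp add: in_window_def a_def b_def)
  moreover have "2 ^ m \<le> Suc a * 2 ^ m" by simp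
  ultimately have "2 ^ m \<le> Suc b" by linarith
  moreover have "m < 2 ^ m" by (rule less_exp)
  ultimately have "m \<le> b" by linarith
  also have "b \<le> n" unfolding n using le_prod_encode_2 le_trans by blast
  finally show ?thesis .
qed

lemma basic_ball_code:
  "basic_ball M d s (code (i, a, b)) = Metric_space.mball M d (s i) (real (Suc a) / real (Suc b))"
  by (simp add: basic_ball_def code_prod_def code_nat_def)

abbreviation baire_ball :: "nat \<Rightarrow> (nat \<Rightarrow> nat) set" where
  "baire_ball \<equiv> basic_ball UNIV baire_dist finite_seq"

abbreviation baire_union :: "nat set \<Rightarrow> (nat \<Rightarrow> nat) set" where
  "baire_union \<equiv> basic_union UNIV baire_dist finite_seq"

lemma mem_basic_ball_baire_iff:
  "x \<in> baire_ball n \<longleftrightarrow> (\<forall>m. in_window n m \<longrightarrow> x m = center n m)"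
proof -
  obtain i a b :: nat where d: "decode n = (i, a, b)" using prod_cases3 by blast
  then have n: "n = code (i, a, b)" by (metis code_decode)
  have r: "real (Suc a) / real (Suc b) \<le> (1 / 2) ^ m \<longleftrightarrow> in_window n m" for m
  proof -
    have "real (Suc a) / real (Suc b) \<le> (1 / 2) ^ m \<longleftrightarrow> real (Suc a) * 2 ^ m \<le> real (Suc b)"
      by (simp add: power_divide field_simps del: of_nat_Suc)
    also have "\<dots> \<longleftrightarrow> real (Suc a * 2 ^ m) \<le> real (Suc b)"
      by (simp only: of_nat_mult of_nat_power of_nat_numeral)
    also have "\<dots> \<longleftrightarrow> in_window n m" unfolding of_nat_le_iff by (simp add: in_window_def d)
    finally show ?thesis .
  qed
  have "x \<in> baire_ball n \<longleftrightarrow>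
      baire_dist (finite_seq i) x < real (Suc a) / real (Suc b)"
    unfolding n basic_ball_code by (simp del: of_nat_Suc)
  also have "\<dots> \<longleftrightarrow> (\<forall>m. in_window n m \<longrightarrow> finite_seq i m = x m)"
    using baire_dist_less_iff[of "real (Suc a) / real (Suc b)"] r by simp
  finally show ?thesis by (auto simp: center_def d)
qed

text \<open>The radius is \<open>1 / 2 ^ N\<close>, so exactly the positions up to and including
  \<open>N\<close> are constrained; hence the \<open>Suc N\<close> entries of the centre.\<close>

definition prefix_ball :: "(nat \<Rightarrow> nat) \<Rightarrow> nat \<Rightarrow> nat" where
  "prefix_ball x N = code (code (map x [0..<Suc N]), 0 :: nat, 2 ^ N - 1 :: nat)"

lemma in_window_prefix_ball: "in_window (prefix_ball x N) m \<longleftrightarrow> m \<le> N"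
  by (simp add: in_window_def prefix_ball_def)

lemma center_prefix_ball: "m \<le> N \<Longrightarrow> center (prefix_ball x N) m = x m"
  by (simp add: center_def prefix_ball_def finite_seq_code del: upt_Suc)

lemma half_power_less: "0 < r \<Longrightarrow> \<exists>N. (1 / 2 :: real) ^ N < r"
  by (rule real_arch_pow_inv) auto

lemma baire_mball_prefix:
  assumes "0 < r"
  obtains N where "\<And>y. (\<And>m. m < N \<Longrightarrow> y m = x m) \<Longrightarrow> y \<in> baire.mball x r"
proof -
  obtain N where N: "(1 / 2) ^ N < r" using half_power_less[OF assms] by blast
  have *: "baire_dist x y < r" if "\<And>m. m < N \<Longrightarrow> y m = x m" for y
  proof -
    have "x n = y n" if "r \<le> (1 / 2) ^ n" for n
    proof -
      have "n < N"
      proof (rule ccontr)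
        assume "\<not> n < N"
        then have "(1 / 2 :: real) ^ n \<le> (1 / 2) ^ N" by (intro power_decreasing) auto
        with that N show False by simp
      qed
      then show ?thesis using \<open>\<And>m. m < N \<Longrightarrow> y m = x m\<close> by simp
    qed
    then show ?thesis using baire_dist_less_iff[OF assms] by blast
  qed
  show thesis by (rule that[of N]) (simp add: *)
qed

lemma nat_to_rat_surj_code:
  "nat_to_rat_surj (code (2 * a :: nat, 2 * b :: nat)) = Fract (int a) (int b)"
  by (simp add: nat_to_rat_surj_def code_prod_def code_nat_def int_decode_def sum_decode_def)

lemma computable_metric_space_baire: "computable_metric_space UNIV baire_dist finite_seq"
proof
  show "range finite_seq \<subseteq> UNIV" by simp
  have "\<exists>y\<in>range finite_seq. y \<in> baire.mball x r" if r: "0 < r" for x r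
  proof -
    obtain N where N: "\<And>y. (\<And>m. m < N \<Longrightarrow> y m = x m) \<Longrightarrow> y \<in> baire.mball x r"
      using baire_mball_prefix[OF r] by blast
    have "finite_seq (code (map x [0..<N])) \<in> baire.mball x r"
      by (rule N) (simp add: finite_seq_code)
    then show ?thesis by blast
  qed
  then show "Abstract_Topology.closure_of baire.mtopology (range finite_seq) = UNIV"
    unfolding baire.metric_closure_of by blast
  \<comment> \<open>At position \<open>i + j\<close> both sequences have already become zero. The
    search for a first difference thus ends, and finding none means that they are equal.\<close>
  define k where "k i j = (LEAST m. m = i + j \<or> finite_seq i m \<noteq> finite_seq j m)" for i j
  \<comment> \<open>The exact distance, as the fraction 0/1 or \<open>1 / 2 ^ k\<close>, so one
    output serves every precision. The factors 2 appear because even numbers code the nonnegative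
    integers.\<close>
  define g where "g p = (if finite_seq (fst p) (k (fst p) (snd p)) = finite_seq (snd p) (k (fst p) (snd p))
     then code (2 * 0 :: nat, 2 * 1 :: nat) else code (2 * 1 :: nat, 2 * 2 ^ k (fst p) (snd p) :: nat))" for p
  have ck: "computable (\<lambda>p. k (fst p) (snd p))"
    unfolding k_def
    by (rule computable_Least) (intro computable_intros decidable_not[OF decidable_eq], blast)
  have "computable g"
    unfolding g_def by (intro computable_intros computable_compose2[OF ck])
  then obtain r where r: "\<And>i j. rec_eval r [prod_encode (i, j)] (g (i, j))"
    by (auto simp: computable_def code_prod_def code_nat_def)
  obtain e where e: "rec_eval e [m, n] (prod_encode (m, n))" for m n using recf_prod_encode by blast
  have g: "of_rat (nat_to_rat_surj (g (i, j))) = baire_dist (finite_seq i) (finite_seq j)" for i j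
  proof -
    have ex: "k i j = i + j \<or> finite_seq i (k i j) \<noteq> finite_seq j (k i j)"
      unfolding k_def by (rule LeastI[of _ "i + j"]) simp
    have less: "finite_seq i m = finite_seq j m" if "m < k i j" for m
      using not_less_Least[OF that[unfolded k_def]] by blast
    show ?thesis
    proof (cases "finite_seq i (k i j) = finite_seq j (k i j)")
      case True
      then have "k i j = i + j" using ex by blast
      then have "finite_seq i m = finite_seq j m" for m
        using less[of m] finite_seq_beyond[of i m] finite_seq_beyond[of j m] by (cases "m < i + j") auto
      then have "finite_seq i = finite_seq j" by blast
      then show ?thesis using True
        by (simp add: g_def nat_to_rat_surj_code[of 0 1, simplified] baire_dist_def Fract_of_int_quotient)
    next
      case False
      then have "(LEAST m. finite_seq i m \<noteq> finite_seq j m) = k i j"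
        using less by (intro Least_equality) (auto simp: not_less[symmetric])
      then have "baire_dist (finite_seq i) (finite_seq j) = (1 / 2) ^ k i j"
        using False by (auto simp: baire_dist_def)
      then show ?thesis using False nat_to_rat_surj_code[of 1 "2 ^ k i j"]
        by (simp add: g_def Fract_of_int_quotient of_rat_divide of_rat_power power_divide)
    qed
  qed
  show "\<exists>f. \<forall>i j n. \<exists>r. rec_eval f [i, j, n] r \<and>
      \<bar>baire_dist (finite_seq i) (finite_seq j) - of_rat (nat_to_rat_surj r)\<bar> \<le> 1 / 2 ^ n"
  proof (intro exI allI conjI)
    fix i j n :: nat
    have "rec_eval (Comp e [Proj 0, Proj 1]) [i, j, n] (prod_encode (i, j))"
      by (rule rec_eval_Comp2 rec_eval_Proj e | simp)+
    then show "rec_eval (Comp r [Comp e [Proj 0, Proj 1]]) [i, j, n] (g (i, j))"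
      using r rec_eval_Comp1 by blast
    show "\<bar>baire_dist (finite_seq i) (finite_seq j) - of_rat (nat_to_rat_surj (g (i, j)))\<bar> \<le> 1 / 2 ^ n"
      unfolding g by simp
  qed
qed


section \<open>Effective subshifts are effective dynamical systems\<close>

context group
begin

text \<open>A configuration is read along all words in the order of their codes. An element with
  several spellings is read several times, which avoids any decision about equality in the
  group.\<close>

definition coordinates :: "(nat \<Rightarrow> 'a) \<Rightarrow> 'c set \<Rightarrow> ('a \<Rightarrow> 'c) \<Rightarrow> nat \<Rightarrow> nat" where
  "coordinates e A x n = to_nat_on A (x (word_map G e (decode n)))"

text \<open>A continuous injection of a compact space into a Hausdorff space is an embedding.
  Injectivity holds because every element has a spelling, continuity because a ball constrains
  finitely many coordinates.\<close>

lemma homeomorphic_map_coordinates: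
  assumes A: "finite A" and X: "subshift G A X" and e: "\<And>i. e i \<in> carrier G"
    and surj: "\<And>g. g \<in> carrier G \<Longrightarrow> \<exists>w. word_map G e w = g"
  shows "homeomorphic_map (subtopology (full_shift G A) X)
      (subtopology baire.mtopology (coordinates e A ` X)) (coordinates e A)"
    and "inj_on (coordinates e A) X" and "compactin baire.mtopology (coordinates e A ` X)"
proof -
  let ?\<phi> = "coordinates e A" and ?T = "subtopology (full_shift G A) X"
  have XA: "X \<subseteq> carrier G \<rightarrow>\<^sub>E A" by (rule subshift_subset[OF X])
  then have top: "topspace ?T = X" by auto
  have w: "word_map G e w \<in> carrier G" for w using e by simp
  show inj: "inj_on ?\<phi> X"
  proof (rule inj_onI)
    fix x y assume xy: "x \<in> X" "y \<in> X" "?\<phi> x = ?\<phi> y"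
    have "x (word_map G e w) = y (word_map G e w)" for w
    proof -
      have "to_nat_on A (x (word_map G e w)) = to_nat_on A (y (word_map G e w))"
        using fun_cong[OF xy(3), of "code w"] by (simp add: coordinates_def)
      moreover have "x (word_map G e w) \<in> A" "y (word_map G e w) \<in> A" using xy(1,2) XA w by auto
      ultimately show ?thesis using inj_on_to_nat_on_finite[OF A] by (simp add: inj_on_eq_iff)
    qed
    then have "x g = y g" if "g \<in> carrier G" for g using surj[OF that] by metis
    then show "x = y" using xy XA by (intro PiE_ext[of x "carrier G" "\<lambda>_. A" y]) auto
  qed
  have cont: "continuous_map ?T baire.mtopology ?\<phi>"
    unfolding continuous_map_def
  proof (intro conjI allI impI)
    fix U assume U: "openin baire.mtopology U"
    show "openin ?T {x \<in> topspace ?T. ?\<phi> x \<in> U}"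
    proof (subst openin_subopen, intro ballI)
      fix x assume x: "x \<in> {x \<in> topspace ?T. ?\<phi> x \<in> U}"
      then obtain r where r: "r > 0" "baire.mball (?\<phi> x) r \<subseteq> U"
        using U unfolding baire.openin_mtopology by blast
      then obtain N where N: "\<And>y. (\<And>m. m < N \<Longrightarrow> y m = ?\<phi> x m) \<Longrightarrow> y \<in> baire.mball (?\<phi> x) r"
        using baire_mball_prefix by blast
      define F where "F = (\<lambda>m. word_map G e (decode m)) ` {..<N}"
      define Nb where "Nb = {y \<in> carrier G \<rightarrow>\<^sub>E A. \<forall>g\<in>F \<inter> carrier G. y g = x g}"
      have xX: "x \<in> X" using x top by blast
      have "openin (full_shift G A) Nb"
        unfolding Nb_def F_def using xX XA by (intro openin_full_shift_cylinder) auto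
      then have "openin ?T (Nb \<inter> X)" by (auto simp: openin_subtopology)
      moreover have "x \<in> Nb \<inter> X" using xX XA by (auto simp: Nb_def)
      moreover have "?\<phi> y \<in> U" if "y \<in> Nb" for y
      proof -
        have "?\<phi> y m = ?\<phi> x m" if "m < N" for m
          using \<open>y \<in> Nb\<close> that w unfolding Nb_def F_def coordinates_def by auto
        then show ?thesis using N r(2) by blast
      qed
      ultimately show "\<exists>T. openin ?T T \<and> x \<in> T \<and> T \<subseteq> {x \<in> topspace ?T. ?\<phi> x \<in> U}"
        using top by (intro exI[of _ "Nb \<inter> X"]) blast
    qed
  qed simp
  have comp: "compact_space ?T"
  proof (rule compact_space_subtopology)
    show "compactin (full_shift G A) X"
      using X by (intro closedin_compact_space[OF compact_space_full_shift[OF A]]) (simp add: subshift_def)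
  qed
  show "homeomorphic_map ?T (subtopology baire.mtopology (?\<phi> ` X)) ?\<phi>"
  proof (rule continuous_imp_homeomorphic_map)
    show "continuous_map ?T (subtopology baire.mtopology (?\<phi> ` X)) ?\<phi>"
      using cont top by (auto simp: continuous_map_in_subtopology)
    show "Hausdorff_space (subtopology baire.mtopology (?\<phi> ` X))"
      by (intro Hausdorff_space_subtopology baire.Hausdorff_space_mtopology)
    show "?\<phi> ` topspace ?T = topspace (subtopology baire.mtopology (?\<phi> ` X))"
      using top by simp
  qed (use comp inj top in auto)
  have "compactin ?T X" using comp top by (metis compact_space_def)
  then show "compactin baire.mtopology (?\<phi> ` X)" by (rule image_compactin[OF _ cont])
qed

text \<open>A set of balls with number \<open>n\<close> has members of index below \<open>n\<close>,
  and these constrain only coordinates below \<open>n\<close>. Covering can thus be tested on the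
  finitely many prefixes of length \<open>n\<close>: each is covered or is the prefix of no point,
  and the latter is a forbidden pattern.\<close>

lemma recursively_compact_coordinates:
  assumes A: "finite A" and X: "subshift G A X" and e: "\<And>i. e i \<in> carrier G"
    and comp: "compactin baire.mtopology (coordinates e A ` X)"
    and sd: "semidec (forbids X A (word_map G e))"
  shows "recursively_compact UNIV baire_dist finite_seq (coordinates e A ` X)"
proof -
  let ?\<phi> = "coordinates e A"
  have XA: "X \<subseteq> carrier G \<rightarrow>\<^sub>E A" by (rule subshift_subset[OF X])
  define covered where "covered \<sigma> n \<longleftrightarrow> (\<exists>i\<in>set (elements n). \<forall>m<n. in_window i m \<longrightarrow> item \<sigma> m = center i m)"
    for \<sigma> n
  define pat where "pat \<sigma> n = map (\<lambda>m. (decode m :: nat list, item \<sigma> m)) [0..<n]" for \<sigma> :: "nat list" and n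
  have "word_map G e w \<in> carrier G" for w using e by simp
  then have \<phi>_less: "?\<phi> x m < card A" if "x \<in> X" for x m
    using that XA unfolding coordinates_def by (intro to_nat_on_less[OF A]) auto
  have forbids_pat: "forbids X A (word_map G e) (pat \<sigma> n) \<longleftrightarrow> \<not> (\<exists>x\<in>X. \<forall>m<n. ?\<phi> x m = item \<sigma> m)" for \<sigma> n
    unfolding forbids_def pat_def coordinates_def set_map ball_simps(9) by (simp add: Ball_def)
  have covered: "covered \<sigma> n \<longleftrightarrow> x \<in> baire_union (set_decode n)"
    if "\<And>m. m < n \<Longrightarrow> item \<sigma> m = x m" for \<sigma> n x
  proof -
    have "(\<forall>m<n. in_window i m \<longrightarrow> item \<sigma> m = center i m) \<longleftrightarrow> (\<forall>m. in_window i m \<longrightarrow> x m = center i m)"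
      if "i \<in> set_decode n" for i
      using in_window_le[of i] less_of_mem_set_decode[OF that] \<open>\<And>m. m < n \<Longrightarrow> item \<sigma> m = x m\<close>
      by (metis le_less_trans)
    then show ?thesis
      unfolding covered_def basic_union_def by (simp add: mem_basic_ball_baire_iff)
  qed
  have iff: "n \<in> set_encode ` {I. finite I \<and> ?\<phi> ` X \<subseteq> baire_union I} \<longleftrightarrow>
      (\<forall>\<sigma>\<in>set (List.n_lists n [0..<card A]). covered \<sigma> n \<or> forbids X A (word_map G e) (pat \<sigma> n))" for n
  proof -
    have "n \<in> set_encode ` {I. finite I \<and> ?\<phi> ` X \<subseteq> baire_union I} \<longleftrightarrow>
        ?\<phi> ` X \<subseteq> baire_union (set_decode n)"
      by (auto intro!: image_eqI[of _ set_encode "set_decode n"])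
    also have "\<dots> \<longleftrightarrow> (\<forall>\<sigma>\<in>set (List.n_lists n [0..<card A]). covered \<sigma> n \<or> forbids X A (word_map G e) (pat \<sigma> n))"
    proof (intro iffI ballI)
      fix \<sigma> assume *: "?\<phi> ` X \<subseteq> baire_union (set_decode n)"
      show "covered \<sigma> n \<or> forbids X A (word_map G e) (pat \<sigma> n)"
        unfolding forbids_pat using covered[of n \<sigma>] * by (metis image_subset_iff)
    next
      assume *: "\<forall>\<sigma>\<in>set (List.n_lists n [0..<card A]). covered \<sigma> n \<or> forbids X A (word_map G e) (pat \<sigma> n)"
      show "?\<phi> ` X \<subseteq> baire_union (set_decode n)"
      proof (clarify)
        fix x assume x: "x \<in> X"
        define \<sigma> where "\<sigma> = map (?\<phi> x) [0..<n]"
        have \<sigma>: "item \<sigma> m = ?\<phi> x m" if "m < n" for m using that by (simp add: \<sigma>_def)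
        have "\<sigma> \<in> set (List.n_lists n [0..<card A])"
          using \<phi>_less[OF x] by (auto simp: set_n_lists \<sigma>_def)
        moreover have "\<not> forbids X A (word_map G e) (pat \<sigma> n)" using x \<sigma> unfolding forbids_pat by metis
        ultimately have "covered \<sigma> n" using * by blast
        then show "?\<phi> x \<in> baire_union (set_decode n)"
          using covered[of n \<sigma> "?\<phi> x"] \<sigma> by blast
      qed
    qed
    finally show ?thesis .
  qed
  have "semidec (\<lambda>n. \<forall>\<sigma>\<in>set (List.n_lists n [0..<card A]). covered \<sigma> n \<or> forbids X A (word_map G e) (pat \<sigma> n))"
  proof (rule semidec_ball[OF semidec_disj])
    show "semidec (\<lambda>p. covered (snd p) (fst p))"
      unfolding covered_def by (intro semidec_decidable computable_intros)
    show "semidec (\<lambda>p. forbids X A (word_map G e) (pat (snd p) (fst p)))"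
      unfolding pat_def by (intro semidec_compose[OF sd] computable_intros)
    show "computable (\<lambda>n. List.n_lists n [0..<card A])" by (intro computable_intros)
  qed
  then show ?thesis
    unfolding recursively_compact_def re_set_iff_semidec iff using comp by blast
qed

text \<open>Shifting by \<open>t\<close> reads the old configuration at the inverse of
  \<open>t\<close> times the given element. On words this prepends the letter \<open>c\<close>, so
  the map merely permits reading coordinate \<open>h j\<close> in place of coordinate
  \<open>j\<close>.\<close>

lemma computable_map_coordinates:
  assumes e: "\<And>i. e i \<in> carrier G" and c: "e c = inv t" and t: "t \<in> carrier G"
    and \<alpha>: "\<And>x. x \<in> X \<Longrightarrow> \<alpha> (coordinates e A x) = coordinates e A (shift G t x)"
  shows "computable_map UNIV baire_dist finite_seq (coordinates e A ` X) UNIV baire_dist finite_seq \<alpha>"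
proof -
  let ?\<phi> = "coordinates e A"
  define h where "h j = code (c # (decode j :: nat list))" for j
  have \<alpha>h: "\<alpha> (?\<phi> x) j = ?\<phi> x (h j)" if "x \<in> X" for x j
  proof -
    have "word_map G e w \<in> carrier G" for w using e by simp
    then show ?thesis unfolding \<alpha>[OF that] using c by (simp add: coordinates_def h_def shift_def)
  qed
  \<comment> \<open>Ball \<open>n\<close> is listed for \<open>m\<close> when its equations include
    those of \<open>m\<close> after renaming. The bound on \<open>j\<close> loses nothing by
    \<open>in_window_le\<close>.\<close>
  define R where "R = {p. \<forall>j<Suc (fst p). in_window (fst p) j \<longrightarrow>
      in_window (snd p) (h j) \<and> center (snd p) (h j) = center (fst p) j}"
  have "semidec (\<lambda>n. decode n \<in> R)"
    unfolding R_def mem_Collect_eq h_def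
    by (intro semidec_decidable computable_intros computable_compose[where g = fst])
  moreover have "n \<in> prod_encode ` R \<longleftrightarrow> decode n \<in> R" for n
  proof -
    have "prod_encode p = n \<longleftrightarrow> p = decode n" for p :: "nat \<times> nat"
    proof -
      have "prod_encode p = code p" by (simp add: code_prod_def code_nat_def)
      then show ?thesis using code_eq_iff[of p "decode n"] code_decode by metis
    qed
    then have "n \<in> prod_encode ` R \<longleftrightarrow> (\<exists>p\<in>R. p = decode n)" unfolding image_iff by metis
    then show ?thesis by blast
  qed
  ultimately have "re_set (prod_encode ` R)" unfolding re_set_iff_semidec by simp
  moreover have "{y \<in> ?\<phi> ` X. \<alpha> y \<in> baire_ball m} =
      baire_union {n. (m, n) \<in> R} \<inter> ?\<phi> ` X" for m
  proof -
    have "\<alpha> (?\<phi> x) \<in> baire_ball m \<longleftrightarrow>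
        ?\<phi> x \<in> baire_union {n. (m, n) \<in> R}" if x: "x \<in> X" for x
    proof
      assume "\<alpha> (?\<phi> x) \<in> baire_ball m"
      then have *: "?\<phi> x (h j) = center m j" if "in_window m j" for j
        using that by (simp add: mem_basic_ball_baire_iff \<alpha>h[OF x])
      \<comment> \<open>A prefix this long determines all renamed coordinates that ball
        \<open>m\<close> can constrain.\<close>
      define N where "N = Max (h ` {..m})"
      have N: "h j \<le> N" if "j \<le> m" for j using that unfolding N_def by (intro Max_ge) auto
      have "(m, prefix_ball (?\<phi> x) N) \<in> R"
        using * N by (auto simp: R_def in_window_prefix_ball center_prefix_ball less_Suc_eq_le)
      moreover have "?\<phi> x \<in> baire_ball (prefix_ball (?\<phi> x) N)"
        by (simp add: mem_basic_ball_baire_iff in_window_prefix_ball center_prefix_ball)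
      ultimately show "?\<phi> x \<in> baire_union {n. (m, n) \<in> R}"
        unfolding basic_union_def by blast
    next
      assume "?\<phi> x \<in> baire_union {n. (m, n) \<in> R}"
      then obtain n where n: "(m, n) \<in> R" "?\<phi> x \<in> baire_ball n"
        unfolding basic_union_def by blast
      have "?\<phi> x (h j) = center m j" if "in_window m j" for j
        using n that in_window_le[OF that] by (auto simp: R_def mem_basic_ball_baire_iff less_Suc_eq_le)
      then show "\<alpha> (?\<phi> x) \<in> baire_ball m"
        by (simp add: mem_basic_ball_baire_iff \<alpha>h[OF x])
    qed
    then show ?thesis by blast
  qed
  ultimately show ?thesis unfolding computable_map_def by blast
qed

theorem effective_imp_eds:
  assumes A: "finite A" and X: "subshift G A X" and eff: "effective G A X"
  shows "eds G (subtopology (full_shift G A) X) (shift G)"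
proof -
  obtain S where S: "fin_gen_set G S" and re: "re_patterns (S \<times> UNIV) A
      {p \<in> finite_patterns (carrier (free_group S)) A.
         \<not> (\<exists>y\<in>pullback G S X. \<forall>w\<in>dom p. p w = Some (y w))}"
    using eff unfolding effective_def by blast
  have fS: "finite S" "S \<subseteq> carrier G" "generate G S = carrier G" using S by (auto simp: fin_gen_set_def)
  have XA: "X \<subseteq> carrier G \<rightarrow>\<^sub>E A" by (rule subshift_subset[OF X])
  let ?e = "free_gens S"
  have e: "?e i \<in> carrier G" for i by (rule free_gens_closed[OF fS(1,2)])
  have sd: "semidec (forbids X A (word_map G ?e))"
    using re_pullback_iff_semidec_forbids[OF A XA S] re by blast
  have surj: "\<exists>w. word_map G ?e w = g" if "g \<in> carrier G" for g
    using that fS free_gens_range[OF fS(1)] by (intro generate_word_map[OF e fS(2)]) auto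
  let ?\<phi> = "coordinates ?e A"
  let ?K = "?\<phi> ` X" and ?T = "subtopology (full_shift G A) X"
  note hom = homeomorphic_map_coordinates[OF A X e surj]
  have top: "topspace ?T = X" using XA by auto
  have bij: "bij_betw ?\<phi> X ?K" using hom(2) by (simp add: bij_betw_def)
  define \<alpha> where "\<alpha> = (\<lambda>g. \<lambda>y\<in>?K. ?\<phi> ((\<lambda>x\<in>X. shift G g x) (inv_into X ?\<phi> y)))"
  have ga: "group_action G ?K \<alpha>"
    unfolding \<alpha>_def by (rule group_action_transport[OF group_action_shift[OF X] bij])
  have \<alpha>: "\<alpha> g (?\<phi> x) = ?\<phi> (shift G g x)" if "x \<in> X" for g x
    using that inv_into_f_f[OF hom(2) that] by (simp add: \<alpha>_def)
  have "homeomorphic_map (subtopology baire.mtopology ?K) (subtopology baire.mtopology ?K) (\<alpha> g)"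
    if g: "g \<in> carrier G" for g
  proof -
    obtain k where k: "homeomorphic_maps ?T (subtopology baire.mtopology ?K) ?\<phi> k"
      using hom(1) homeomorphic_map_maps by blast
    then have hk: "homeomorphic_map (subtopology baire.mtopology ?K) ?T k"
      using homeomorphic_maps_sym homeomorphic_maps_imp_map by blast
    have "homeomorphic_map (subtopology baire.mtopology ?K) (subtopology baire.mtopology ?K) (?\<phi> \<circ> (shift G g \<circ> k))"
      by (intro homeomorphic_map_compose[OF homeomorphic_map_compose[OF hk homeomorphic_map_shift[OF X g]] hom(1)])
    moreover have "(?\<phi> \<circ> (shift G g \<circ> k)) y = \<alpha> g y" if "y \<in> topspace (subtopology baire.mtopology ?K)" for y
    proof -
      from that obtain x where x: "x \<in> X" "y = ?\<phi> x" by auto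
      then have "k y = x" using k top unfolding homeomorphic_maps_def by auto
      then show ?thesis using x \<alpha> by simp
    qed
    ultimately show ?thesis by (rule homeomorphic_map_eq)
  qed
  moreover have "computable_map UNIV baire_dist finite_seq ?K UNIV baire_dist finite_seq (\<alpha> t)" if t: "t \<in> S" for t
  proof -
    obtain c where "?e c = inv t" using free_gens_range(2)[OF fS(1) t] by (metis imageE)
    then show ?thesis using \<alpha> fS(2) t by (intro computable_map_coordinates[OF e]) auto
  qed
  ultimately have ca: "computable_action G UNIV baire_dist finite_seq ?K \<alpha>"
    unfolding computable_action_def using ga S by blast
  have "\<forall>g\<in>carrier G. \<forall>x\<in>topspace ?T. shift G g x \<in> topspace ?T \<and> ?\<phi> (shift G g x) = \<alpha> g (?\<phi> x)"
    using \<alpha> subshift_shift[OF X] top by simp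
  with ca show ?thesis
    unfolding eds_def eds_on_def
    using computable_metric_space_baire recursively_compact_coordinates[OF A X e hom(3) sd] hom(1) by blast
qed

end

section \<open>Computing with basic balls\<close>

text \<open>Finitely many procedures can be combined without being given uniformly in
  \<open>i\<close>.\<close>

lemma semidec_finite_cases:
  fixes P :: "nat \<Rightarrow> 'a::coded \<Rightarrow> bool"
  assumes "\<And>i. i < k \<Longrightarrow> semidec (P i)"
  shows "semidec (\<lambda>p. fst p < k \<and> P (fst p) (snd p))"
  using assms
proof (induction k)
  case 0
  then show ?case using semidec_decidable[OF decidable_const[of False]] by simp
next
  case (Suc k)
  then have "semidec (\<lambda>p. (fst p < k \<and> P (fst p) (snd p)) \<or> (fst p = k \<and> P k (snd p)))"
    by (intro semidec_disj semidec_conj[where P = "\<lambda>p. fst p = k"] semidec_compose[of "P k" snd]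
        semidec_decidable[OF decidable_eq] computable_intros) auto
  moreover have "fst p < Suc k \<and> P (fst p) (snd p) \<longleftrightarrow>
      (fst p < k \<and> P (fst p) (snd p)) \<or> (fst p = k \<and> P k (snd p))" for p
    by (auto simp: less_Suc_eq)
  ultimately show ?case by presburger
qed

text \<open>Even numbers code nonnegative integers and odd ones negative integers, so equal parities
  allow the signs to be cancelled. With unequal parities the rational is at most 0 and can never
  exceed a nonnegative fraction; the denominator 0 then makes the comparison fail.\<close>

definition rat_num :: "nat \<Rightarrow> nat" where
  "rat_num q = (let p = decode q :: nat \<times> nat in
     if even (fst p) \<and> even (snd p) then fst p div 2
     else if \<not> even (fst p) \<and> \<not> even (snd p) then Suc (fst p div 2) else 0)"

definition rat_den :: "nat \<Rightarrow> nat" where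
  "rat_den q = (let p = decode q :: nat \<times> nat in
     if even (fst p) \<and> even (snd p) then snd p div 2
     else if \<not> even (fst p) \<and> \<not> even (snd p) then Suc (snd p div 2) else 0)"

lemma less_nat_to_rat_surj_iff:
  assumes "0 < y"
  shows "real x / real y < of_rat (nat_to_rat_surj q) \<longleftrightarrow> 0 < rat_den q \<and> x * rat_den q < rat_num q * y"
proof -
  obtain a b :: nat where d: "decode q = (a, b)" by fastforce
  then have q: "q = prod_encode (a, b)"
    by (metis code_decode code_prod_def code_nat_def fst_conv snd_conv)
  have val: "of_rat (nat_to_rat_surj q) = (of_int (int_decode a) / of_int (int_decode b) :: real)"
    by (simp add: q nat_to_rat_surj_def Fract_of_int_quotient of_rat_divide)
  have cmp: "real x / real y < real m / real n \<longleftrightarrow> x * n < m * y" if "0 < n" for m n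
  proof -
    have "real x / real y < real m / real n \<longleftrightarrow> real x * real n < real m * real y"
      using assms that by (simp add: field_simps)
    then show ?thesis by (simp flip: of_nat_mult)
  qed
  consider "even a" "even b" | "odd a" "odd b" | "even a \<noteq> even b" by blast
  then show ?thesis
  proof cases
    case 1
    then have "of_rat (nat_to_rat_surj q) = real (a div 2) / real (b div 2)"
      by (simp add: val int_decode_def sum_decode_def)
    then show ?thesis
      using 1 cmp[of "b div 2" "a div 2"] divide_nonneg_nonneg[of "real x" "real y"]
      by (cases "b div 2 = 0") (auto simp: rat_num_def rat_den_def d Let_def not_less)
  next
    case 2
    then have "of_rat (nat_to_rat_surj q) = (- real (a div 2) - 1) / (- real (b div 2) - 1)"
      by (simp add: val int_decode_def sum_decode_def)
    also have "\<dots> = real (Suc (a div 2)) / real (Suc (b div 2))"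
      by (metis (no_types, opaque_lifting) add.commute minus_add_distrib minus_divide_divide of_nat_Suc uminus_add_conv_diff diff_minus_eq_add minus_diff_eq)
    finally show ?thesis
      using 2 cmp[of "Suc (b div 2)" "Suc (a div 2)"] by (auto simp: rat_num_def rat_den_def d Let_def)
  next
    case 3
    then have "of_rat (nat_to_rat_surj q) \<le> (0 :: real)"
      by (auto simp: val int_decode_def sum_decode_def divide_le_0_iff)
    moreover have "0 \<le> real x / real y" by simp
    ultimately have "\<not> real x / real y < of_rat (nat_to_rat_surj q)" by linarith
    then show ?thesis using 3 by (auto simp: rat_den_def d Let_def)
  qed
qed

definition ball_center :: "nat \<Rightarrow> nat" where
  "ball_center n = fst (ball_data n)"

definition radius_num :: "nat \<Rightarrow> nat" where
  "radius_num n = Suc (fst (snd (ball_data n)))"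

definition radius_den :: "nat \<Rightarrow> nat" where
  "radius_den n = Suc (snd (snd (ball_data n)))"

definition ball_radius :: "nat \<Rightarrow> real" where
  "ball_radius n = real (radius_num n) / real (radius_den n)"

lemma basic_ball_eq: "basic_ball M d s n = Metric_space.mball M d (s (ball_center n)) (ball_radius n)"
proof -
  from basic_ball_code[of M d s "fst (ball_data n)" "fst (snd (ball_data n))"
      "snd (snd (ball_data n))"]
  show ?thesis
    by (simp add: ball_center_def ball_radius_def radius_num_def radius_den_def del: of_nat_Suc)
qed

context computable_metric_space
begin

lemma openin_basic_ball: "openin mtopology (basic_ball M d s n)"
  unfolding basic_ball_eq by (rule openin_mball)

lemma small_basic_ball:
  assumes y: "y \<in> M" and \<epsilon>: "0 < \<epsilon>"
  obtains n where "y \<in> basic_ball M d s n" "ball_radius n < \<epsilon>"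
proof -
  obtain b where b: "1 / real (Suc b) < \<epsilon>"
    using reals_Archimedean[OF \<epsilon>] by (auto simp: inverse_eq_divide)
  have "y \<in> Abstract_Topology.closure_of mtopology (range s)" using y s_dense by simp
  moreover have "0 < 1 / real (Suc b)" by simp
  ultimately obtain i where i: "s i \<in> mball y (1 / real (Suc b))"
    unfolding metric_closure_of by blast
  define n where "n = code (i, 0 :: nat, b)"
  have n: "ball_center n = i" "ball_radius n = 1 / real (Suc b)"
    by (simp_all add: n_def ball_center_def ball_radius_def radius_num_def radius_den_def)
  show thesis
    by (rule that[of n]) (use i b in \<open>auto simp: basic_ball_eq n commute\<close>)
qed

lemma compactin_basic_union:
  assumes "compactin mtopology K" "K \<subseteq> basic_union M d s I"
  obtains J where "set J \<subseteq> I" "K \<subseteq> basic_union M d s (set J)"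
proof -
  obtain \<F> where \<F>: "finite \<F>" "\<F> \<subseteq> basic_ball M d s ` I" "K \<subseteq> \<Union>\<F>"
    using assms openin_basic_ball unfolding compactin_def basic_union_def by (metis (no_types, lifting) imageE)
  then obtain F where F: "F \<subseteq> I" "finite F" "\<F> = basic_ball M d s ` F"
    using finite_subset_image by metis
  obtain J where "set J = F" using finite_list[OF F(2)] by blast
  then show thesis using that[of J] F \<F>(3) by (simp add: basic_union_def)
qed

text \<open>By compactness a cover by infinitely many listed balls has a finite subcover, so one
  searches for a finite list of balls together with certificates that they are listed and that they
  cover.\<close>

lemma semidec_covers:
  assumes K: "recursively_compact M d s K" and P: "semidec (\<lambda>p. P (fst p) (snd p))"
  shows "semidec (\<lambda>x. K \<subseteq> basic_union M d s {n. P x n})"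
proof -
  define N where "N = set_encode ` {I. finite I \<and> K \<subseteq> basic_union M d s I}"
  have sN: "semidec (\<lambda>n. n \<in> N)"
    using K unfolding recursively_compact_def N_def re_set_iff_semidec by blast
  have N: "set_code J \<in> N \<longleftrightarrow> K \<subseteq> basic_union M d s (set J)" for J
  proof
    assume "set_code J \<in> N"
    then obtain I where I: "finite I" "K \<subseteq> basic_union M d s I" "set_encode (set J) = set_encode I"
      unfolding N_def set_code_eq by blast
    then have "set J = I" by (metis List.finite_set set_encode_inverse)
    then show "K \<subseteq> basic_union M d s (set J)" using I(2) by simp
  qed (auto simp: N_def set_code_eq)
  have mono: "basic_union M d s I \<subseteq> basic_union M d s I'" if "I \<subseteq> I'" for I I'
    using that by (auto simp: basic_union_def)
  have "K \<subseteq> basic_union M d s {n. P x n} \<longleftrightarrow> (\<exists>J. set_code J \<in> N \<and> (\<forall>n\<in>set J. P x n))" for x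
  proof
    assume "K \<subseteq> basic_union M d s {n. P x n}"
    moreover have "compactin mtopology K" using K by (simp add: recursively_compact_def)
    ultimately obtain J where "set J \<subseteq> {n. P x n}" "K \<subseteq> basic_union M d s (set J)"
      using compactin_basic_union by blast
    then show "\<exists>J. set_code J \<in> N \<and> (\<forall>n\<in>set J. P x n)" using N by blast
  next
    assume "\<exists>J. set_code J \<in> N \<and> (\<forall>n\<in>set J. P x n)"
    then show "K \<subseteq> basic_union M d s {n. P x n}" using N mono by (metis (no_types, lifting) mem_Collect_eq subset_eq)
  qed
  moreover have "semidec (\<lambda>x. \<exists>J. set_code J \<in> N \<and> (\<forall>n\<in>set J. P x n))"
    by (intro semidec_intros semidec_compose[OF sN] semidec_compose2[OF P] computable_intros)
  ultimately show ?thesis by presburger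
qed

text \<open>A sufficient condition for disjointness that depends only on the centres and radii, and
  that approximations of the distance can confirm.\<close>

definition far_apart :: "nat \<Rightarrow> nat \<Rightarrow> bool" where
  "far_apart m n \<longleftrightarrow> ball_radius m + ball_radius n < d (s (ball_center m)) (s (ball_center n))"

text \<open>The strict inequality holds iff some approximation of the distance exceeds the sum of
  the radii by more than its own error bound.\<close>

lemma semidec_far_apart: "semidec (\<lambda>p. far_apart (fst p) (snd p))"
proof -
  obtain f where f: "\<And>i j n. \<exists>r. rec_eval f [i, j, n] r \<and>
      \<bar>d (s i) (s j) - of_rat (nat_to_rat_surj r)\<bar> \<le> 1 / 2 ^ n"
    using computable_dist by blast
  \<comment> \<open>The quotient of \<open>x\<close> by \<open>y\<close> is the error bound plus
    both radii over a common denominator, so the comparison is one between natural numbers.\<close>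
  define y where "y m n k = 2 ^ k * (radius_den m * radius_den n)" for m n k :: nat
  define x where "x m n k = radius_den m * radius_den n +
     2 ^ k * (radius_num m * radius_den n + radius_num n * radius_den m)" for m n k :: nat
  have y: "0 < y m n k" for m n k by (simp add: y_def radius_den_def)
  have xy: "real (x m n k) / real (y m n k) = 1 / 2 ^ k + (ball_radius m + ball_radius n)" for m n k
  proof -
    have *: "(q * v + w * (p * v + u * q)) / (w * (q * v)) = 1 / w + (p / q + u / v)"
      if "0 < q" "0 < v" "0 < w" for p q u v w :: real
      using that by (simp add: field_simps)
    have "0 < real (radius_den m)" "0 < real (radius_den n)" by (simp_all add: radius_den_def)
    from *[OF this, of "2 ^ k" "real (radius_num m)" "real (radius_num n)"]
    show ?thesis by (simp add: x_def y_def ball_radius_def)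
  qed
  define T where "T m n k q \<longleftrightarrow> 0 < rat_den q \<and> x m n k * rat_den q < rat_num q * y m n k" for m n k q
  have T: "T m n k q \<longleftrightarrow> 1 / 2 ^ k + (ball_radius m + ball_radius n) < of_rat (nat_to_rat_surj q)" for m n k q
    using less_nat_to_rat_surj_iff[OF y, of "x m n k" m n k q] unfolding T_def xy by simp
  have "far_apart m n \<longleftrightarrow> (\<exists>k q. rec_eval f [ball_center m, ball_center n, k] q \<and> T m n k q)" for m n
  proof
    assume far: "far_apart m n"
    \<comment> \<open>The gap must exceed twice the error: once for the approximation, once for the
      margin demanded by the test.\<close>
    define \<delta> where "\<delta> = d (s (ball_center m)) (s (ball_center n)) - (ball_radius m + ball_radius n)"
    have "0 < \<delta> / 2" using far by (simp add: far_apart_def \<delta>_def)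
    then obtain k where "(1 / 2 :: real) ^ k < \<delta> / 2" using real_arch_pow_inv[of "\<delta> / 2" "1 / 2"] by auto
    then have k: "2 * (1 / 2 ^ k) < \<delta>" by (simp add: power_divide)
    obtain q where "rec_eval f [ball_center m, ball_center n, k] q"
      "\<bar>d (s (ball_center m)) (s (ball_center n)) - of_rat (nat_to_rat_surj q)\<bar> \<le> 1 / 2 ^ k"
      using f by blast
    moreover from this k have "T m n k q" unfolding T \<delta>_def by linarith
    ultimately show "\<exists>k q. rec_eval f [ball_center m, ball_center n, k] q \<and> T m n k q" by blast
  next
    assume "\<exists>k q. rec_eval f [ball_center m, ball_center n, k] q \<and> T m n k q"
    then obtain k q where kq: "rec_eval f [ball_center m, ball_center n, k] q" "T m n k q" by blast
    obtain r where r: "rec_eval f [ball_center m, ball_center n, k] r"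
      "\<bar>d (s (ball_center m)) (s (ball_center n)) - of_rat (nat_to_rat_surj r)\<bar> \<le> 1 / 2 ^ k"
      using f by blast
    have rq: "r = q" using rec_eval_deterministic[OF kq(1) r(1)] .
    show "far_apart m n" using r(2) kq(2) unfolding T far_apart_def rq by linarith
  qed
  moreover have "semidec (\<lambda>p. \<exists>k q. rec_eval f [ball_center (fst p), ball_center (snd p), k] q \<and>
      T (fst p) (snd p) k q)"
    unfolding T_def x_def y_def rat_num_def rat_den_def Let_def ball_center_def radius_num_def radius_den_def
    by (intro semidec_ex semidec_conj semidec_compose2[OF semidec_rec_eval] semidec_decidable[OF decidable_less]
        computable_intros)
  ultimately show ?thesis by presburger
qed

lemma far_apart_disjoint: "far_apart m n \<Longrightarrow> basic_ball M d s m \<inter> basic_ball M d s n = {}"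
proof (rule ccontr)
  assume far: "far_apart m n" and "basic_ball M d s m \<inter> basic_ball M d s n \<noteq> {}"
  then obtain y where y: "y \<in> mball (s (ball_center m)) (ball_radius m)"
    "y \<in> mball (s (ball_center n)) (ball_radius n)"
    unfolding basic_ball_eq by blast
  then show False
    using triangle[of "s (ball_center m)" y "s (ball_center n)"] commute[of y "s (ball_center n)"] far
    by (simp add: far_apart_def)
qed

text \<open>The enumeration behind a computable self-map of \<open>K\<close>, with the relation
  named so that it can be inverted and composed.\<close>

definition tracks :: "'m set \<Rightarrow> (nat \<Rightarrow> nat \<Rightarrow> bool) \<Rightarrow> ('m \<Rightarrow> 'm) \<Rightarrow> bool" where
  "tracks K Q f \<longleftrightarrow> semidec (\<lambda>p. Q (fst p) (snd p)) \<and>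
    (\<forall>m. \<forall>x\<in>K. f x \<in> basic_ball M d s m \<longleftrightarrow> (\<exists>n. Q m n \<and> x \<in> basic_ball M d s n))"

text \<open>A point \<open>y\<close> of \<open>K\<close> satisfies \<open>g y \<in> B\<^sub>m\<close> iff \<open>y\<close> has a neighbourhood \<open>B\<^sub>n\<close> such that \<open>K\<close>
  is covered by \<open>B\<^sub>m\<close> and the preimage under \<open>f\<close> of the exterior of \<open>B\<^sub>n\<close>; the latter condition
  is semidecidable because \<open>K\<close> is recursively compact.\<close>

lemma tracks_inverse:
  assumes K: "recursively_compact M d s K"
    and cont: "continuous_map (subtopology mtopology K) (subtopology mtopology K) f"
    and g: "g \<in> K \<rightarrow> K" and gf: "\<And>x. x \<in> K \<Longrightarrow> g (f x) = x" and fg: "\<And>y. y \<in> K \<Longrightarrow> f (g y) = y"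
    and Q: "tracks K Q f"
  shows "\<exists>Q'. tracks K Q' g"
proof -
  have sQ: "semidec (\<lambda>p. Q (fst p) (snd p))" using Q by (simp add: tracks_def)
  define P where "P p j \<longleftrightarrow> j = fst p \<or> (\<exists>l. far_apart (snd p) l \<and> Q l j)" for p :: "nat \<times> nat" and j
  define Q' where "Q' m n \<longleftrightarrow> K \<subseteq> basic_union M d s {j. P (m, n) j}" for m n
  have comp: "compactin mtopology K" using K by (simp add: recursively_compact_def)
  then have KM: "K \<subseteq> M" using compactin_subset_topspace by fastforce
  have fK: "f x \<in> K" if "x \<in> K" for x
    using cont that KM by (auto simp: continuous_map_def Pi_def)
  have "semidec (\<lambda>p. P (fst p) (snd p))"
    unfolding P_def
    by (intro semidec_intros semidec_decidable[OF decidable_eq] computable_intros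
        semidec_compose2[OF semidec_far_apart] semidec_compose2[OF sQ])
  from semidec_covers[OF K this] have "semidec (\<lambda>p. Q' (fst p) (snd p))"
    by (simp add: Q'_def)
  moreover have P: "x \<in> basic_union M d s {j. P (m, n) j} \<longleftrightarrow>
      x \<in> basic_ball M d s m \<or> (\<exists>l. far_apart n l \<and> f x \<in> basic_ball M d s l)" if x: "x \<in> K" for x m n
    using Q x unfolding tracks_def basic_union_def P_def by auto
  moreover have "g y \<in> basic_ball M d s m \<longleftrightarrow> (\<exists>n. Q' m n \<and> y \<in> basic_ball M d s n)" if y: "y \<in> K" for y m
  proof
    assume gy: "g y \<in> basic_ball M d s m"
    \<comment> \<open>The points of \<open>K\<close> that must be excluded as values of
      \<open>g\<close>. Their image under \<open>f\<close> is compact, hence closed, and misses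
      \<open>y\<close>.\<close>
    define L where "L = K - basic_ball M d s m"
    have "closedin (subtopology mtopology K) L"
    proof -
      have "openin (subtopology mtopology K) (K \<inter> basic_ball M d s m)"
        using openin_basic_ball by (auto simp: openin_subtopology)
      then have "closedin (subtopology mtopology K) (topspace (subtopology mtopology K) - (K \<inter> basic_ball M d s m))"
        by (rule openin_closedin_eq[THEN iffD1, THEN conjunct2])
      moreover have "topspace (subtopology mtopology K) - (K \<inter> basic_ball M d s m) = L"
        using KM by (auto simp: L_def)
      ultimately show ?thesis by simp
    qed
    moreover have "compact_space (subtopology mtopology K)" using comp by (rule compact_space_subtopology)
    ultimately have "compactin (subtopology mtopology K) (f ` L)"
      using closedin_compact_space image_compactin[OF _ cont] by blast
    then have "closedin mtopology (f ` L)"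
      using compactin_imp_closedin[OF Hausdorff_space_mtopology] by (simp add: compactin_subtopology)
    then have "openin mtopology (M - f ` L)" by (simp add: closedin_def)
    moreover have "y \<notin> f ` L"
      using gf gy unfolding L_def by force
    ultimately obtain \<epsilon> where \<epsilon>: "0 < \<epsilon>" "mball y \<epsilon> \<subseteq> M - f ` L"
      using y KM unfolding openin_mtopology by blast
    \<comment> \<open>Points \<open>y\<close> and \<open>f x\<close> at distance at least
      \<open>\<epsilon>\<close> lie within \<open>\<epsilon> / 4\<close> of their centres, so these
      are more than \<open>\<epsilon> / 2\<close> apart, which exceeds the sum of two radii below
      \<open>\<epsilon> / 4\<close>.\<close>
    have e4: "0 < \<epsilon> / 4" using \<epsilon> by simp
    obtain n where n: "y \<in> basic_ball M d s n" "ball_radius n < \<epsilon> / 4"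
      using small_basic_ball[OF _ e4] y KM by blast
    have "Q' m n"
      unfolding Q'_def
    proof
      fix x assume x: "x \<in> K"
      show "x \<in> basic_union M d s {j. P (m, n) j}"
        unfolding P[OF x]
      proof (cases "x \<in> basic_ball M d s m")
        case False
        then have "f x \<in> f ` L" using x by (simp add: L_def)
        then have dist: "\<epsilon> \<le> d y (f x)" using \<epsilon>(2) y KM fK[OF x] by fastforce
        obtain l where l: "f x \<in> basic_ball M d s l" "ball_radius l < \<epsilon> / 4"
          using small_basic_ball[OF _ e4] fK[OF x] KM by blast
        have "far_apart n l"
        proof -
          let ?c = "s (ball_center n)" and ?c' = "s (ball_center l)"
          have in_M: "?c \<in> M" "?c' \<in> M" "y \<in> M" "f x \<in> M" using s_in y KM fK[OF x] by auto
          have "d ?c y < \<epsilon> / 4" "d ?c' (f x) < \<epsilon> / 4"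
            using n l by (auto simp: basic_ball_eq)
          moreover have "d y (f x) \<le> d ?c y + d ?c ?c' + d ?c' (f x)"
            using triangle[of y ?c "f x"] triangle[of ?c ?c' "f x"] commute[of y ?c] in_M by simp
          ultimately show ?thesis using dist n(2) l(2) unfolding far_apart_def by linarith
        qed
        then show "x \<in> basic_ball M d s m \<or> (\<exists>l. far_apart n l \<and> f x \<in> basic_ball M d s l)"
          using l(1) by blast
      qed blast
    qed
    with n(1) show "\<exists>n. Q' m n \<and> y \<in> basic_ball M d s n" by blast
  next
    assume "\<exists>n. Q' m n \<and> y \<in> basic_ball M d s n"
    then obtain n where n: "Q' m n" "y \<in> basic_ball M d s n" by blast
    have gy: "g y \<in> K" using g y by blast
    then have "g y \<in> basic_ball M d s m \<or> (\<exists>l. far_apart n l \<and> f (g y) \<in> basic_ball M d s l)"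
      using n(1) P[OF gy] unfolding Q'_def by blast
    then show "g y \<in> basic_ball M d s m"
      using far_apart_disjoint n(2) fg[OF y] by fastforce
  qed
  ultimately show ?thesis unfolding tracks_def by blast
qed

text \<open>Openness gives balls that do not leave \<open>Z\<close> within \<open>K\<close>;
  compactness leaves finitely many of them.\<close>

lemma clopen_basic_union:
  assumes K: "K \<subseteq> M" and Z: "openin (subtopology mtopology K) Z" "compactin mtopology Z"
  obtains J where "basic_union M d s (set J) \<inter> K = Z"
proof -
  obtain U where U: "openin mtopology U" "Z = U \<inter> K"
    using Z(1) by (auto simp: openin_subtopology)
  define I where "I = {n. basic_ball M d s n \<subseteq> U}"
  have "Z \<subseteq> basic_union M d s I"
  proof
    fix y assume "y \<in> Z"
    then have "y \<in> U" "y \<in> M" using U K by auto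
    then obtain \<epsilon> where \<epsilon>: "0 < \<epsilon>" "mball y \<epsilon> \<subseteq> U" using U(1) unfolding openin_mtopology by blast
    then have "0 < \<epsilon> / 2" by simp
    then obtain n where n: "y \<in> basic_ball M d s n" "ball_radius n < \<epsilon> / 2"
      using small_basic_ball[OF \<open>y \<in> M\<close>] by blast
    have "basic_ball M d s n \<subseteq> mball y \<epsilon>"
    proof
      fix z assume z: "z \<in> basic_ball M d s n"
      then show "z \<in> mball y \<epsilon>"
        using n triangle[of y "s (ball_center n)" z] commute[of y "s (ball_center n)"]
        by (simp add: basic_ball_eq)
    qed
    then show "y \<in> basic_union M d s I" using n(1) \<epsilon>(2) unfolding basic_union_def I_def by blast
  qed
  then obtain J where J: "set J \<subseteq> I" "Z \<subseteq> basic_union M d s (set J)"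
    using compactin_basic_union[OF Z(2)] by blast
  have "basic_union M d s (set J) \<subseteq> U" using J(1) unfolding basic_union_def I_def by blast
  then show thesis using that[of J] J(2) U(2) by blast
qed

end


section \<open>Symbolic effective dynamical systems are effectively closed by patterns\<close>

text \<open>A path of ball indices from \<open>n\<close> to \<open>m\<close> with one step for each
  letter, the first letter being applied first. The list is a certificate for a composition whose
  length varies with the word.\<close>

definition chain :: "(nat \<Rightarrow> nat \<Rightarrow> nat \<Rightarrow> bool) \<Rightarrow> nat list \<Rightarrow> nat \<Rightarrow> nat \<Rightarrow> bool" where
  "chain Q w m n \<longleftrightarrow> (\<exists>l. length l = Suc (length w) \<and> item l 0 = n \<and> item l (length w) = m \<and>
     (\<forall>i<length w. Q (item w i) (item l (Suc i)) (item l i)))"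

lemma semidec_chain:
  assumes "semidec (\<lambda>p. Q (fst p) (fst (snd p)) (snd (snd p)))"
  shows "semidec (\<lambda>p. chain Q (fst p) (fst (snd p)) (snd (snd p)))"
  unfolding chain_def
  by (intro semidec_ex semidec_conj semidec_all_less semidec_decidable[OF decidable_eq] computable_intros
      semidec_compose[OF assms, of "\<lambda>p. (f p, g p, h p)" for f g h, simplified])

lemma chain_Nil: "chain Q [] m n \<longleftrightarrow> m = n"
proof
  assume "m = n"
  then show "chain Q [] m n" unfolding chain_def by (intro exI[of _ "[n]"]) simp
qed (auto simp: chain_def)

lemma chain_Cons: "chain Q (i # w) m n \<longleftrightarrow> (\<exists>k. chain Q w m k \<and> Q i k n)"
proof
  assume "chain Q (i # w) m n"
  then obtain l where l: "length l = Suc (Suc (length w))" "item l 0 = n" "item l (Suc (length w)) = m"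
    "\<forall>j<Suc (length w). Q (item (i # w) j) (item l (Suc j)) (item l j)"
    unfolding chain_def by auto
  then obtain a l' where l': "l = a # l'" "length l' = Suc (length w)" by (cases l) auto
  have "Q i (item l' 0) n" using l(2) l(4)[rule_format, of 0] l' by simp
  moreover have "Q (item w j) (item l' (Suc j)) (item l' j)" if "j < length w" for j
    using l(4)[rule_format, of "Suc j"] that l' by simp
  then have "chain Q w m (item l' 0)"
    unfolding chain_def using l(3) l' by (intro exI[of _ l']) simp
  ultimately show "\<exists>k. chain Q w m k \<and> Q i k n" by blast
next
  assume "\<exists>k. chain Q w m k \<and> Q i k n"
  then obtain k l where l: "Q i k n" "length l = Suc (length w)" "item l 0 = k" "item l (length w) = m"
    "\<forall>j<length w. Q (item w j) (item l (Suc j)) (item l j)"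
    unfolding chain_def by blast
  have "Q (item (i # w) j) (item (n # l) (Suc j)) (item (n # l) j)" if "j < Suc (length w)" for j
    using that l by (cases j) auto
  then show "chain Q (i # w) m n"
    unfolding chain_def using l by (intro exI[of _ "n # l"]) simp
qed

context group
begin

text \<open>Invariance carries the forbidden patterns to all translates. Conversely,
  \<open>X\<close> is closed, so a configuration outside it is separated from \<open>X\<close> by
  its values on finitely many elements.\<close>

lemma avoiding_forbidden:
  assumes X: "subshift G A X" and S: "fin_sym_gen_set G S"
  shows "X = avoiding G A {c \<in> finite_patterns (lists S) A.
    \<not> (\<exists>x\<in>X. \<forall>w\<in>dom c. c w = Some (x (word_val G w)))}" (is "X = avoiding G A ?C")
proof -
  have XA: "X \<subseteq> carrier G \<rightarrow>\<^sub>E A" by (rule subshift_subset[OF X])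
  have fS: "finite S" "S \<subseteq> carrier G" using S by (auto simp: fin_sym_gen_set_def fin_gen_set_def)
  have surj: "\<exists>w\<in>lists S. word_val G w = g" if g: "g \<in> carrier G" for g
  proof -
    obtain u where u: "word_map G (letter G S (\<lambda>s. s)) u = g" using word_map_surj[OF S g] by blast
    obtain w where "w \<in> lists S" "word_map G (letter G S (\<lambda>s. s)) u = word_val G (map (\<lambda>s. s) w)"
      using word_map_letter_eq[OF fS(1)] fS(2) by (metis image_ident)
    then show ?thesis using u by auto
  qed
  have no_cyl: "y \<notin> cylinder G A c" if "y \<in> X" "c \<in> ?C" for y c
    using that unfolding cylinder_def by fastforce
  show ?thesis
  proof
    show "X \<subseteq> avoiding G A ?C"
    proof
      fix x assume x: "x \<in> X"
      have "x \<notin> shift G g ` cylinder G A c" if g: "g \<in> carrier G" and c: "c \<in> ?C" for g c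
      proof
        assume "x \<in> shift G g ` cylinder G A c"
        then obtain y where y: "y \<in> cylinder G A c" "x = shift G g y" by blast
        have "y = shift G (inv g) x"
          using y g by (simp add: shift_shift shift_one[of y A] cylinder_def)
        then have "y \<in> X" using subshift_shift[OF X] g x by simp
        with no_cyl[OF _ c] y(1) show False by blast
      qed
      then show "x \<in> avoiding G A ?C" using x XA unfolding avoiding_def by blast
    qed
    show "avoiding G A ?C \<subseteq> X"
    proof
      fix x assume x: "x \<in> avoiding G A ?C"
      then have xA: "x \<in> carrier G \<rightarrow>\<^sub>E A" by (simp add: avoiding_def)
      show "x \<in> X"
      proof (rule ccontr)
        assume "x \<notin> X"
        moreover have "openin (full_shift G A) ((carrier G \<rightarrow>\<^sub>E A) - X)"
          using X unfolding subshift_def closedin_def by simp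
        ultimately obtain F where F: "finite F" "F \<subseteq> carrier G"
          "\<And>y. y \<in> carrier G \<rightarrow>\<^sub>E A \<Longrightarrow> (\<And>g. g \<in> F \<Longrightarrow> y g = x g) \<Longrightarrow> y \<in> (carrier G \<rightarrow>\<^sub>E A) - X"
          using openin_full_shiftE[of G A _ x] xA by blast
        obtain wd where wd: "\<And>g. g \<in> carrier G \<Longrightarrow> wd g \<in> lists S \<and> word_val G (wd g) = g"
          using surj by metis
        \<comment> \<open>The values of \<open>x\<close> on \<open>F\<close>, placed at one chosen
          spelling of each element; a point of \<open>X\<close> satisfying them would lie in the
          excluded neighbourhood of \<open>x\<close>.\<close>
        define c where "c w = (if w \<in> wd ` F then Some (x (word_val G w)) else None)" for w
        have dom: "dom c = wd ` F" by (auto simp: c_def dom_def split: if_splits)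
        have vF: "word_val G w \<in> F" if "w \<in> wd ` F" for w using that wd F(2) by auto
        have "ran c \<subseteq> A"
          using xA vF F(2) by (fastforce simp: ran_def c_def split: if_splits)
        moreover have "wd ` F \<subseteq> lists S" using wd F(2) by blast
        ultimately have "c \<in> finite_patterns (lists S) A"
          using F(1) dom by (simp add: finite_patterns_def)
        moreover have "\<not> (\<exists>y\<in>X. \<forall>w\<in>dom c. c w = Some (y (word_val G w)))"
        proof
          assume "\<exists>y\<in>X. \<forall>w\<in>dom c. c w = Some (y (word_val G w))"
          then obtain y where y: "y \<in> X" "\<And>w. w \<in> wd ` F \<Longrightarrow> c w = Some (y (word_val G w))"
            unfolding dom by blast
          have "y g = x g" if "g \<in> F" for g
            using y(2)[of "wd g"] wd[of g] that F(2) by (auto simp: c_def)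
          then show False using F(3)[of y] y(1) XA by blast
        qed
        ultimately have c: "c \<in> ?C" by blast
        have "x \<in> cylinder G A c" using xA by (auto simp: cylinder_def dom) (auto simp: c_def)
        then have "x \<in> shift G \<one> ` cylinder G A c"
          using shift_one[OF xA] by (metis image_eqI)
        then show False using x c unfolding avoiding_def by blast
      qed
    qed
  qed
qed

lemma openin_symbol_at_one:
  assumes X: "subshift G A X"
  shows "openin (subtopology (full_shift G A) X) {x \<in> X. P (x \<one>)}"
proof (subst openin_subopen, intro ballI)
  fix x assume x: "x \<in> {x \<in> X. P (x \<one>)}"
  have XA: "X \<subseteq> carrier G \<rightarrow>\<^sub>E A" by (rule subshift_subset[OF X])
  let ?U = "{y \<in> carrier G \<rightarrow>\<^sub>E A. \<forall>g\<in>{\<one>} \<inter> carrier G. y g = x g}"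
  have "openin (full_shift G A) ?U"
    using x XA by (intro openin_full_shift_cylinder) auto
  then have "openin (subtopology (full_shift G A) X) (?U \<inter> X)" by (auto simp: openin_subtopology)
  moreover have "x \<in> ?U \<inter> X" "?U \<inter> X \<subseteq> {x \<in> X. P (x \<one>)}" using x XA by auto
  ultimately show "\<exists>T. openin (subtopology (full_shift G A) X) T \<and> x \<in> T \<and> T \<subseteq> {x \<in> X. P (x \<one>)}" by blast
qed

text \<open>The symbol of \<open>x\<close> at \<open>g\<close> is the symbol at the identity after
  shifting by the inverse of \<open>g\<close>. Violation of a constraint is thus the preimage, under
  finitely many generators and inverses, of one of finitely many clopen sets; a list is forbidden
  iff the preimages for its constraints cover \<open>K\<close>.\<close>

lemma semidec_forbids_of_eds:
  assumes A: "finite A" and X: "subshift G A X"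
    and cms: "computable_metric_space M d s" and rc: "recursively_compact M d s K"
    and S: "fin_gen_set G S" and comp: "\<And>t. t \<in> S \<Longrightarrow> computable_map M d s K M d s (\<alpha> t)"
    and homeo: "\<And>g. g \<in> carrier G \<Longrightarrow> homeomorphic_map (subtopology (Metric_space.mtopology M d) K)
      (subtopology (Metric_space.mtopology M d) K) (\<alpha> g)"
    and hom: "homeomorphic_map (subtopology (full_shift G A) X) (subtopology (Metric_space.mtopology M d) K) \<phi>"
    and equi: "\<And>g x. g \<in> carrier G \<Longrightarrow> x \<in> X \<Longrightarrow> \<phi> (shift G g x) = \<alpha> g (\<phi> x)"
    and e: "\<And>i. e i \<in> carrier G" and e_gen: "\<And>i. i < k \<Longrightarrow> e i \<in> S \<or> inv (e i) \<in> S"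
    and e_one: "\<And>i. k \<le> i \<Longrightarrow> e i = \<one>"
  shows "semidec (forbids X A (word_map G e))"
proof -
  interpret computable_metric_space M d s by fact
  let ?T = "subtopology (full_shift G A) X"
  have XA: "X \<subseteq> carrier G \<rightarrow>\<^sub>E A" by (rule subshift_subset[OF X])
  then have top: "topspace ?T = X" by auto
  have fS: "finite S" "S \<subseteq> carrier G" using S by (auto simp: fin_gen_set_def)
  have cK: "compactin mtopology K" using rc by (simp add: recursively_compact_def)
  then have KM: "K \<subseteq> M" using compactin_subset_topspace by fastforce
  have K: "K = \<phi> ` X"
    using homeomorphic_imp_surjective_map[OF hom] top KM by auto
  have \<alpha>K: "\<alpha> g y \<in> K" if "g \<in> carrier G" "y \<in> K" for g y
    using that equi subshift_shift[OF X] unfolding K by (metis (no_types, lifting) image_iff)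
  have \<alpha>_inv: "\<alpha> (inv g) (\<alpha> g y) = y" "\<alpha> g (\<alpha> (inv g) y) = y" if "g \<in> carrier G" "y \<in> K" for g y
    using that equi[symmetric] subshift_shift[OF X] subshift_shift_inv[OF X] unfolding K by auto
  have gen: "\<exists>Q. tracks K Q (\<alpha> t)" if t: "t \<in> S" for t
  proof -
    obtain R where R: "re_set (prod_encode ` R)"
      "\<And>m. {y \<in> K. \<alpha> t y \<in> basic_ball M d s m} = basic_union M d s {n. (m, n) \<in> R} \<inter> K"
      using comp[OF t] unfolding computable_map_def by blast
    have "code p \<in> prod_encode ` R \<longleftrightarrow> p \<in> R" for p
      using inj_image_mem_iff[OF inj_prod_encode, of p R] by (simp add: code_prod_def code_nat_def)
    moreover have "semidec (\<lambda>p :: nat \<times> nat. code p \<in> prod_encode ` R)"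
      by (rule semidec_compose[OF R(1)[unfolded re_set_iff_semidec]]) (intro computable_intros)
    ultimately have "semidec (\<lambda>p. (fst p, snd p) \<in> R)" by simp
    moreover have "\<alpha> t y \<in> basic_ball M d s m \<longleftrightarrow> (\<exists>n. (m, n) \<in> R \<and> y \<in> basic_ball M d s n)"
      if "y \<in> K" for m y
      using R(2)[of m] that unfolding basic_union_def by blast
    ultimately show ?thesis by (intro exI[of _ "\<lambda>m n. (m, n) \<in> R"]) (simp add: tracks_def)
  qed
  \<comment> \<open>Reading symbols requires the inverses of the letters. If the inverse is a
    generator, computability is given; if only the letter is one, recursive compactness supplies the
    inverse.\<close>
  have gen_inv: "\<exists>Q. tracks K Q (\<alpha> (inv (e i)))" if i: "i < k" for i
    using e_gen[OF i]
  proof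
    assume t: "e i \<in> S"
    obtain Q where Q: "tracks K Q (\<alpha> (e i))" using gen[OF t] by blast
    have cont: "continuous_map (subtopology mtopology K) (subtopology mtopology K) (\<alpha> (e i))"
      by (rule homeomorphic_imp_continuous_map[OF homeo[OF e]])
    have maps: "\<alpha> (inv (e i)) \<in> K \<rightarrow> K" using \<alpha>K e by auto
    show "\<exists>Q. tracks K Q (\<alpha> (inv (e i)))"
      by (rule tracks_inverse[OF rc cont maps \<alpha>_inv(1)[OF e] \<alpha>_inv(2)[OF e] Q])
  qed (rule gen)
  \<comment> \<open>A relation is chosen for each of the finitely many proper letters. All other
    numbers name the identity, whose preimages are described by equality of indices.\<close>
  define Q where "Q i = (if i < k then SOME Q. tracks K Q (\<alpha> (inv (e i))) else (=))" for i
  have Q: "tracks K (Q i) (\<alpha> (inv (e i)))" if "i < k" for i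
    using someI_ex[OF gen_inv[OF that]] that by (simp add: Q_def)
  have sQ: "semidec (\<lambda>p. Q (fst p) (fst (snd p)) (snd (snd p)))"
  proof -
    have "semidec (\<lambda>p. fst p < k \<and> Q (fst p) (fst (snd p)) (snd (snd p)))"
      by (rule semidec_finite_cases[of k "\<lambda>i q. Q i (fst q) (snd q)"]) (use Q in \<open>simp add: tracks_def\<close>)
    moreover have "semidec (\<lambda>p :: nat \<times> nat \<times> nat. k \<le> fst p \<and> fst (snd p) = snd (snd p))"
      by (intro semidec_decidable computable_intros)
    ultimately have "semidec (\<lambda>p. (fst p < k \<and> Q (fst p) (fst (snd p)) (snd (snd p))) \<or>
        (k \<le> fst p \<and> fst (snd p) = snd (snd p)))" by (rule semidec_disj)
    moreover have "(i < k \<and> Q i m n) \<or> (k \<le> i \<and> m = n) \<longleftrightarrow> Q i m n" for i m n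
      by (auto simp: Q_def)
    ultimately show ?thesis by simp
  qed
  have Q_iff: "\<alpha> (inv (e i)) y \<in> basic_ball M d s m \<longleftrightarrow> (\<exists>n. Q i m n \<and> y \<in> basic_ball M d s n)"
    if y: "y \<in> K" for i m y
  proof (cases "i < k")
    case True
    then show ?thesis using Q y by (simp add: tracks_def)
  next
    case False
    obtain x where x: "x \<in> X" "y = \<phi> x" using y K by blast
    then have "\<alpha> \<one> y = y" using equi[OF one_closed x(1)] shift_one[of x A] XA by auto
    then show ?thesis using False e_one by (auto simp: Q_def)
  qed
  have chain_iff: "\<phi> (shift G (inv (word_map G e w)) x) \<in> basic_ball M d s m \<longleftrightarrow>
      (\<exists>n. chain Q w m n \<and> \<phi> x \<in> basic_ball M d s n)" if "x \<in> X" for w m x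
    using that
  proof (induction w arbitrary: x)
    case Nil
    then show ?case using shift_one[of x A] XA by (auto simp: chain_Nil)
  next
    case (Cons i w)
    have c: "word_map G e w \<in> carrier G" using e by simp
    define x' where "x' = shift G (inv (e i)) x"
    have x': "x' \<in> X" using subshift_shift[OF X] e Cons.prems by (simp add: x'_def)
    have "shift G (inv (word_map G e (i # w))) x = shift G (inv (word_map G e w)) x'"
      using c e by (simp add: x'_def shift_shift inv_mult_group)
    then have "\<phi> (shift G (inv (word_map G e (i # w))) x) \<in> basic_ball M d s m \<longleftrightarrow>
        (\<exists>n. chain Q w m n \<and> \<phi> x' \<in> basic_ball M d s n)"
      using Cons.IH[OF x'] by simp
    also have "\<dots> \<longleftrightarrow> (\<exists>n. chain Q w m n \<and> (\<exists>j. Q i n j \<and> \<phi> x \<in> basic_ball M d s j))"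
    proof -
      have "\<phi> x' = \<alpha> (inv (e i)) (\<phi> x)" using equi[OF _ Cons.prems] e by (simp add: x'_def)
      moreover have "\<phi> x \<in> K" using Cons.prems K by blast
      ultimately show ?thesis using Q_iff by simp
    qed
    finally show ?case unfolding chain_Cons by blast
  qed
  have "\<exists>J. basic_union M d s (set J) \<inter> K = \<phi> ` {x \<in> X. to_nat_on A (x \<one>) \<noteq> a}" for a
  proof -
    let ?Z = "{x \<in> X. to_nat_on A (x \<one>) \<noteq> a}"
    have Z: "openin ?T ?Z" by (rule openin_symbol_at_one[OF X])
    have "openin ?T {x \<in> X. to_nat_on A (x \<one>) = a}" by (rule openin_symbol_at_one[OF X])
    moreover have "topspace ?T - ?Z = {x \<in> X. to_nat_on A (x \<one>) = a}" unfolding top by blast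
    ultimately have "closedin ?T ?Z" unfolding closedin_def top by auto
    moreover have "compact_space ?T"
      using X by (intro compact_space_subtopology closedin_compact_space[OF compact_space_full_shift[OF A]])
        (simp add: subshift_def)
    ultimately have "compactin ?T ?Z" by (intro closedin_compact_space)
    then have "compactin (subtopology mtopology K) (\<phi> ` ?Z)"
      by (rule image_compactin[OF _ homeomorphic_imp_continuous_map[OF hom]])
    then have compact: "compactin mtopology (\<phi> ` ?Z)" by (simp add: compactin_subtopology)
    have open': "openin (subtopology mtopology K) (\<phi> ` ?Z)"
      using homeomorphic_map_openness[OF hom, of ?Z] Z top by auto
    obtain J where "basic_union M d s (set J) \<inter> K = \<phi> ` ?Z"
      by (rule clopen_basic_union[OF KM open' compact])
    then show ?thesis by blast
  qed
  then obtain J0 where J0: "\<And>a. basic_union M d s (set (J0 a)) \<inter> K = \<phi> ` {x \<in> X. to_nat_on A (x \<one>) \<noteq> a}"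
    by metis
  have big: "{x \<in> X. to_nat_on A (x \<one>) \<noteq> a} = X" if "card A \<le> a" for a
  proof -
    have "to_nat_on A (x \<one>) < card A" if "x \<in> X" for x
      using that XA by (intro to_nat_on_less[OF A]) auto
    then show ?thesis using that by fastforce
  qed
  \<comment> \<open>Every number from \<open>card A\<close> on codes no symbol and gives the same
    set, all of \<open>X\<close>; one cover is reused there so that \<open>J\<close> is a finite
    table with a constant tail.\<close>
  define J where "J a = (if card A \<le> a then J0 (card A) else J0 a)" for a
  have cJ: "computable J" by (rule computable_finite_support[of "card A" _ "J0 (card A)"]) (simp add: J_def)
  have J: "basic_union M d s (set (J a)) \<inter> K = \<phi> ` {x \<in> X. to_nat_on A (x \<one>) \<noteq> a}" for a
    using J0[of a] J0[of "card A"] big[of a] big[of "card A"] by (simp add: J_def)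
  have inj: "inj_on \<phi> X" using homeomorphic_imp_injective_map[OF hom] top by simp
  \<comment> \<open>A listed ball \<open>n\<close> is one at whose points in \<open>K\<close> some
    constraint of \<open>l\<close> is violated: the chain carries them into a ball of the clopen set
    for a wrong symbol.\<close>
  define P where "P l n \<longleftrightarrow> (\<exists>p\<in>set l. \<exists>m\<in>set (J (snd p)). chain Q (fst p) m n)"
    for l :: "(nat list \<times> nat) list" and n
  have "semidec (\<lambda>p. P (fst p) (snd p))"
    unfolding P_def
    by (intro semidec_bex computable_intros computable_compose[OF cJ]
        semidec_compose[OF semidec_chain[OF sQ], of "\<lambda>p. (f p, g p, h p)" for f g h, simplified])
  from semidec_covers[OF rc this] have "semidec (\<lambda>l. K \<subseteq> basic_union M d s {n. P l n})" .
  moreover have "K \<subseteq> basic_union M d s {n. P l n} \<longleftrightarrow> forbids X A (word_map G e) l" for l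
  proof -
    have "\<phi> x \<in> basic_union M d s {n. P l n} \<longleftrightarrow>
        (\<exists>p\<in>set l. to_nat_on A (x (word_map G e (fst p))) \<noteq> snd p)" if x: "x \<in> X" for x
    proof -
      have entry: "(\<exists>m\<in>set (J a). \<exists>n. chain Q w m n \<and> \<phi> x \<in> basic_ball M d s n) \<longleftrightarrow>
          to_nat_on A (x (word_map G e w)) \<noteq> a" for w a
      proof -
        have c: "word_map G e w \<in> carrier G" using e by simp
        define x' where "x' = shift G (inv (word_map G e w)) x"
        have x': "x' \<in> X" using subshift_shift[OF X] c x by (simp add: x'_def)
        have "(\<exists>m\<in>set (J a). \<exists>n. chain Q w m n \<and> \<phi> x \<in> basic_ball M d s n) \<longleftrightarrow>
            \<phi> x' \<in> basic_union M d s (set (J a))"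
          unfolding basic_union_def x'_def using chain_iff[OF x] by blast
        also have "\<dots> \<longleftrightarrow> \<phi> x' \<in> \<phi> ` {x \<in> X. to_nat_on A (x \<one>) \<noteq> a}"
          using J[of a] x' K by blast
        also have "\<dots> \<longleftrightarrow> to_nat_on A (x' \<one>) \<noteq> a"
          using inj_on_image_mem_iff[OF inj x', of "{x \<in> X. to_nat_on A (x \<one>) \<noteq> a}"] x' by blast
        also have "x' \<one> = x (word_map G e w)" unfolding x'_def by (rule shift_at_one[OF c])
        finally show ?thesis .
      qed
      have "\<phi> x \<in> basic_union M d s {n. P l n} \<longleftrightarrow> (\<exists>p\<in>set l. \<exists>m\<in>set (J (snd p)). \<exists>n.
          chain Q (fst p) m n \<and> \<phi> x \<in> basic_ball M d s n)"
        unfolding basic_union_def P_def by blast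
      then show ?thesis unfolding entry .
    qed
    then show ?thesis unfolding K forbids_def case_prod_beta by blast
  qed
  ultimately show ?thesis by simp
qed

text \<open>The codings are all forbidden patterns over a symmetric generating set: they define
  \<open>X\<close> by \<open>avoiding_forbidden\<close> and are enumerable by
  \<open>semidec_forbids_of_eds\<close>.\<close>

theorem eds_imp_ecp:
  assumes A: "finite A" and X: "subshift G A X"
    and eds: "eds G (subtopology (full_shift G A) X) (shift G)"
  shows "ecp G A X"
proof -
  have XA: "X \<subseteq> carrier G \<rightarrow>\<^sub>E A" by (rule subshift_subset[OF X])
  then have top: "topspace (subtopology (full_shift G A) X) = X" by auto
  from eds obtain M :: "(nat \<Rightarrow> nat) set" and d s K \<alpha> \<phi> where
    cms: "computable_metric_space M d s" and rc: "recursively_compact M d s K" and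
    ca: "computable_action G M d s K \<alpha>" and
    hom: "homeomorphic_map (subtopology (full_shift G A) X) (subtopology (Metric_space.mtopology M d) K) \<phi>" and
    equi: "\<forall>g\<in>carrier G. \<forall>x\<in>X. \<phi> (shift G g x) = \<alpha> g (\<phi> x)"
    unfolding eds_def eds_on_def top by blast
  from ca obtain S where S: "fin_gen_set G S" and comp: "\<And>t. t \<in> S \<Longrightarrow> computable_map M d s K M d s (\<alpha> t)"
    and homeo: "\<And>g. g \<in> carrier G \<Longrightarrow> homeomorphic_map (subtopology (Metric_space.mtopology M d) K)
      (subtopology (Metric_space.mtopology M d) K) (\<alpha> g)"
    unfolding computable_action_def by blast
  have fS: "finite S" "S \<subseteq> carrier G" "generate G S = carrier G" using S by (auto simp: fin_gen_set_def)
  \<comment> \<open>The generators acting computably need not be closed under inverses, whereas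
    pattern codings use words in the generators alone.\<close>
  define T where "T = S \<union> (\<lambda>s. inv s) ` S"
  have fT: "finite T" "T \<subseteq> carrier G" using fS by (auto simp: T_def)
  have "generate G T = carrier G"
    using mono_generate[of S T] fS(3) generate_incl[OF fT(2)] by (auto simp: T_def)
  moreover have "inv t \<in> T" if "t \<in> T" for t using that fS(2) by (auto simp: T_def)
  ultimately have T: "fin_sym_gen_set G T" using fT by (simp add: fin_sym_gen_set_def fin_gen_set_def)
  let ?e = "letter G T (\<lambda>s. s)"
  have e: "?e i \<in> carrier G" for i using fT by (intro letter_closed) auto
  have "?e i \<in> S \<or> inv (?e i) \<in> S" if i: "i < card T" for i
    using from_nat_into_less(1)[OF fT(1) i] i fS(2) by (auto simp: letter_def T_def)
  then have sd: "semidec (forbids X A (word_map G ?e))"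
    using equi by (intro semidec_forbids_of_eds[OF A X cms rc S comp homeo hom _ e, where k = "card T"])
      (auto simp: letter_def)
  let ?C = "{c \<in> finite_patterns (lists T) A. \<not> (\<exists>x\<in>X. \<forall>w\<in>dom c. c w = Some (x (word_val G w)))}"
  have "re_patterns T A ?C"
  proof (rule re_patterns_of_semidec_forbids[OF fT(1) A subset_refl _ _ _ _ sd])
    show "decidable (\<lambda>w :: nat list. True)" by (rule decidable_const)
    show "word_map G ?e (letters_of T w) = word_val G w" if "w \<in> lists T" for w
      using word_map_letters_of[OF fT(1) that, of G "\<lambda>s. s"] by simp
    show "x (word_val G w) \<in> A" if "x \<in> X" "w \<in> lists T" for x w
    proof -
      have "word_val G w \<in> carrier G" using that(2) fT(2) by (intro word_val_closed) auto
      then show ?thesis using that(1) XA by auto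
    qed
  qed simp
  moreover have "?C \<subseteq> finite_patterns (lists T) A" by (rule subsetI) simp
  ultimately show ?thesis
    unfolding ecp_def using T avoiding_forbidden[OF X T] by (intro exI[of _ T] exI[of _ ?C] conjI)
qed

end

theorem corollary7p7:
  fixes G :: "('g, 'b) monoid_scheme"
  assumes "group G"
    and "finitely_generated G"
    and "recursively_presented G"
  shows "(\<forall>(A :: 'a set) X. finite A \<and> subshift G A X \<and> ecp G A X \<longrightarrow> effective G A X) \<and>
    (\<forall>(A :: 'a set) X. finite A \<and> subshift G A X \<longrightarrow>
       (eds G (subtopology (full_shift G A) X) (shift G) \<longleftrightarrow> effective G A X) \<and>
       (effective G A X \<longleftrightarrow> ecp G A X))"
proof -
  interpret group G by fact
  have "effective G A X" if "finite A" "ecp G A X" for A :: "'a set" and X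
    using ecp_imp_effective[OF that assms(3)] .
  then show ?thesis using effective_imp_eds eds_imp_ecp by blast
qed

end
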